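(* Let $\Gamma$ be a tree of diameter $d$, with ambient polynomial ring $Q$. The minimal $Q$-free resolution of $Q/I_\Gamma$ admits the structure of a differential graded algebra if and only if $d\le 4$.
   Context: The diameter of a graph is the number of edges in a longest path. For a graph on vertices $x_1,\ldots,x_n$, $Q=\Bbbk[x_1,\ldots,x_n]$ over a field $\Bbbk$ and the edge ideal $I_\Gamma$ is generated by $x_ix_j$ for edges $\{x_i,x_j\}$. A dg algebra structure on a complex of free $Q$-modules is a unital associative multiplication with $\mathcal{A}_i\mathcal{A}_j\subseteq\mathcal{A}_{i+j}$, $ab=(-1)^{|a||b|}ba$, $a^2=0$ for odd $|a|$, and $\partial(ab)=\partial(a)b+(-1)^{|a|}a\partial(b)$. *)

theory Defs
  imports Main "HOL-Library.Poly_Mapping"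
begin

definition simple_graph :: "'v set set \<Rightarrow> bool" where
  "simple_graph E \<longleftrightarrow> (\<forall>e\<in>E. card e = 2)"

definition adj :: "'v set set \<Rightarrow> 'v \<Rightarrow> 'v \<Rightarrow> bool" where
  "adj E u v \<longleftrightarrow> {u, v} \<in> E"

definition is_path :: "'v set set \<Rightarrow> 'v list \<Rightarrow> bool" where
  "is_path E p \<longleftrightarrow> p \<noteq> [] \<and> distinct p \<and> (\<forall>i. Suc i < length p \<longrightarrow> adj E (p ! i) (p ! Suc i))"

definition connected_graph :: "'v set set \<Rightarrow> bool" where
  "connected_graph E \<longleftrightarrow> (\<forall>u v. \<exists>p. is_path E p \<and> hd p = u \<and> last p = v)"

definition is_cycle :: "'v set set \<Rightarrow> 'v list \<Rightarrow> bool" where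
  "is_cycle E c \<longleftrightarrow> length c \<ge> 3 \<and> is_path E c \<and> adj E (last c) (hd c)"

definition is_tree :: "'v set set \<Rightarrow> bool" where
  "is_tree E \<longleftrightarrow> simple_graph E \<and> connected_graph E \<and> (\<nexists>c. is_cycle E c)"

definition diameter :: "('v::finite) set set \<Rightarrow> nat" where
  "diameter E = Max {length p - 1 | p. is_path E p}"

type_synonym ('v, 'k) mpoly = "('v \<Rightarrow>\<^sub>0 nat) \<Rightarrow>\<^sub>0 'k"

definition var :: "'v \<Rightarrow> ('v, 'k::field) mpoly" where
  "var v = Poly_Mapping.single (Poly_Mapping.single v 1) 1"

definition edge_monomial :: "'v set \<Rightarrow> ('v, 'k::field) mpoly" where
  "edge_monomial e = (\<Prod>v\<in>e. var v)"

definition edge_ideal :: "('v::finite) set set \<Rightarrow> ('v, 'k::field) mpoly set" where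
  "edge_ideal E = {\<Sum>e\<in>E. f e * edge_monomial e | f. True}"

definition total_degree :: "('v::finite \<Rightarrow>\<^sub>0 nat) \<Rightarrow> nat" where
  "total_degree m = (\<Sum>v\<in>UNIV. Poly_Mapping.lookup m v)"

text \<open>p is homogeneous of (integer) degree t; for t < 0 this forces p = 0.\<close>
definition homogeneous :: "('v::finite, 'k::field) mpoly \<Rightarrow> int \<Rightarrow> bool" where
  "homogeneous p t \<longleftrightarrow> (\<forall>m\<in>Poly_Mapping.keys p. int (total_degree m) = t)"

text \<open>A complex F is given by ranks b i (F_i = Q^(b i)), internal degrees of basis
  elements dg i j, and matrices D i (of the differential F_i -> F_(i-1), i >= 1),
  with entry D i r c for row r < b (i-1), column c < b i.
  Elements of F_i are vectors v :: nat => Q with v j = 0 for j >= b i.\<close>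

record 'q cplx =
  rk :: "nat \<Rightarrow> nat"
  dg :: "nat \<Rightarrow> nat \<Rightarrow> int"
  mat :: "nat \<Rightarrow> nat \<Rightarrow> nat \<Rightarrow> 'q"

definition inF :: "('v, 'k::field) mpoly cplx \<Rightarrow> nat \<Rightarrow> (nat \<Rightarrow> ('v, 'k) mpoly) \<Rightarrow> bool" where
  "inF F i v \<longleftrightarrow> (\<forall>j\<ge>rk F i. v j = 0)"

definition dd :: "('v, 'k::field) mpoly cplx \<Rightarrow> nat \<Rightarrow> (nat \<Rightarrow> ('v, 'k) mpoly) \<Rightarrow> (nat \<Rightarrow> ('v, 'k) mpoly)" where
  "dd F i v = (if i = 0 then (\<lambda>_. 0)
     else (\<lambda>r. if r < rk F (i - 1) then (\<Sum>c<rk F i. mat F i r c * v c) else 0))"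

definition is_min_free_res :: "('v::finite) set set \<Rightarrow> ('v, 'k::field) mpoly cplx \<Rightarrow> bool" where
  "is_min_free_res E F \<longleftrightarrow>
     rk F 0 = 1 \<and> dg F 0 0 = 0 \<and>
     (\<forall>i\<ge>1. \<forall>r<rk F (i - 1). \<forall>c<rk F i. homogeneous (mat F i r c) (dg F i c - dg F (i - 1) r)) \<and>
     (\<forall>i\<ge>1. \<forall>r c. r \<ge> rk F (i - 1) \<or> c \<ge> rk F i \<longrightarrow> mat F i r c = 0) \<and>
     {dd F 1 v 0 | v. inF F 1 v} = edge_ideal E \<and>
     (\<forall>i\<ge>1. {v. inF F i v \<and> dd F i v = (\<lambda>_. 0)} = {dd F (Suc i) w | w. inF F (Suc i) w}) \<and>
     (\<forall>i r c. Poly_Mapping.lookup (mat F i r c) 0 = 0)"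

definition is_dga_structure ::
  "('v, 'k::field) mpoly cplx \<Rightarrow> (nat \<Rightarrow> nat \<Rightarrow> (nat \<Rightarrow> ('v, 'k) mpoly) \<Rightarrow> (nat \<Rightarrow> ('v, 'k) mpoly) \<Rightarrow> (nat \<Rightarrow> ('v, 'k) mpoly)) \<Rightarrow> bool" where
  "is_dga_structure F mu \<longleftrightarrow>
     \<comment> \<open>lands in F_(i+j)\<close>
     (\<forall>i j a b. inF F i a \<longrightarrow> inF F j b \<longrightarrow> inF F (i + j) (mu i j a b)) \<and>
     \<comment> \<open>Q-bilinear\<close>
     (\<forall>i j a a' b. inF F i a \<longrightarrow> inF F i a' \<longrightarrow> inF F j b \<longrightarrow>
        mu i j (\<lambda>r. a r + a' r) b = (\<lambda>r. mu i j a b r + mu i j a' b r)) \<and>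
     (\<forall>i j a b b'. inF F i a \<longrightarrow> inF F j b \<longrightarrow> inF F j b' \<longrightarrow>
        mu i j a (\<lambda>r. b r + b' r) = (\<lambda>r. mu i j a b r + mu i j a b' r)) \<and>
     (\<forall>i j q a b. inF F i a \<longrightarrow> inF F j b \<longrightarrow>
        mu i j (\<lambda>r. q * a r) b = (\<lambda>r. q * mu i j a b r) \<and>
        mu i j a (\<lambda>r. q * b r) = (\<lambda>r. q * mu i j a b r)) \<and>
     \<comment> \<open>unital\<close>
     (\<exists>u. inF F 0 u \<and> (\<forall>i a. inF F i a \<longrightarrow> mu 0 i u a = a \<and> mu i 0 a u = a)) \<and>
     \<comment> \<open>associative\<close>
     (\<forall>i j k a b c. inF F i a \<longrightarrow> inF F j b \<longrightarrow> inF F k c \<longrightarrow>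
        mu (i + j) k (mu i j a b) c = mu i (j + k) a (mu j k b c)) \<and>
     \<comment> \<open>graded commutative\<close>
     (\<forall>i j a b. inF F i a \<longrightarrow> inF F j b \<longrightarrow>
        mu i j a b = (\<lambda>r. (-1) ^ (i * j) * mu j i b a r)) \<and>
     \<comment> \<open>squares of odd elements vanish\<close>
     (\<forall>i a. odd i \<longrightarrow> inF F i a \<longrightarrow> mu i i a a = (\<lambda>_. 0)) \<and>
     \<comment> \<open>Leibniz rule\<close>
     (\<forall>i j a b. inF F i a \<longrightarrow> inF F j b \<longrightarrow>
        dd F (i + j) (mu i j a b) =
          (\<lambda>r. mu (i - 1) j (dd F i a) b r + (-1) ^ i * mu i (j - 1) a (dd F j b) r))"

definition admits_dga_structure :: "('v, 'k::field) mpoly cplx \<Rightarrow> bool" where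
  "admits_dga_structure F \<longleftrightarrow> (\<exists>mu. is_dga_structure F mu)"

end

(* Diameter at least 5: the tree has an induced path x1, ..., x6. A suitable chain map from the
   resolution to a resolution of the colon ideal (x4, x1 x2, x2 x3), taken modulo all other
   variables, evaluates the product g1 g5 p of three specific elements in two incompatible ways.
   Only the Leibniz rule and the relation g1 g5 = - g5 g1 enter, so the product need not
   respect internal degrees.

   Diameter at most 4: the tree consists of a centre c, its neighbours Y and leaves X attached to
   Y. The minimal resolution is built by hand from the Taylor complex of the edges {par a, a} and
   the Koszul complex on Y, and embeds, as a subcomplex closed under products, into the product
   of two copies of the Koszul algebra on all variables. All minimal graded resolutions being
   isomorphic, the product transfers to any of them. *)

theory Submission
  imports Defs "HOL-Computational_Algebra.Primes"
begin

section \<open>Polynomials\<close>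

text \<open>Small diameter: let J be the ideal of the edges {par a, a}. As J lies in (Y), the edge
  ideal is the intersection of J + (c) and (Y). Hence the two Koszul algebras: one contains the
  Taylor algebra of J with an exterior variable for c adjoined, the other is the Koszul algebra on
  Y. The minimal resolution maps to both; in general only the pair of maps is injective, and
  associativity and the other axioms are inherited through it. Large diameter: without
  degree-preserving products the argument cannot be restricted to one multidegree. What survives is
  a comparison of a few low coefficients, controlled because differentials have entries without
  constant term. The colon ideal enters because it contains the coefficient of x5 x6 in every
  relation among the five edges. Since the statement concerns all minimal resolutions, existence and
  uniqueness are proved too; existence rests on finite generation of submodules of Q^n, obtained
  from Dickson's lemma.\<close>

lemma poly_sum_monomials:
  fixes p :: "'a \<Rightarrow>\<^sub>0 'b::comm_monoid_add"
  shows "p = (\<Sum>m\<in>Poly_Mapping.keys p. Poly_Mapping.single m (Poly_Mapping.lookup p m))"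
proof (rule poly_mapping_eqI)
  fix k
  have "(\<Sum>m\<in>Poly_Mapping.keys p. Poly_Mapping.lookup (Poly_Mapping.single m (Poly_Mapping.lookup p m)) k)
     = (\<Sum>m\<in>Poly_Mapping.keys p. if m = k then Poly_Mapping.lookup p m else 0)"
    by (intro sum.cong) (auto simp: lookup_single when_def)
  also have "\<dots> = Poly_Mapping.lookup p k"
    by (auto simp: in_keys_iff)
  finally show "Poly_Mapping.lookup p k =
      Poly_Mapping.lookup (\<Sum>m\<in>Poly_Mapping.keys p. Poly_Mapping.single m (Poly_Mapping.lookup p m)) k"
    by (simp add: lookup_sum)
qed

lemma poly_induct_single_add [case_names single add]:
  fixes p :: "'a \<Rightarrow>\<^sub>0 'b::comm_monoid_add"
  assumes s: "\<And>m c. P (Poly_Mapping.single m c)"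
    and a: "\<And>p q. P p \<Longrightarrow> P q \<Longrightarrow> P (p + q)"
  shows "P p"
proof -
  have "P (\<Sum>m\<in>A. Poly_Mapping.single m (Poly_Mapping.lookup p m))" if "finite A" for A
    using that
  proof (induction A rule: finite_induct)
    case empty
    show ?case using s[of undefined 0] by simp
  next
    case (insert x A)
    then show ?case using a s by simp
  qed
  from this[OF finite_keys] show ?thesis
    by (metis poly_sum_monomials)
qed

lemma lookup_single_mult_add:
  fixes p :: "('a::cancel_comm_monoid_add) \<Rightarrow>\<^sub>0 ('b::comm_semiring_1)"
  shows "Poly_Mapping.lookup (Poly_Mapping.single a c * p) (a + m) = c * Poly_Mapping.lookup p m"
proof (induction p rule: poly_induct_single_add)
  case (single m' c')
  have "a + m' = a + m \<longleftrightarrow> m' = m" by auto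
  then show ?case by (simp add: mult_single lookup_single when_def)
qed (simp add: lookup_add algebra_simps)

lemma lookup_single_mult_eq_0:
  fixes p :: "('a::cancel_comm_monoid_add) \<Rightarrow>\<^sub>0 ('b::comm_semiring_1)"
  assumes "\<And>m'. m \<noteq> a + m'"
  shows "Poly_Mapping.lookup (Poly_Mapping.single a c * p) m = 0"
  using assms
  by (induction p rule: poly_induct_single_add)
     (auto simp: mult_single lookup_single when_def lookup_add algebra_simps)

lemma single_mult_cancel:
  fixes p q :: "('a::cancel_comm_monoid_add) \<Rightarrow>\<^sub>0 ('b::comm_semiring_1)"
  assumes "Poly_Mapping.single a 1 * p = Poly_Mapping.single a 1 * q"
  shows "p = q"
  by (rule poly_mapping_eqI) (metis assms lookup_single_mult_add mult_1)

lemma lookup_mult_zero: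
  fixes p q :: "('v \<Rightarrow>\<^sub>0 nat) \<Rightarrow>\<^sub>0 ('b::comm_ring_1)"
  shows "Poly_Mapping.lookup (p * q) 0 = Poly_Mapping.lookup p 0 * Poly_Mapping.lookup q 0"
proof (induction p rule: poly_induct_single_add)
  case (single m c)
  show ?case
  proof (cases "m = 0")
    case True
    then show ?thesis using lookup_single_mult_add[of 0 c q 0] by simp
  next
    case False
    have "0 \<noteq> m + m'" for m'
    proof
      assume e: "0 = m + m'"
      have "Poly_Mapping.lookup m k = 0" for k
        using arg_cong[OF e, of "\<lambda>x. Poly_Mapping.lookup x k"] unfolding lookup_add by simp
      then have "m = 0" by (intro poly_mapping_eqI) simp
      then show False using False by simp
    qed
    then show ?thesis using False by (simp add: lookup_single_mult_eq_0 lookup_single when_def)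
  qed
qed (simp add: lookup_add algebra_simps)

text \<open>The monomials below a single variable are that variable and 1.\<close>

lemma lookup_mult_single_var:
  fixes p q :: "('v \<Rightarrow>\<^sub>0 nat) \<Rightarrow>\<^sub>0 ('b::comm_ring_1)"
  shows "Poly_Mapping.lookup (p * q) (Poly_Mapping.single v 1) =
    Poly_Mapping.lookup p 0 * Poly_Mapping.lookup q (Poly_Mapping.single v 1)
    + Poly_Mapping.lookup p (Poly_Mapping.single v 1) * Poly_Mapping.lookup q 0"
proof (induction p rule: poly_induct_single_add)
  case (single m c)
  let ?v = "Poly_Mapping.single v (1::nat)"
  have v0: "?v \<noteq> 0" by (metis lookup_single_eq lookup_zero zero_neq_one)
  consider "m = 0" | "m = ?v" | "m \<noteq> 0" "m \<noteq> ?v" by blast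
  then show ?case
  proof cases
    case 1
    then show ?thesis using lookup_single_mult_add[of 0 c q ?v] v0
      by (simp add: lookup_single when_def)
  next
    case 2
    then show ?thesis using lookup_single_mult_add[of ?v c q 0] v0
      by (simp add: lookup_single when_def)
  next
    case 3
    have "?v \<noteq> m + m'" for m'
    proof
      assume e: "?v = m + m'"
      have l: "Poly_Mapping.lookup ?v w = Poly_Mapping.lookup m w + Poly_Mapping.lookup m' w" for w
        using arg_cong[OF e, of "\<lambda>x. Poly_Mapping.lookup x w"] unfolding lookup_add .
      have o: "Poly_Mapping.lookup m w = 0" if "w \<noteq> v" for w
        using l[of w] that by (simp add: lookup_single when_def)
      have "Poly_Mapping.lookup m v + Poly_Mapping.lookup m' v = 1"
        using l[of v] by (simp only: lookup_single_eq)
      then consider "Poly_Mapping.lookup m v = 0" | "Poly_Mapping.lookup m v = 1" by linarith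
      then show False
      proof cases
        case 1
        then have "m = 0" using o by (intro poly_mapping_eqI) (metis lookup_zero)
        then show False using 3 by simp
      next
        case 2
        then have "m = ?v" using o
          by (intro poly_mapping_eqI) (auto simp: lookup_single when_def)
        then show False using 3 by simp
      qed
    qed
    then show ?thesis using 3 by (simp add: lookup_single_mult_eq_0 lookup_single when_def)
  qed
qed (simp add: lookup_add algebra_simps)

section \<open>Selection of monomials and substitution of zero for variables\<close>

definition pfilter :: "('a \<Rightarrow> bool) \<Rightarrow> ('a \<Rightarrow>\<^sub>0 'b::zero) \<Rightarrow> ('a \<Rightarrow>\<^sub>0 'b)" where
  "pfilter P p = Poly_Mapping.mapp (\<lambda>k x. if P k then x else 0) p"

lemma lookup_pfilter: "Poly_Mapping.lookup (pfilter P p) m = (if P m then Poly_Mapping.lookup p m else 0)"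
  by (auto simp: pfilter_def lookup_mapp when_def in_keys_iff)

lemma pfilter_add: "pfilter P (p + q) = pfilter P p + pfilter P (q :: _ \<Rightarrow>\<^sub>0 'b::comm_monoid_add)"
  by (rule poly_mapping_eqI) (auto simp: lookup_pfilter lookup_add)

lemma pfilter_zero [simp]: "pfilter P 0 = 0"
  by (rule poly_mapping_eqI) (auto simp: lookup_pfilter)

lemma pfilter_single: "pfilter P (Poly_Mapping.single m c) = (if P m then Poly_Mapping.single m c else 0)"
  by (rule poly_mapping_eqI) (auto simp: lookup_pfilter lookup_single when_def)

lemma pfilter_sum: "pfilter P (\<Sum>i\<in>I. f i) = (\<Sum>i\<in>I. pfilter P (f i :: _ \<Rightarrow>\<^sub>0 'b::comm_monoid_add))"
  by (rule poly_mapping_eqI) (auto simp: lookup_pfilter lookup_sum)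

text \<open>Multiplication by \<open>q\<close> shifts exponents. When every exponent of
  \<open>q\<close> shifts the predicate in the same way, the selection moves to the other factor.
  The two uses are a homogeneous \<open>q\<close>, shifting the total degree, and a single variable,
  shifting the multidegree.\<close>

lemma pfilter_mult:
  fixes p q :: "('a::comm_monoid_add) \<Rightarrow>\<^sub>0 ('b::comm_semiring_1)"
  assumes "\<And>m m'. m' \<in> Poly_Mapping.keys q \<Longrightarrow> P (m + m') \<longleftrightarrow> R m"
  shows "pfilter P (p * q) = pfilter R p * q"
proof (induction p rule: poly_induct_single_add)
  case (single m c)
  have k: "Poly_Mapping.keys (Poly_Mapping.single m c * q) \<subseteq> {m + m' | m'. m' \<in> Poly_Mapping.keys q}"
    using keys_mult[of "Poly_Mapping.single m c" q] by (auto split: if_splits)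
  have "Poly_Mapping.lookup (pfilter P (Poly_Mapping.single m c * q)) k
      = Poly_Mapping.lookup (pfilter R (Poly_Mapping.single m c) * q) k" for k
  proof (cases "k \<in> Poly_Mapping.keys (Poly_Mapping.single m c * q)")
    case True
    then obtain m' where "k = m + m'" "m' \<in> Poly_Mapping.keys q" using k by auto
    then show ?thesis using assms by (auto simp: lookup_pfilter pfilter_single)
  next
    case False
    then show ?thesis by (auto simp: lookup_pfilter pfilter_single in_keys_iff)
  qed
  then show ?case by (rule poly_mapping_eqI)
qed (simp add: pfilter_add algebra_simps)

text \<open>Substitution of 0 for the variables in \<open>S\<close>, hence a ring endomorphism. As a
  selection of monomials it leaves the surviving coefficients untouched, which the coefficient
  comparisons rely on.\<close>

definition kill :: "'v set \<Rightarrow> (('v \<Rightarrow>\<^sub>0 nat) \<Rightarrow>\<^sub>0 'k) \<Rightarrow> (('v \<Rightarrow>\<^sub>0 nat) \<Rightarrow>\<^sub>0 ('k::comm_ring_1))" where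
  "kill S = pfilter (\<lambda>m. \<forall>v\<in>S. Poly_Mapping.lookup m v = 0)"

lemma kill_add: "kill S (p + q) = kill S p + kill S q"
  by (simp add: kill_def pfilter_add)

lemma kill_zero [simp]: "kill S 0 = 0"
  by (simp add: kill_def)

lemma kill_sum: "kill S (\<Sum>i\<in>I. f i) = (\<Sum>i\<in>I. kill S (f i))"
  by (simp add: kill_def pfilter_sum)

lemma kill_mult: "kill S (p * q) = kill S p * kill S q"
proof (induction p rule: poly_induct_single_add)
  case (single m c)
  show ?case
    by (induction q rule: poly_induct_single_add)
       (auto simp: mult_single kill_def pfilter_single lookup_add pfilter_add distrib_left)
qed (simp add: kill_add algebra_simps)

lemma kill_uminus: "kill S (- p) = - kill S p"
  using kill_add[of S "- p" p] by (simp add: eq_neg_iff_add_eq_0)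

lemma kill_var: "kill S (var v) = (if v \<in> S then 0 else var v)"
  by (auto simp: kill_def var_def pfilter_single lookup_single when_def)

lemma lookup_kill:
  "Poly_Mapping.lookup (kill S p) m = (if \<forall>v\<in>S. Poly_Mapping.lookup m v = 0 then Poly_Mapping.lookup p m else 0)"
  by (simp add: kill_def lookup_pfilter)

lemma kill_one: "kill S 1 = 1"
  by (rule poly_mapping_eqI) (auto simp: lookup_kill lookup_one when_def)

lemma single_le_split:
  fixes m :: "'v \<Rightarrow>\<^sub>0 nat"
  assumes "Poly_Mapping.lookup m v \<noteq> 0"
  shows "m = Poly_Mapping.single v 1 + (m - Poly_Mapping.single v 1)"
  using assms by (intro poly_mapping_eqI) (auto simp: lookup_add lookup_minus lookup_single when_def)

lemma lookup_var_mult: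
  fixes p :: "('v, 'k::field) mpoly"
  shows "Poly_Mapping.lookup (var v * p) m =
    (if Poly_Mapping.lookup m v = 0 then 0 else Poly_Mapping.lookup p (m - Poly_Mapping.single v 1))"
proof (cases "Poly_Mapping.lookup m v = 0")
  case True
  then have "m \<noteq> Poly_Mapping.single v 1 + m'" for m' by (auto simp: lookup_add)
  then show ?thesis using True by (simp add: var_def lookup_single_mult_eq_0)
next
  case False
  then have "Poly_Mapping.lookup (var v * p) (Poly_Mapping.single v 1 + (m - Poly_Mapping.single v 1))
      = Poly_Mapping.lookup p (m - Poly_Mapping.single v 1)"
    by (simp add: var_def lookup_single_mult_add)
  then show ?thesis using False single_le_split[OF False] by simp
qed

lemma var_cancel:
  fixes p q :: "('v, 'k::field) mpoly"
  shows "var v * p = var v * q \<longleftrightarrow> p = q"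
  using single_mult_cancel[of "Poly_Mapping.single v 1" p q] by (auto simp: var_def)

lemma var_mult_eq_0: "var v * (p::('v, 'k::field) mpoly) = 0 \<longleftrightarrow> p = 0"
  using var_cancel[of v p 0] by simp

lemma var_split:
  fixes p :: "('v, 'k::field) mpoly"
  obtains q where "p = var v * q + kill {v} p"
proof -
  have "\<exists>q. p = var v * q + kill {v} p"
  proof (induction p rule: poly_induct_single_add)
    case (single m c)
    show ?case
    proof (cases "Poly_Mapping.lookup m v = 0")
      case True
      then show ?thesis by (intro exI[of _ 0]) (simp add: kill_def pfilter_single)
    next
      case False
      then show ?thesis using single_le_split[OF False]
        by (intro exI[of _ "Poly_Mapping.single (m - Poly_Mapping.single v 1) c"])
           (simp add: kill_def pfilter_single var_def mult_single)
    qed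
  next
    case (add p q)
    then obtain a b where "p = var v * a + kill {v} p" "q = var v * b + kill {v} q" by auto
    then have "p + q = var v * (a + b) + kill {v} (p + q)"
      by (metis (no_types, lifting) add.assoc add.commute distrib_left kill_add)
    then show ?case by blast
  qed
  then show ?thesis using that by blast
qed

lemma kill_eq_0_var_dvd:
  fixes p :: "('v, 'k::field) mpoly"
  assumes "kill {v} p = 0"
  obtains q where "p = var v * q"
  using var_split[of p v] assms by auto

text \<open>Distinct variables are coprime: after setting \<open>v\<close> to 0 the left side
  vanishes and \<open>var w\<close> cancels. Together with \<open>var_split\<close> this takes the
  place of unique factorisation.\<close>

lemma var_dvd_var_mult:
  fixes p q :: "('v, 'k::field) mpoly"
  assumes "var v * p = var w * q" "v \<noteq> w"
  obtains r where "q = var v * r"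
proof -
  have "kill {v} (var v * p) = kill {v} (var w * q)" using assms by simp
  then have "(0::('v, 'k) mpoly) * kill {v} p = var w * kill {v} q"
    using assms(2) by (simp only: kill_mult kill_var) simp
  then have "var w * kill {v} q = 0" by simp
  then have "kill {v} q = 0" by (simp add: var_mult_eq_0)
  then show ?thesis using that by (rule kill_eq_0_var_dvd)
qed

subsection \<open>Homogeneous components\<close>

lemma total_degree_add: "total_degree (a + b) = total_degree a + total_degree b"
  by (simp add: total_degree_def lookup_add sum.distrib)

lemma total_degree_zero [simp]: "total_degree 0 = 0"
  by (simp add: total_degree_def)

lemma total_degree_single: "total_degree (Poly_Mapping.single v n) = n"
  by (simp add: total_degree_def lookup_single when_def)

lemma total_degree_eq_0: "total_degree m = 0 \<longleftrightarrow> m = 0"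
  by (auto simp: total_degree_def intro!: poly_mapping_eqI)

definition hcomp :: "int \<Rightarrow> ('v::finite, 'k::field) mpoly \<Rightarrow> ('v, 'k) mpoly" where
  "hcomp t = pfilter (\<lambda>m. int (total_degree m) = t)"

lemma hcomp_zero [simp]: "hcomp t 0 = 0" by (simp add: hcomp_def)
lemma hcomp_sum: "hcomp t (\<Sum>i\<in>I. f i) = (\<Sum>i\<in>I. hcomp t (f i))" by (simp add: hcomp_def pfilter_sum)

lemma lookup_hcomp:
  "Poly_Mapping.lookup (hcomp t p) m = (if int (total_degree m) = t then Poly_Mapping.lookup p m else 0)"
  by (simp add: hcomp_def lookup_pfilter)

lemma homogeneous_alt:
  "homogeneous p t \<longleftrightarrow> (\<forall>m. Poly_Mapping.lookup p m \<noteq> 0 \<longrightarrow> int (total_degree m) = t)"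
  by (auto simp: homogeneous_def in_keys_iff)

lemma homogeneous_hcomp: "homogeneous (hcomp t p) t"
  by (auto simp: homogeneous_alt lookup_hcomp)

lemma hcomp_homogeneous: "homogeneous p t \<Longrightarrow> hcomp s p = (if s = t then p else 0)"
  by (rule poly_mapping_eqI) (auto simp: homogeneous_alt lookup_hcomp)

lemma hcomp_mult: "homogeneous q t \<Longrightarrow> hcomp s (p * q) = hcomp (s - t) p * q"
  unfolding hcomp_def by (rule pfilter_mult) (auto simp: homogeneous_def total_degree_add)

lemma homogeneous_zero [simp]: "homogeneous 0 t" by (simp add: homogeneous_def)

lemma homogeneous_add: "homogeneous p t \<Longrightarrow> homogeneous q t \<Longrightarrow> homogeneous (p + q) t"
  using keys_add[of p q] by (auto simp: homogeneous_def)

lemma homogeneous_uminus: "homogeneous p t \<Longrightarrow> homogeneous (- p) t"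
  by (simp add: homogeneous_alt)

lemma homogeneous_sum: "(\<And>i. i \<in> I \<Longrightarrow> homogeneous (f i) t) \<Longrightarrow> homogeneous (\<Sum>i\<in>I. f i) t"
  by (induction I rule: infinite_finite_induct) (auto intro: homogeneous_add)

lemma homogeneous_mult: "homogeneous p s \<Longrightarrow> homogeneous q t \<Longrightarrow> homogeneous (p * q) (s + t)"
  unfolding homogeneous_def
proof
  fix m assume p: "\<forall>m\<in>Poly_Mapping.keys p. int (total_degree m) = s"
    and q: "\<forall>m\<in>Poly_Mapping.keys q. int (total_degree m) = t" and m: "m \<in> Poly_Mapping.keys (p * q)"
  then obtain a b where "m = a + b" "a \<in> Poly_Mapping.keys p" "b \<in> Poly_Mapping.keys q"
    using keys_mult[of p q] by blast
  then show "int (total_degree m) = s + t" using p q by (simp add: total_degree_add)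
qed

lemma homogeneous_one: "homogeneous 1 0"
  by (simp add: homogeneous_alt lookup_one when_def)

lemma homogeneous_var: "homogeneous (var v) 1"
  by (simp add: homogeneous_def var_def total_degree_single)

lemma homogeneous_prod_var: "homogeneous (\<Prod>v\<in>A. var v) (int (card A))"
proof (induction A rule: infinite_finite_induct)
  case (insert x A)
  then show ?case using homogeneous_mult[OF homogeneous_var[of x] insert.IH] by simp
qed (auto simp: homogeneous_one)

lemma homogeneous_neg_eq_0: "homogeneous p t \<Longrightarrow> t < 0 \<Longrightarrow> p = 0"
  by (rule poly_mapping_eqI) (auto simp: homogeneous_alt)

lemma homogeneous_0_const:
  assumes "homogeneous p 0" "Poly_Mapping.lookup p 0 = 0" shows "p = 0"
  using assms by (intro poly_mapping_eqI) (auto simp: homogeneous_alt total_degree_eq_0)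

section \<open>Uniqueness of minimal graded free resolutions\<close>

text \<open>Elements of a free module are functions on labels vanishing outside the basis
  \<open>B\<close>. Arbitrary labels let the numbered bases of \<open>F\<close> and the set-indexed
  bases of the hand-built resolution share one theory.\<close>

definition vec :: "'b set \<Rightarrow> ('b \<Rightarrow> 'q::zero) \<Rightarrow> bool" where
  "vec B v \<longleftrightarrow> (\<forall>b. b \<notin> B \<longrightarrow> v b = 0)"

definition unitv :: "'b \<Rightarrow> 'b \<Rightarrow> 'q::zero_neq_one" where
  "unitv b = (\<lambda>x. if x = b then 1 else 0)"

text \<open>Linearity is asked on all functions, not only on those supported in a basis, so that
  composites need no membership side conditions.\<close>

definition qlinear :: "(('b \<Rightarrow> 'q::comm_ring_1) \<Rightarrow> ('c \<Rightarrow> 'q)) \<Rightarrow> bool" where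
  "qlinear D \<longleftrightarrow> (\<forall>v w. D (\<lambda>b. v b + w b) = (\<lambda>r. D v r + D w r)) \<and>
     (\<forall>q v. D (\<lambda>b. q * v b) = (\<lambda>r. q * D v r))"

lemma qlinear_add: "qlinear D \<Longrightarrow> D (\<lambda>b. v b + w b) = (\<lambda>r. D v r + D w r)"
  by (simp add: qlinear_def)

lemma qlinear_scale: "qlinear D \<Longrightarrow> D (\<lambda>b. q * v b) = (\<lambda>r. q * D v r)"
  by (simp add: qlinear_def)

lemma qlinear_zero: "qlinear D \<Longrightarrow> D (\<lambda>_. 0) = (\<lambda>_. 0)"
  using qlinear_scale[of D 0 "\<lambda>_. 0"] by simp

lemma qlinear_uminus: "qlinear D \<Longrightarrow> D (\<lambda>b. - v b) = (\<lambda>r. - D v r)"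
  using qlinear_scale[of D "-1" v] by simp

lemma qlinear_diff: "qlinear D \<Longrightarrow> D (\<lambda>b. v b - w b) = (\<lambda>r. D v r - D w r)"
  using qlinear_add[of D v "\<lambda>b. - w b"] qlinear_uminus[of D w] by (simp add: fun_eq_iff)

lemma qlinear_sum:
  assumes "qlinear D"
  shows "D (\<lambda>b. \<Sum>i\<in>I. f i b) = (\<lambda>r. \<Sum>i\<in>I. D (f i) r)"
proof (induction I rule: infinite_finite_induct)
  case (insert x I)
  then show ?case using qlinear_add[OF assms, of "f x" "\<lambda>b. \<Sum>i\<in>I. f i b"] by simp
qed (simp_all add: qlinear_zero[OF assms])

lemma qlinear_comp: "qlinear D \<Longrightarrow> qlinear D' \<Longrightarrow> qlinear (\<lambda>v. D' (D v))"
  by (simp add: qlinear_def)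

lemma vec_zero [simp]: "vec B (\<lambda>_. 0)" by (simp add: vec_def)
lemma vec_unitv: "b \<in> B \<Longrightarrow> vec B (unitv b)" by (auto simp: vec_def unitv_def)
lemma vec_add: "vec B v \<Longrightarrow> vec B w \<Longrightarrow> vec B (\<lambda>b. v b + w b :: 'q::comm_ring_1)" by (simp add: vec_def)
lemma vec_diff: "vec B v \<Longrightarrow> vec B w \<Longrightarrow> vec B (\<lambda>b. v b - w b :: 'q::comm_ring_1)" by (simp add: vec_def)
lemma vec_scale: "vec B v \<Longrightarrow> vec B (\<lambda>b. q * v b :: 'q::comm_ring_1)" by (simp add: vec_def)
lemma vec_sum: "(\<And>i. i \<in> I \<Longrightarrow> vec B (f i)) \<Longrightarrow> vec B (\<lambda>b. \<Sum>i\<in>I. f i b :: 'q::comm_ring_1)"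
  by (simp add: vec_def)

lemma vec_expand:
  assumes "finite B" "vec B v"
  shows "v = (\<lambda>r. \<Sum>b\<in>B. v b * unitv b r :: 'q::comm_ring_1)"
proof
  fix r
  have "(\<Sum>b\<in>B. v b * unitv b r) = (\<Sum>b\<in>B. if b = r then v b else 0)"
    by (intro sum.cong) (auto simp: unitv_def)
  also have "\<dots> = v r" using assms by (simp add: vec_def)
  finally show "v r = (\<Sum>b\<in>B. v b * unitv b r)" by simp
qed

lemma qlinear_expand:
  assumes "finite B" "vec B v" "qlinear D"
  shows "D v = (\<lambda>r. \<Sum>b\<in>B. v b * D (unitv b) r)"
proof -
  have "D v = D (\<lambda>r. \<Sum>b\<in>B. v b * unitv b r)"
    using vec_expand[OF assms(1,2)] by simp
  also have "\<dots> = (\<lambda>r. \<Sum>b\<in>B. D (\<lambda>r. v b * unitv b r) r)"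
    by (rule qlinear_sum[OF assms(3)])
  finally show ?thesis by (simp add: qlinear_scale[OF assms(3)])
qed

definition lincomb :: "'b set \<Rightarrow> ('b \<Rightarrow> 'c \<Rightarrow> 'q::comm_ring_1) \<Rightarrow> ('b \<Rightarrow> 'q) \<Rightarrow> 'c \<Rightarrow> 'q" where
  "lincomb B y v = (\<lambda>r. \<Sum>b\<in>B. v b * y b r)"

lemma qlinear_lincomb: "qlinear (lincomb B y)"
  by (simp add: qlinear_def lincomb_def fun_eq_iff algebra_simps sum.distrib sum_distrib_left)

lemma lincomb_unitv:
  assumes "finite B" "b \<in> B"
  shows "lincomb B y (unitv b) = y b"
proof
  fix r
  have "(\<Sum>x\<in>B. unitv b x * y x r) = (\<Sum>x\<in>B. if x = b then y x r else 0)"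
    by (intro sum.cong) (auto simp: unitv_def)
  then show "lincomb B y (unitv b) r = y b r" using assms by (simp add: lincomb_def)
qed

lemma vec_lincomb: "(\<And>b. b \<in> B \<Longrightarrow> vec C (y b)) \<Longrightarrow> vec C (lincomb B y v)"
  by (simp add: vec_def lincomb_def)

definition hvec :: "('b \<Rightarrow> int) \<Rightarrow> int \<Rightarrow> ('b \<Rightarrow> ('v::finite, 'k::field) mpoly) \<Rightarrow> bool" where
  "hvec \<delta> t v \<longleftrightarrow> (\<forall>b. homogeneous (v b) (t - \<delta> b))"

definition hvcomp :: "('b \<Rightarrow> int) \<Rightarrow> int \<Rightarrow> ('b \<Rightarrow> ('v::finite, 'k::field) mpoly) \<Rightarrow> ('b \<Rightarrow> ('v, 'k) mpoly)" where
  "hvcomp \<delta> t v = (\<lambda>b. hcomp (t - \<delta> b) (v b))"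

definition graded_map :: "'b set \<Rightarrow> ('b \<Rightarrow> int) \<Rightarrow> ('c \<Rightarrow> int) \<Rightarrow>
    (('b \<Rightarrow> ('v::finite, 'k::field) mpoly) \<Rightarrow> ('c \<Rightarrow> ('v, 'k) mpoly)) \<Rightarrow> bool" where
  "graded_map B \<delta> \<xi> D \<longleftrightarrow> (\<forall>b\<in>B. hvec \<xi> (\<delta> b) (D (unitv b)))"

lemma hvec_hvcomp: "hvec \<delta> t (hvcomp \<delta> t v)"
  by (simp add: hvec_def hvcomp_def homogeneous_hcomp)

lemma hvcomp_hvec: "hvec \<delta> t v \<Longrightarrow> hvcomp \<delta> t v = v"
  by (rule ext) (metis hcomp_homogeneous hvcomp_def hvec_def)

lemma vec_hvcomp: "vec B v \<Longrightarrow> vec B (hvcomp \<delta> t v)"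
  by (simp add: vec_def hvcomp_def)

lemma hvec_unitv: "hvec \<delta> (\<delta> b) (unitv b)"
  by (auto simp: hvec_def unitv_def homogeneous_one)

lemma graded_hvcomp:
  assumes "finite B" "qlinear D" "graded_map B \<delta> \<xi> D" "vec B v"
  shows "D (hvcomp \<delta> t v) = hvcomp \<xi> t (D v)"
proof
  fix r
  have "hvcomp \<xi> t (D v) r = (\<Sum>b\<in>B. hcomp (t - \<xi> r) (v b * D (unitv b) r))"
    by (subst qlinear_expand[OF assms(1,4,2)]) (simp add: hvcomp_def hcomp_sum)
  also have "\<dots> = (\<Sum>b\<in>B. hcomp (t - \<delta> b) (v b) * D (unitv b) r)"
  proof (rule sum.cong)
    fix b assume "b \<in> B"
    then have "homogeneous (D (unitv b) r) (\<delta> b - \<xi> r)"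
      using assms(3) by (auto simp: graded_map_def hvec_def)
    from hcomp_mult[OF this, of "t - \<xi> r" "v b"]
    show "hcomp (t - \<xi> r) (v b * D (unitv b) r) = hcomp (t - \<delta> b) (v b) * D (unitv b) r"
      by (simp add: algebra_simps)
  qed simp
  also have "\<dots> = D (hvcomp \<delta> t v) r"
    by (subst qlinear_expand[OF assms(1) vec_hvcomp[OF assms(4)] assms(2)]) (simp add: hvcomp_def)
  finally show "D (hvcomp \<delta> t v) r = hvcomp \<xi> t (D v) r" ..
qed

lemma graded_hvec:
  assumes "finite B" "qlinear D" "graded_map B \<delta> \<xi> D" "vec B v" "hvec \<delta> t v"
  shows "hvec \<xi> t (D v)"
  by (metis assms graded_hvcomp hvcomp_hvec hvec_hvcomp)

lemma graded_map_comp: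
  assumes "finite B'" "qlinear D'" "graded_map B' \<delta>' \<xi> D'" "graded_map B \<delta> \<delta>' D"
    and "\<And>b. b \<in> B \<Longrightarrow> vec B' (D (unitv b))"
  shows "graded_map B \<delta> \<xi> (\<lambda>v. D' (D v))"
  using assms graded_hvec[OF assms(1-3)] by (auto simp: graded_map_def)

text \<open>Projectivity with degrees: each basis element has a preimage, and the component of that
  preimage in the degree of the basis element is again a preimage because \<open>D'\<close>
  preserves degrees.\<close>

lemma ex_graded_lift:
  assumes "finite B" "finite B'" "qlinear D" "qlinear D'"
    and "graded_map B \<delta> \<xi> D" "graded_map B' \<delta>' \<xi> D'"
    and im: "\<And>v. vec B v \<Longrightarrow> \<exists>w. vec B' w \<and> D' w = D v"
  obtains \<alpha> where "qlinear \<alpha>" "\<And>v. vec B' (\<alpha> v)" "graded_map B \<delta> \<delta>' \<alpha>"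
    "\<And>v. vec B v \<Longrightarrow> D' (\<alpha> v) = D v"
proof -
  have "\<exists>w. vec B' w \<and> hvec \<delta>' (\<delta> b) w \<and> D' w = D (unitv b)" if b: "b \<in> B" for b
  proof -
    obtain w where w: "vec B' w" "D' w = D (unitv b)" using im[OF vec_unitv[OF b]] by blast
    have "hvec \<xi> (\<delta> b) (D (unitv b))" using assms(5) b by (simp add: graded_map_def)
    then have "D' (hvcomp \<delta>' (\<delta> b) w) = D (unitv b)"
      using graded_hvcomp[OF assms(2,4,6) w(1)] w(2) by (simp add: hvcomp_hvec)
    then show ?thesis using vec_hvcomp[OF w(1)] hvec_hvcomp by blast
  qed
  then obtain y where y: "\<And>b. b \<in> B \<Longrightarrow> vec B' (y b) \<and> hvec \<delta>' (\<delta> b) (y b) \<and> D' (y b) = D (unitv b)"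
    by metis
  show ?thesis
  proof (rule that[of "lincomb B y"])
    show "qlinear (lincomb B y)" by (rule qlinear_lincomb)
    show "vec B' (lincomb B y v)" for v using y by (intro vec_lincomb) auto
    show "graded_map B \<delta> \<delta>' (lincomb B y)"
      using y assms(1) by (simp add: graded_map_def lincomb_unitv)
    show "D' (lincomb B y v) = D v" if v: "vec B v" for v
    proof -
      have "D' (lincomb B y v) = (\<lambda>r. \<Sum>b\<in>B. v b * D' (lincomb B y (unitv b)) r)"
        by (rule qlinear_expand[OF assms(1) v qlinear_comp[OF qlinear_lincomb assms(4)]])
      also have "\<dots> = (\<lambda>r. \<Sum>b\<in>B. v b * D (unitv b) r)"
        using y assms(1) by (simp add: lincomb_unitv cong: sum.cong)
      also have "\<dots> = D v" by (rule qlinear_expand[OF assms(1) v assms(3), symmetric])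
      finally show ?thesis .
    qed
  qed
qed

text \<open>The kernel lies in the ideal of the variables times the free module, expressed through
  constant terms. By the graded Nakayama lemma this is minimality of the presentation.\<close>

definition minimal_on :: "'b set \<Rightarrow> (('b \<Rightarrow> ('v::finite, 'k::field) mpoly) \<Rightarrow> ('x \<Rightarrow> ('v, 'k) mpoly)) \<Rightarrow> bool" where
  "minimal_on B D \<longleftrightarrow> (\<forall>v b. vec B v \<longrightarrow> D v = (\<lambda>_. 0) \<longrightarrow> Poly_Mapping.lookup (v b) 0 = 0)"

text \<open>\<open>\<gamma>\<close> is a degree-preserving lift of the identity through
  \<open>D\<close>. The predicate is applied to both composites of two comparison maps.\<close>

definition minimal_lift :: "'b set \<Rightarrow> ('b \<Rightarrow> int) \<Rightarrow>
    (('b \<Rightarrow> ('v::finite, 'k::field) mpoly) \<Rightarrow> ('x \<Rightarrow> ('v, 'k) mpoly)) \<Rightarrow>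
    (('b \<Rightarrow> ('v, 'k) mpoly) \<Rightarrow> ('b \<Rightarrow> ('v, 'k) mpoly)) \<Rightarrow> bool" where
  "minimal_lift B \<delta> D \<gamma> \<longleftrightarrow> finite B \<and> qlinear D \<and> qlinear \<gamma> \<and> (\<forall>v. vec B v \<longrightarrow> vec B (\<gamma> v)) \<and>
     graded_map B \<delta> \<delta> \<gamma> \<and> (\<forall>v. vec B v \<longrightarrow> D (\<gamma> v) = D v) \<and> minimal_on B D"

lemma minimal_liftD:
  assumes "minimal_lift B \<delta> D \<gamma>"
  shows "finite B" "qlinear D" "qlinear \<gamma>" "\<And>v. vec B v \<Longrightarrow> vec B (\<gamma> v)"
    "graded_map B \<delta> \<delta> \<gamma>" "\<And>v. vec B v \<Longrightarrow> D (\<gamma> v) = D v"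
    "\<And>v b. vec B v \<Longrightarrow> D v = (\<lambda>_. 0) \<Longrightarrow> Poly_Mapping.lookup (v b) 0 = 0"
  using assms unfolding minimal_lift_def minimal_on_def by simp_all

text \<open>A graded lift of the identity through a minimal presentation is unitriangular with
  respect to the internal degrees.\<close>

lemma minimal_lift_unitriangular:
  assumes L: "minimal_lift B \<delta> D \<gamma>"
    and b: "b \<in> B" "\<delta> b \<le> \<delta> b'"
  shows "\<gamma> (unitv b) b' = (unitv b b' :: ('v::finite, 'k::field) mpoly)"
proof -
  note B = minimal_liftD(1)[OF L] and D = minimal_liftD(2)[OF L] and g = minimal_liftD(3-6)[OF L]
    and min = minimal_liftD(7)[OF L]
  define n where "n = (\<lambda>x. \<gamma> (unitv b) x - unitv b x)"
  have vb: "vec B (unitv b :: 'a \<Rightarrow> ('v, 'k) mpoly)" using b by (simp add: vec_unitv)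
  have v: "vec B n" unfolding n_def by (intro vec_diff g vb)
  have "D n = (\<lambda>_. 0)" unfolding n_def using qlinear_diff[OF D] g(4)[OF vb] by simp
  then have c: "Poly_Mapping.lookup (n b') 0 = 0" by (rule min[OF v])
  have 1: "homogeneous (\<gamma> (unitv b) b') (\<delta> b - \<delta> b')"
    using g(3) b(1) by (simp add: graded_map_def hvec_def)
  have 2: "homogeneous (unitv b b' :: ('v, 'k) mpoly) (\<delta> b - \<delta> b')"
    using hvec_unitv[of \<delta> b] unfolding hvec_def by blast
  have h: "homogeneous (n b') (\<delta> b - \<delta> b')"
    using homogeneous_add[OF 1 homogeneous_uminus[OF 2]] by (simp add: n_def)
  \<comment> \<open>Equal degrees leave only a constant, which minimality excludes; in a negative
    degree there is no nonzero polynomial.\<close>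
  have "n b' = 0"
  proof (cases "\<delta> b = \<delta> b'")
    case True
    then show ?thesis using homogeneous_0_const h c by simp
  next
    case False
    then show ?thesis using homogeneous_neg_eq_0[OF h] b by simp
  qed
  then show ?thesis by (simp add: n_def)
qed

text \<open>At a basis element of largest degree among those with nonzero coefficient,
  unitriangularity makes the coefficients of \<open>v\<close> and \<open>\<gamma> v\<close>
  agree.\<close>

lemma minimal_lift_inj:
  assumes L: "minimal_lift B \<delta> D \<gamma>"
    and v: "vec B v" "\<gamma> v = (\<lambda>_. 0 :: ('v::finite, 'k::field) mpoly)"
  shows "v = (\<lambda>_. 0)"
proof (rule ccontr)
  note B = minimal_liftD(1)[OF L] and D = minimal_liftD(2)[OF L] and g = minimal_liftD(3-6)[OF L]
    and min = minimal_liftD(7)[OF L]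
  assume nz: "v \<noteq> (\<lambda>_. 0)"
  let ?S = "{b \<in> B. v b \<noteq> 0}"
  have "?S \<noteq> {}" using nz v(1) by (auto simp: vec_def)
  then have "Max (\<delta> ` ?S) \<in> \<delta> ` ?S" using B by (intro Max_in) auto
  then obtain b where b: "b \<in> B" "v b \<noteq> 0" and bm: "\<delta> b = Max (\<delta> ` ?S)" by auto
  have mx: "\<delta> b' \<le> \<delta> b" if "b' \<in> B" "v b' \<noteq> 0" for b'
    unfolding bm using that B by (intro Max_ge) auto
  have "\<gamma> v b = (\<Sum>b'\<in>B. v b' * \<gamma> (unitv b') b)"
    by (subst qlinear_expand[OF B v(1) g(1)]) simp
  also have "\<dots> = (\<Sum>b'\<in>B. v b' * unitv b' b)"
  proof (rule sum.cong)
    fix b' assume b': "b' \<in> B"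
    show "v b' * \<gamma> (unitv b') b = v b' * unitv b' b"
    proof (cases "v b' = 0")
      case False
      show ?thesis
        using minimal_lift_unitriangular[OF L b' mx[OF b' False]] by simp
    qed simp
  qed simp
  also have "\<dots> = v b" using vec_expand[OF B v(1)] by metis
  finally show False using v(2) b by simp
qed

text \<open>Induction on the degree of a basis element: \<open>\<gamma> (unitv b)\<close> differs
  from \<open>unitv b\<close> only by basis elements of smaller degree, which are already in the
  image.\<close>

lemma minimal_lift_surj:
  assumes L: "minimal_lift B \<delta> D \<gamma>"
    and w: "vec B (w :: 'b \<Rightarrow> ('v::finite, 'k::field) mpoly)"
  shows "\<exists>v. vec B v \<and> \<gamma> v = w"
proof -
  note B = minimal_liftD(1)[OF L] and D = minimal_liftD(2)[OF L] and g = minimal_liftD(3-6)[OF L]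
    and min = minimal_liftD(7)[OF L]
  let ?m = "Min (\<delta> ` B)"
  have unit: "\<exists>v. vec B v \<and> \<gamma> v = unitv b" if "b \<in> B" for b
    using that
  proof (induction "nat (\<delta> b - ?m)" arbitrary: b rule: less_induct)
    case less
    define n where "n = (\<lambda>x. \<gamma> (unitv b) x - unitv b x)"
    have vb: "vec B (unitv b :: 'b \<Rightarrow> ('v, 'k) mpoly)" using less.prems by (simp add: vec_unitv)
    have vn: "vec B n" unfolding n_def by (intro vec_diff g vb)
    have "\<exists>v. vec B v \<and> (n b' \<noteq> 0 \<longrightarrow> \<gamma> v = unitv b')" if b': "b' \<in> B" for b'
    proof (cases "n b' = 0")
      case False
      have "\<not> \<delta> b \<le> \<delta> b'"
        using minimal_lift_unitriangular[OF L less.prems, of b'] False by (auto simp: n_def)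
      moreover have "?m \<le> \<delta> b'" using B b' by simp
      ultimately have "nat (\<delta> b' - ?m) < nat (\<delta> b - ?m)" by linarith
      then show ?thesis using less.hyps b' by blast
    qed (use vec_zero in blast)
    then obtain y where y: "\<And>b'. b' \<in> B \<Longrightarrow> vec B (y b') \<and> (n b' \<noteq> 0 \<longrightarrow> \<gamma> (y b') = unitv b')"
      by metis
    define v where "v = (\<lambda>x. unitv b x - lincomb B y n x)"
    have "\<gamma> (lincomb B y n) = (\<lambda>r. \<Sum>b'\<in>B. n b' * \<gamma> (lincomb B y (unitv b')) r)"
      by (rule qlinear_expand[OF B vn qlinear_comp[OF qlinear_lincomb g(1)]])
    also have "\<dots> = (\<lambda>r. \<Sum>b'\<in>B. n b' * unitv b' r)"
    proof (intro ext sum.cong)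
      fix r b' assume "b' \<in> B"
      then show "n b' * \<gamma> (lincomb B y (unitv b')) r = n b' * unitv b' r"
        using y[of b'] by (cases "n b' = 0") (simp_all add: lincomb_unitv B)
    qed simp
    also have "\<dots> = n" by (rule vec_expand[OF B vn, symmetric])
    finally have "\<gamma> v = (\<lambda>x. \<gamma> (unitv b) x - n x)"
      unfolding v_def using qlinear_diff[OF g(1)] by simp
    then have "\<gamma> v = unitv b" by (simp add: n_def)
    moreover have "vec B v" unfolding v_def using y by (intro vec_diff vb vec_lincomb) auto
    ultimately show ?case by blast
  qed
  then obtain y where y: "\<And>b. b \<in> B \<Longrightarrow> vec B (y b) \<and> \<gamma> (y b) = unitv b" by metis
  have "\<gamma> (lincomb B y w) = (\<lambda>r. \<Sum>b\<in>B. w b * \<gamma> (lincomb B y (unitv b)) r)"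
    by (rule qlinear_expand[OF B w qlinear_comp[OF qlinear_lincomb g(1)]])
  also have "\<dots> = (\<lambda>r. \<Sum>b\<in>B. w b * unitv b r)"
    using y by (simp add: lincomb_unitv B cong: sum.cong)
  also have "\<dots> = w" by (rule vec_expand[OF B w, symmetric])
  finally show ?thesis using y by (intro exI[of _ "lincomb B y w"] conjI vec_lincomb) auto
qed

text \<open>Each cover lifts through the other. Both composites lift the identity of a minimal
  presentation, hence are bijective.\<close>

lemma minimal_cover_unique:
  fixes D :: "('b \<Rightarrow> ('v::finite, 'k::field) mpoly) \<Rightarrow> ('x \<Rightarrow> ('v, 'k) mpoly)"
    and D' :: "('c \<Rightarrow> ('v, 'k) mpoly) \<Rightarrow> ('x \<Rightarrow> ('v, 'k) mpoly)"
  assumes B: "finite B" "finite B'" and D: "qlinear D" "qlinear D'"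
    and gr: "graded_map B \<delta> \<xi> D" "graded_map B' \<delta>' \<xi> D'"
    and im: "{D v | v. vec B v} = {D' w | w. vec B' w}"
    and min: "minimal_on B D" "minimal_on B' D'"
  obtains \<alpha> where "qlinear \<alpha>" "graded_map B \<delta> \<delta>' \<alpha>" "bij_betw \<alpha> {v. vec B v} {w. vec B' w}"
    "\<And>v. vec B v \<Longrightarrow> D' (\<alpha> v) = D v"
proof -
  have "\<exists>w. vec B' w \<and> D' w = D v" if "vec B v" for v
  proof -
    have "D v \<in> {D' w | w. vec B' w}" unfolding im[symmetric] using that by blast
    then show ?thesis by auto
  qed
  from ex_graded_lift[OF B D gr this] obtain \<alpha> where a: "qlinear \<alpha>" "\<And>v. vec B' (\<alpha> v)"
    "graded_map B \<delta> \<delta>' \<alpha>" "\<And>v. vec B v \<Longrightarrow> D' (\<alpha> v) = D v" by blast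
  have "\<exists>v. vec B v \<and> D v = D' w" if "vec B' w" for w
  proof -
    have "D' w \<in> {D v | v. vec B v}" unfolding im using that by blast
    then show ?thesis by auto
  qed
  from ex_graded_lift[OF B(2,1) D(2,1) gr(2,1) this] obtain \<beta> where b: "qlinear \<beta>" "\<And>w. vec B (\<beta> w)"
    "graded_map B' \<delta>' \<delta> \<beta>" "\<And>w. vec B' w \<Longrightarrow> D (\<beta> w) = D' w" by blast
  have ba: "qlinear (\<lambda>v. \<beta> (\<alpha> v))" "graded_map B \<delta> \<delta> (\<lambda>v. \<beta> (\<alpha> v))"
    using a b B by (auto intro: qlinear_comp graded_map_comp)
  have ab: "qlinear (\<lambda>v. \<alpha> (\<beta> v))" "graded_map B' \<delta>' \<delta>' (\<lambda>v. \<alpha> (\<beta> v))"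
    using a b B by (auto intro: qlinear_comp graded_map_comp)
  have Lba: "minimal_lift B \<delta> D (\<lambda>v. \<beta> (\<alpha> v))"
    using B D ba a b min by (simp add: minimal_lift_def)
  have Lab: "minimal_lift B' \<delta>' D' (\<lambda>v. \<alpha> (\<beta> v))"
    using B D ab a b min by (simp add: minimal_lift_def)
  have inj: "v = v'" if "vec B v" "vec B v'" "\<alpha> v = \<alpha> v'" for v v'
  proof -
    have "\<alpha> (\<lambda>x. v x - v' x) = (\<lambda>_. 0)" using qlinear_diff[OF a(1)] that(3) by simp
    then have "\<beta> (\<alpha> (\<lambda>x. v x - v' x)) = (\<lambda>_. 0)" using qlinear_zero[OF b(1)] by simp
    from minimal_lift_inj[OF Lba vec_diff[OF that(1,2)] this]
    have "(\<lambda>x. v x - v' x) = (\<lambda>_. 0)" .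
    then show ?thesis by (auto simp: fun_eq_iff)
  qed
  have "\<exists>v. vec B v \<and> \<alpha> v = w" if "vec B' w" for w
    using minimal_lift_surj[OF Lab that] b(2) by blast
  then have "bij_betw \<alpha> {v. vec B v} {w. vec B' w}"
    unfolding bij_betw_def inj_on_def using inj a(2) by auto
  then show ?thesis using that a by blast
qed

lemma inF_vec: "inF F i v \<longleftrightarrow> vec {..<rk F i} v"
  by (auto simp: inF_def vec_def not_less)

lemma qlinear_dd: "qlinear (dd F i)"
  by (auto simp: qlinear_def dd_def fun_eq_iff algebra_simps sum.distrib sum_distrib_left)

lemma inF_dd: "inF F (i - 1) (dd F i v)"
  by (auto simp: inF_def dd_def)

lemma dd_unitv:
  assumes "c < rk F (Suc i)"
  shows "dd F (Suc i) (unitv c) r = (if r < rk F i then mat F (Suc i) r c else 0)"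
proof -
  have "(\<Sum>c'<rk F (Suc i). mat F (Suc i) r c' * unitv c c') = (\<Sum>c'<rk F (Suc i). if c' = c then mat F (Suc i) r c' else 0)"
    by (intro sum.cong) (auto simp: unitv_def)
  then show ?thesis using assms by (simp add: dd_def)
qed

lemma graded_dd:
  assumes "is_min_free_res E F"
  shows "graded_map {..<rk F (Suc i)} (dg F (Suc i)) (dg F i) (dd F (Suc i))"
proof -
  have "\<forall>i\<ge>1. \<forall>r<rk F (i - 1). \<forall>c<rk F i. homogeneous (mat F i r c) (dg F i c - dg F (i - 1) r)"
    using assms by (simp add: is_min_free_res_def)
  from this[rule_format, of "Suc i"] show ?thesis
    by (auto simp: graded_map_def hvec_def dd_unitv)
qed

lemma dd_const_zero:
  assumes "is_min_free_res E F"
  shows "Poly_Mapping.lookup (dd F i v r) 0 = 0"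
proof -
  have "Poly_Mapping.lookup (mat F i r c) 0 = 0" for c
    using assms by (simp add: is_min_free_res_def)
  then show ?thesis by (simp add: dd_def lookup_sum lookup_mult_zero)
qed

lemma res_exact:
  assumes "is_min_free_res E F" "inF F (Suc i) v" "dd F (Suc i) v = (\<lambda>_. 0)"
  obtains w where "inF F (Suc (Suc i)) w" "dd F (Suc (Suc i)) w = v"
proof -
  have "\<forall>i\<ge>1. {v. inF F i v \<and> dd F i v = (\<lambda>_. 0)} = {dd F (Suc i) w | w. inF F (Suc i) w}"
    using assms by (simp add: is_min_free_res_def)
  from this[rule_format, of "Suc i"] have "v \<in> {dd F (Suc (Suc i)) w | w. inF F (Suc (Suc i)) w}"
    using assms(2,3) by auto
  then show ?thesis using that by blast
qed

lemma dd_dd_Suc: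
  assumes "is_min_free_res E F" "inF F (Suc (Suc i)) w"
  shows "dd F (Suc i) (dd F (Suc (Suc i)) w) = (\<lambda>_. 0)"
proof -
  have "\<forall>i\<ge>1. {v. inF F i v \<and> dd F i v = (\<lambda>_. 0)} = {dd F (Suc i) w | w. inF F (Suc i) w}"
    using assms by (simp add: is_min_free_res_def)
  from this[rule_format, of "Suc i"]
  have "dd F (Suc (Suc i)) w \<in> {v. inF F (Suc i) v \<and> dd F (Suc i) v = (\<lambda>_. 0)}"
    using assms(2) by auto
  then show ?thesis by simp
qed

lemma minimal_res_unique:
  fixes F :: "('v::finite, 'k::field) mpoly cplx" and B :: "nat \<Rightarrow> 'b set"
    and d :: "nat \<Rightarrow> ('b \<Rightarrow> ('v, 'k) mpoly) \<Rightarrow> ('b \<Rightarrow> ('v, 'k) mpoly)"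
  assumes F: "is_min_free_res E F"
    and B: "\<And>i. finite (B i)" "B 0 = {b0}" "\<delta> 0 b0 = 0"
    and d: "\<And>i. qlinear (d i)" "\<And>i. graded_map (B (Suc i)) (\<delta> (Suc i)) (\<delta> i) (d (Suc i))"
    and d1: "{d 1 v | v. vec (B 1) v} = {v. vec {b0} v \<and> v b0 \<in> edge_ideal E}"
    and ex: "\<And>i. {v. vec (B (Suc i)) v \<and> d (Suc i) v = (\<lambda>_. 0)} = {d (Suc (Suc i)) w | w. vec (B (Suc (Suc i))) w}"
    and min: "\<And>i v b. vec (B (Suc i)) v \<Longrightarrow> Poly_Mapping.lookup (d (Suc i) v b) 0 = 0"
  obtains \<alpha> where "\<And>i. qlinear (\<alpha> i)" "\<And>i. bij_betw (\<alpha> i) {v. inF F i v} {w. vec (B i) w}"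
    "\<And>i v. inF F (Suc i) v \<Longrightarrow> d (Suc i) (\<alpha> (Suc i) v) = \<alpha> i (dd F (Suc i) v)"
proof -
  have rk0: "rk F 0 = 1" "dg F 0 0 = 0" using F by (auto simp: is_min_free_res_def)
  have F1: "{dd F 1 v 0 | v. inF F 1 v} = edge_ideal E" using F by (simp add: is_min_free_res_def)
  \<comment> \<open>The last clause, equality of the images of the next differentials, is what
    \<open>minimal_cover_unique\<close> consumes in the following degree.\<close>
  define P where "P i a \<longleftrightarrow> qlinear a \<and> graded_map {..<rk F i} (dg F i) (\<delta> i) a \<and>
     bij_betw a {v. inF F i v} {w. vec (B i) w} \<and>
     {a (dd F (Suc i) v) | v. inF F (Suc i) v} = {d (Suc i) w | w. vec (B (Suc i)) w}" for i a
  define R where "R i a b \<longleftrightarrow> (\<forall>v. inF F (Suc i) v \<longrightarrow> d (Suc i) (b v) = a (dd F (Suc i) v))" for i a b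
  have "\<exists>\<alpha>. \<forall>i. P i (\<alpha> i) \<and> R i (\<alpha> i) (\<alpha> (Suc i))"
  proof (rule dependent_nat_choice)
    let ?a = "\<lambda>v::nat \<Rightarrow> ('v, 'k) mpoly. \<lambda>b. if b = b0 then v 0 else 0"
    have "qlinear ?a" by (auto simp: qlinear_def fun_eq_iff)
    moreover have "graded_map {..<rk F 0} (dg F 0) (\<delta> 0) ?a"
      using rk0 B by (auto simp: graded_map_def hvec_def unitv_def homogeneous_one)
    moreover have "bij_betw ?a {v. inF F 0 v} {w. vec (B 0) w}"
      unfolding B(2)
      by (rule bij_betw_byWitness[of _ "\<lambda>w n. if n = 0 then w b0 else 0"])
         (auto simp: inF_def vec_def rk0 fun_eq_iff)
    moreover have "{?a (dd F (Suc 0) v) | v. inF F (Suc 0) v} = {d (Suc 0) w | w. vec (B (Suc 0)) w}"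
    proof -
      have "{?a (dd F (Suc 0) v) | v. inF F (Suc 0) v} = {v. vec {b0} v \<and> v b0 \<in> edge_ideal E}"
        (is "?L = ?R")
      proof
        show "?L \<subseteq> ?R" using F1 by (auto simp: vec_def)
        show "?R \<subseteq> ?L"
        proof
          fix w assume w: "w \<in> ?R"
          then obtain v where v: "inF F 1 v" "w b0 = dd F 1 v 0" using F1 by auto
          have "w = ?a (dd F (Suc 0) v)" using w v by (auto simp: vec_def fun_eq_iff)
          then show "w \<in> ?L" using v by auto
        qed
      qed
      then show ?thesis using d1 by simp
    qed
    ultimately show "\<exists>a. P 0 a" unfolding P_def by blast
  next
    fix a :: "(nat \<Rightarrow> ('v, 'k) mpoly) \<Rightarrow> ('b \<Rightarrow> ('v, 'k) mpoly)" and i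
    assume "P i a"
    then have a: "qlinear a" "graded_map {..<rk F i} (dg F i) (\<delta> i) a"
     "bij_betw a {v. inF F i v} {w. vec (B i) w}"
     "{a (dd F (Suc i) v) | v. inF F (Suc i) v} = {d (Suc i) w | w. vec (B (Suc i)) w}"
      by (auto simp: P_def)
    have inFd: "inF F i (dd F (Suc i) v)" for v using inF_dd[of F "Suc i" v] by simp
    have az: "x = (\<lambda>_. 0)" if "inF F i x" "a x = (\<lambda>_. 0)" for x
    proof -
      have "inF F i (\<lambda>_. 0)" by (simp add: inF_def)
      then show ?thesis using a(3) that qlinear_zero[OF a(1)]
        by (auto simp: bij_betw_def inj_on_def)
    qed
    have 1: "qlinear (\<lambda>v. a (dd F (Suc i) v))" by (rule qlinear_comp[OF qlinear_dd a(1)])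
    have 2: "graded_map {..<rk F (Suc i)} (dg F (Suc i)) (\<delta> i) (\<lambda>v. a (dd F (Suc i) v))"
      using inFd by (intro graded_map_comp[OF _ a(1,2) graded_dd[OF F]]) (auto simp: inF_vec)
    have 3: "{a (dd F (Suc i) v) | v. vec {..<rk F (Suc i)} v} = {d (Suc i) w | w. vec (B (Suc i)) w}"
      using a(4) by (simp add: inF_vec)
    have 4: "Poly_Mapping.lookup (v b) 0 = 0" if "vec {..<rk F (Suc i)} v" "a (dd F (Suc i) v) = (\<lambda>_. 0)" for v b
    proof -
      have z: "dd F (Suc i) v = (\<lambda>_. 0)" by (rule az[OF inFd that(2)])
      have v: "inF F (Suc i) v" using that(1) by (simp add: inF_vec)
      obtain w where "dd F (Suc (Suc i)) w = v" by (rule res_exact[OF F v z])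
      then show ?thesis using dd_const_zero[OF F, of "Suc (Suc i)" w b] by simp
    qed
    have 5: "Poly_Mapping.lookup (w b) 0 = 0" if "vec (B (Suc i)) w" "d (Suc i) w = (\<lambda>_. 0)" for w b
    proof -
      have "w \<in> {d (Suc (Suc i)) w | w. vec (B (Suc (Suc i))) w}"
        unfolding ex[symmetric] using that by simp
      then show ?thesis using min by auto
    qed
    have m: "minimal_on {..<rk F (Suc i)} (\<lambda>v. a (dd F (Suc i) v))" "minimal_on (B (Suc i)) (d (Suc i))"
      using 4 5 by (auto simp: minimal_on_def)
    from minimal_cover_unique[OF finite_lessThan B(1) 1 d(1) 2 d(2) 3 m]
    obtain b where b: "qlinear b" "graded_map {..<rk F (Suc i)} (dg F (Suc i)) (\<delta> (Suc i)) b"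
      "bij_betw b {v. vec {..<rk F (Suc i)} v} {w. vec (B (Suc i)) w}"
      "\<And>v. vec {..<rk F (Suc i)} v \<Longrightarrow> d (Suc i) (b v) = a (dd F (Suc i) v)" by blast
    \<comment> \<open>Both sides are the kernel of \<open>d (Suc i)\<close>: exactness of
      \<open>F\<close> is carried over by \<open>b\<close>, exactness of the target is the
      hypothesis \<open>ex\<close>.\<close>
    have "{b (dd F (Suc (Suc i)) v) | v. inF F (Suc (Suc i)) v} = {d (Suc (Suc i)) w | w. vec (B (Suc (Suc i))) w}"
      (is "?L = _")
    proof -
      have "?L = {w. vec (B (Suc i)) w \<and> d (Suc i) w = (\<lambda>_. 0)}" (is "_ = ?R")
      proof
        show "?L \<subseteq> ?R"
        proof
          fix x assume "x \<in> ?L"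
          then obtain v where v: "inF F (Suc (Suc i)) v" "x = b (dd F (Suc (Suc i)) v)" by blast
          have u: "vec {..<rk F (Suc i)} (dd F (Suc (Suc i)) v)"
            using inF_dd[of F "Suc (Suc i)" v] by (simp add: inF_vec)
          have "d (Suc i) x = (\<lambda>_. 0)"
            using b(4)[OF u] v dd_dd_Suc[OF F v(1)] qlinear_zero[OF a(1)] by simp
          moreover have "vec (B (Suc i)) x" using b(3) u v(2) by (auto simp: bij_betw_def)
          ultimately show "x \<in> ?R" by simp
        qed
        show "?R \<subseteq> ?L"
        proof
          fix x assume x: "x \<in> ?R"
          then have "x \<in> b ` {v. vec {..<rk F (Suc i)} v}" using b(3) by (simp add: bij_betw_def)
          then obtain u where u: "vec {..<rk F (Suc i)} u" "x = b u" by blast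
          have "a (dd F (Suc i) u) = (\<lambda>_. 0)" using b(4)[OF u(1)] u(2) x by simp
          then have z: "dd F (Suc i) u = (\<lambda>_. 0)" by (rule az[OF inFd])
          have u1: "inF F (Suc i) u" using u(1) by (simp add: inF_vec)
          obtain v where "inF F (Suc (Suc i)) v" "dd F (Suc (Suc i)) v = u"
            by (rule res_exact[OF F u1 z])
          then show "x \<in> ?L" using u by blast
        qed
      qed
      then show ?thesis using ex by simp
    qed
    then have "P (Suc i) b" using b by (simp add: P_def inF_vec)
    moreover have "R i a b" using b(4) by (simp add: R_def inF_vec)
    ultimately show "\<exists>b. P (Suc i) b \<and> R i a b" by blast
  qed
  then obtain \<alpha> where "\<And>i. P i (\<alpha> i)" "\<And>i. R i (\<alpha> i) (\<alpha> (Suc i))" by blast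
  then show ?thesis by (intro that[of \<alpha>]) (auto simp: P_def R_def)
qed

section \<open>Existence of minimal graded free resolutions\<close>

text \<open>Always move on to an index at which the rest of the sequence attains its
  minimum.\<close>

lemma nat_seq_mono_subseq:
  fixes s :: "nat \<Rightarrow> nat"
  obtains r where "strict_mono (r :: nat \<Rightarrow> nat)" "mono (\<lambda>i. s (r i))"
proof -
  have "\<exists>j>i. \<forall>k\<ge>j. s j \<le> s k" for i
  proof -
    obtain j where "j > i" "\<forall>k. k > i \<longrightarrow> s j \<le> s k"
      using ex_has_least_nat[of "\<lambda>k. k > i" "Suc i" s] by auto
    then show ?thesis by auto
  qed
  then obtain nx where nx: "\<And>i. nx i > i" "\<And>i k. k \<ge> nx i \<Longrightarrow> s (nx i) \<le> s k" by metis
  define r where "r = rec_nat (nx 0) (\<lambda>_. nx)"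
  have r: "r 0 = nx 0" "\<And>n. r (Suc n) = nx (r n)" by (simp_all add: r_def)
  have lt: "r n < r (Suc n)" for n using nx(1) by (simp add: r)
  have "s (r n) \<le> s (r (Suc n))" for n
  proof (cases n)
    case 0
    then show ?thesis using nx(2)[of 0 "r (Suc 0)"] lt[of 0] by (simp add: r)
  next
    case (Suc k)
    then show ?thesis using nx(2)[of "r k" "r (Suc n)"] lt[of n] by (simp add: r)
  qed
  then show ?thesis using that[of r] lt by (simp add: strict_mono_Suc_iff mono_iff_le_Suc)
qed

lemma multi_mono_subseq:
  fixes s :: "nat \<Rightarrow> 'i \<Rightarrow> nat"
  assumes "finite V"
  shows "\<exists>r. strict_mono (r :: nat \<Rightarrow> nat) \<and> (\<forall>v\<in>V. mono (\<lambda>i. s (r i) v))"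
  using assms
proof (induction V rule: finite_induct)
  case empty
  show ?case by (intro exI[of _ id]) (auto simp: strict_mono_def)
next
  case (insert x V)
  then obtain r where r: "strict_mono (r :: nat \<Rightarrow> nat)" "\<forall>v\<in>V. mono (\<lambda>i. s (r i) v)" by blast
  obtain g where g: "strict_mono (g :: nat \<Rightarrow> nat)" "mono (\<lambda>i. s (r (g i)) x)"
    by (rule nat_seq_mono_subseq[of "\<lambda>i. s (r i) x"])
  have "strict_mono (\<lambda>i. r (g i))" using r(1) g(1) by (simp add: strict_mono_def)
  moreover have "mono (\<lambda>i. s (r (g i)) v)" if "v \<in> V" for v
    using r(2) that g(1) by (auto simp: mono_def strict_mono_less_eq)
  ultimately show ?case using g(2) by (intro exI[of _ "\<lambda>i. r (g i)"]) auto
qed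

lemma dickson:
  fixes f :: "nat \<Rightarrow> ('v::finite \<Rightarrow>\<^sub>0 nat)"
  assumes "\<And>i. c i < (n::nat)"
  obtains i j d where "i < j" "c i = c j" "f j = f i + d"
proof -
  \<comment> \<open>The component \<open>c i\<close> enters both as \<open>c i\<close> and as
    \<open>n - c i\<close>; a subsequence along which both are monotone has constant
    component.\<close>
  define s where "s i x = (case x of Inl v \<Rightarrow> Poly_Mapping.lookup (f i) v
    | Inr b \<Rightarrow> if b then c i else n - c i)" for i and x :: "'v + bool"
  obtain r where r: "strict_mono (r :: nat \<Rightarrow> nat)" "\<forall>x\<in>UNIV. mono (\<lambda>i. s (r i) x)"
    using multi_mono_subseq[of "UNIV :: ('v + bool) set" s] by auto
  have m: "s (r 0) x \<le> s (r 1) x" for x using r(2) by (auto simp: mono_def)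
  have lt: "r 0 < r 1" using r(1) by (simp add: strict_mono_def)
  have "c (r 0) = c (r 1)"
    using m[of "Inr True"] m[of "Inr False"] assms[of "r 0"] assms[of "r 1"] by (simp add: s_def)
  moreover have "f (r 1) = f (r 0) + (f (r 1) - f (r 0))"
    by (rule poly_mapping_eqI) (use m[of "Inl _"] in \<open>auto simp: s_def lookup_add lookup_minus\<close>)
  ultimately show ?thesis using that lt by blast
qed

text \<open>Goedel numbering of the terms of a free module: a multiplicative injection into the
  naturals is a monomial well-order.\<close>

lemma ex_term_code:
  obtains N :: "nat \<Rightarrow> ('v::finite \<Rightarrow>\<^sub>0 nat) \<Rightarrow> nat" and K :: "('v \<Rightarrow>\<^sub>0 nat) \<Rightarrow> nat"
  where "\<And>c m c' m'. N c m = N c' m' \<Longrightarrow> c = c' \<and> m = m'"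
    "\<And>d. K d > 0" "\<And>c m d. N c (m + d) = N c m * K d"
proof -
  have "infinite {p::nat. prime p}" by (rule primes_infinite)
  then obtain f :: "nat \<Rightarrow> nat" where f: "inj f" "range f \<subseteq> {p. prime p}"
    by (meson infinite_countable_subset)
  obtain h :: "'v option \<Rightarrow> nat" where h: "inj h"
    using finite_imp_inj_to_nat_seg[of "UNIV :: 'v option set"] by auto
  define g where "g = f \<circ> h"
  have g: "inj g" "\<And>x. prime (g x)" using f h by (auto simp: g_def intro: inj_compose)
  define e where "e c m x = (case x of None \<Rightarrow> c | Some v \<Rightarrow> Poly_Mapping.lookup m v)"
    for c :: nat and m :: "'v \<Rightarrow>\<^sub>0 nat" and x
  define N where "N c m = (\<Prod>x\<in>UNIV. g x ^ e c m x)" for c m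
  have mult: "multiplicity (g x) (N c m) = e c m x" for x c m
  proof -
    have "N c m = (\<Prod>p\<in>range g. p ^ e c m (inv g p))"
      unfolding N_def using g(1) by (subst prod.reindex) simp_all
    then show ?thesis
      using multiplicity_prod_prime_powers[of "range g" "g x" "\<lambda>p. e c m (inv g p)"] g by auto
  qed
  define K where "K d = N 0 d" for d
  show ?thesis
  proof (rule that[of N K])
    fix c m c' m' assume eq: "N c m = N c' m'"
    then have ee: "e c m x = e c' m' x" for x using mult by metis
    have "c = c'" using ee[of None] by (simp add: e_def)
    moreover have "m = m'" using ee[of "Some _"] by (intro poly_mapping_eqI) (simp add: e_def)
    ultimately show "c = c' \<and> m = m'" ..
  next
    show "K d > 0" for d
      unfolding K_def N_def using g(2) by (intro prod_pos) (simp add: prime_gt_0_nat)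
  next
    fix c m d
    have "e c (m + d) x = e c m x + e 0 d x" for x
      by (cases x) (simp_all add: e_def lookup_add)
    then show "N c (m + d) = N c m * K d"
      by (simp add: N_def K_def power_add prod.distrib)
  qed
qed

section \<open>Submodules of Q^n, their finite generation and their homogeneous generators\<close>

definition submodule_of :: "nat \<Rightarrow> (nat \<Rightarrow> 'q::comm_ring_1) set \<Rightarrow> bool" where
  "submodule_of n N \<longleftrightarrow> (\<forall>v\<in>N. vec {..<n} v) \<and> (\<lambda>_. 0) \<in> N \<and>
     (\<forall>v\<in>N. \<forall>w\<in>N. (\<lambda>r. v r + w r) \<in> N) \<and> (\<forall>q. \<forall>v\<in>N. (\<lambda>r. q * v r) \<in> N)"

lemma submodule_add: "submodule_of n N \<Longrightarrow> v \<in> N \<Longrightarrow> w \<in> N \<Longrightarrow> (\<lambda>r. v r + w r) \<in> N"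
  by (simp add: submodule_of_def)

lemma submodule_sum:
  assumes "submodule_of n N" "\<And>i. i \<in> I \<Longrightarrow> f i \<in> N"
  shows "(\<lambda>r. \<Sum>i\<in>I. q i * f i r) \<in> N"
  using assms(2)
proof (induction I rule: infinite_finite_induct)
  case (insert x I)
  then have "(\<lambda>r. q x * f x r) \<in> N" "(\<lambda>r. \<Sum>i\<in>I. q i * f i r) \<in> N"
    using assms(1) by (auto simp: submodule_of_def)
  then have "(\<lambda>r. (\<lambda>r. q x * f x r) r + (\<lambda>r. \<Sum>i\<in>I. q i * f i r) r) \<in> N"
    by (intro submodule_add[OF assms(1)])
  then show ?case using insert by simp
qed (use assms(1) in \<open>auto simp: submodule_of_def\<close>)

definition spanned :: "('b \<Rightarrow> 'q::comm_ring_1) set \<Rightarrow> ('b \<Rightarrow> 'q) set" where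
  "spanned W = range (lincomb W (\<lambda>w. w))"

lemma spanned_in: "submodule_of n N \<Longrightarrow> W \<subseteq> N \<Longrightarrow> spanned W \<subseteq> N"
  unfolding spanned_def lincomb_def by (auto intro!: submodule_sum)

lemma spanned_zero: "(\<lambda>_. 0) \<in> spanned W"
  unfolding spanned_def by (rule image_eqI[of _ _ "\<lambda>_. 0"]) (simp_all add: lincomb_def)

lemma spanned_add: "v \<in> spanned W \<Longrightarrow> w \<in> spanned W \<Longrightarrow> (\<lambda>r. v r + w r) \<in> spanned W"
  unfolding spanned_def by (auto simp: qlinear_add[OF qlinear_lincomb, symmetric])

lemma spanned_scale: "v \<in> spanned W \<Longrightarrow> (\<lambda>r. q * v r) \<in> spanned W"
  unfolding spanned_def by (auto simp: qlinear_scale[OF qlinear_lincomb, symmetric])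

lemma spanned_sum:
  assumes "\<And>i. i \<in> I \<Longrightarrow> f i \<in> spanned W"
  shows "(\<lambda>r. \<Sum>i\<in>I. q i * f i r) \<in> spanned W"
  using assms
proof (induction I rule: infinite_finite_induct)
  case (insert x I)
  then have "(\<lambda>r. (\<lambda>r. q x * f x r) r + (\<lambda>r. \<Sum>i\<in>I. q i * f i r) r) \<in> spanned W"
    by (intro spanned_add spanned_scale) auto
  then show ?case using insert by simp
qed (auto simp: spanned_zero)

lemma spanned_superset: "finite W \<Longrightarrow> w \<in> W \<Longrightarrow> w \<in> spanned W"
  unfolding spanned_def using lincomb_unitv[of W w "\<lambda>w. w"] by (metis rangeI)

text \<open>A Groebner-style argument: keep adding an element outside the span whose leading term
  has least code. By Dickson's lemma some leading term divides a later one in the same component;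
  subtracting the multiple gives an element still outside the span but with smaller leading
  term.\<close>

lemma noetherian:
  fixes N :: "(nat \<Rightarrow> ('v::finite, 'k::field) mpoly) set"
  assumes N: "submodule_of n N"
  obtains W where "finite W" "W \<subseteq> N" "spanned W = N"
proof (rule ccontr)
  assume contra: "\<not> thesis"
  note gen = that
  have ne: "N - spanned W \<noteq> {}" if W: "finite W" "W \<subseteq> N" for W
  proof
    assume "N - spanned W = {}"
    then have "spanned W = N" using spanned_in[OF N W(2)] by blast
    then show False using contra gen[OF W] by simp
  qed
  obtain C :: "nat \<Rightarrow> ('v \<Rightarrow>\<^sub>0 nat) \<Rightarrow> nat" and K where
    C: "\<And>c m c' m'. C c m = C c' m' \<Longrightarrow> c = c' \<and> m = m'"
    and K: "\<And>d. K d > 0" "\<And>c m d. C c (m + d) = C c m * K d"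
    by (rule ex_term_code) blast
  define T where "T v = {(c, m). c < n \<and> Poly_Mapping.lookup (v c) m \<noteq> 0}"
    for v :: "nat \<Rightarrow> ('v, 'k) mpoly"
  have fT: "finite (T v)" for v
  proof -
    have "T v = Sigma {..<n} (\<lambda>c. Poly_Mapping.keys (v c))"
      by (auto simp: T_def in_keys_iff)
    then show ?thesis by simp
  qed
  \<comment> \<open>\<open>L v\<close> is the code of the leading term. Codes are natural numbers,
    so least choices exist, and multiplication by a monomial scales them by
    \<open>K d\<close>.\<close>
  define L where "L v = Max (case_prod C ` T v)" for v
  have Lmax: "C c m \<le> L v" if "c < n" "Poly_Mapping.lookup (v c) m \<noteq> 0" for c m v
    unfolding L_def using fT that by (intro Max_ge) (auto simp: T_def intro!: image_eqI[of _ _ "(c, m)"])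
  have Lex: "\<exists>c m. c < n \<and> Poly_Mapping.lookup (v c) m \<noteq> 0 \<and> C c m = L v"
    if v: "vec {..<n} v" "v \<noteq> (\<lambda>_. 0)" for v
  proof -
    obtain c where c: "v c \<noteq> 0" using v(2) by auto
    have "c < n" using v(1) c by (metis lessThan_iff vec_def)
    moreover obtain m where "Poly_Mapping.lookup (v c) m \<noteq> 0"
      using c by (metis lookup_zero poly_mapping_eqI)
    ultimately have "T v \<noteq> {}" by (auto simp: T_def)
    then have "L v \<in> case_prod C ` T v" unfolding L_def using fT by (intro Max_in) auto
    then show ?thesis by (auto simp: T_def) blast
  qed
  have "\<exists>v. v \<in> N - spanned W \<and> (\<forall>u \<in> N - spanned W. L v \<le> L u)" if "finite W" "W \<subseteq> N" for W
    using ex_has_least_nat[of "\<lambda>v. v \<in> N - spanned W" _ L] ne[OF that] by blast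
  then obtain pick where pick: "\<And>W. finite W \<Longrightarrow> W \<subseteq> N \<Longrightarrow> pick W \<in> N - spanned W"
    "\<And>W u. finite W \<Longrightarrow> W \<subseteq> N \<Longrightarrow> u \<in> N - spanned W \<Longrightarrow> L (pick W) \<le> L u"
    by metis
  define W where "W = rec_nat {} (\<lambda>_ S. insert (pick S) S)"
  have W0: "W 0 = {}" and WS: "W (Suc i) = insert (pick (W i)) (W i)" for i by (simp_all add: W_def)
  have Wf: "finite (W i) \<and> W i \<subseteq> N" for i
    by (induction i) (use pick(1) in \<open>auto simp: W0 WS\<close>)
  have Wmono: "pick (W i) \<in> W j" if "i < j" for i j
    using that by (induction j) (auto simp: WS less_Suc_eq)
  define v where "v i = pick (W i)" for i
  have vN: "v i \<in> N" "v i \<notin> spanned (W i)" for i using pick(1) Wf by (auto simp: v_def)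
  have "vec {..<n} (v i)" "v i \<noteq> (\<lambda>_. 0)" for i
    using vN(1)[of i] N apply (simp add: submodule_of_def)
    using vN(2)[of i] spanned_zero[of "W i"] by metis
  then have "\<exists>c m. c < n \<and> Poly_Mapping.lookup (v i c) m \<noteq> 0 \<and> C c m = L (v i)" for i
    using Lex by blast
  then obtain c m where cm: "\<And>i. c i < n" "\<And>i. Poly_Mapping.lookup (v i (c i)) (m i) \<noteq> 0"
    "\<And>i. C (c i) (m i) = L (v i)" by metis
  obtain i j d where ij: "i < j" "c i = c j" "m j = m i + d"
    by (rule dickson[of c n m]) (use cm(1) in blast)+
  \<comment> \<open>Chosen so that \<open>u\<close> cancels the leading term of \<open>v j\<close>
    against a monomial multiple of \<open>v i\<close>.\<close>
  define a where "a = Poly_Mapping.lookup (v j (c j)) (m j) / Poly_Mapping.lookup (v i (c i)) (m i)"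
  define u where "u = (\<lambda>r. v j r + Poly_Mapping.single d (- a) * v i r)"
  have sc: "(\<lambda>r. p * v i r) \<in> N" for p using vN(1)[of i] N by (simp add: submodule_of_def)
  have uN: "u \<in> N"
    unfolding u_def by (rule submodule_add[OF N vN(1) sc])
  have vi: "v i \<in> spanned (W j)"
    using Wmono[OF ij(1)] Wf by (intro spanned_superset) (auto simp: v_def)
  have us: "u \<notin> spanned (W j)"
  proof
    assume "u \<in> spanned (W j)"
    from spanned_add[OF this spanned_scale[OF vi, of "Poly_Mapping.single d a"]]
    have "(\<lambda>r. u r + Poly_Mapping.single d a * v i r) \<in> spanned (W j)" .
    moreover have "(\<lambda>r. u r + Poly_Mapping.single d a * v i r) = v j"
      by (simp add: u_def fun_eq_iff algebra_simps single_uminus)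
    ultimately show False using vN(2) by simp
  qed
  have le: "L (v j) \<le> L u" using pick(2)[of "W j" u] Wf uN us by (auto simp: v_def)
  have "u \<noteq> (\<lambda>_. 0)" "vec {..<n} u" using us spanned_zero uN N by (auto simp: submodule_of_def)
  then obtain c' m' where cm': "c' < n" "Poly_Mapping.lookup (u c') m' \<noteq> 0" "C c' m' = L u"
    using Lex by blast
  have "C c' m' \<le> L (v j)"
  proof (cases "Poly_Mapping.lookup (v j c') m' = 0")
    case True
    then have nz: "Poly_Mapping.lookup (Poly_Mapping.single d (- a) * v i c') m' \<noteq> 0"
      using cm'(2) by (simp add: u_def lookup_add)
    then obtain m2 where m2: "m' = d + m2"
      using lookup_single_mult_eq_0[of m' d "- a" "v i c'"] by blast
    then have "Poly_Mapping.lookup (v i c') m2 \<noteq> 0"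
      using nz by (auto simp: lookup_single_mult_add)
    then have "C c' m2 \<le> L (v i)" using Lmax cm'(1) by blast
    then have "C c' m2 * K d \<le> C (c i) (m i) * K d" using cm(3)[of i] by simp
    then show ?thesis using cm(3)[of j] by (simp add: K(2)[symmetric] ij m2 add.commute)
  qed (use Lmax cm'(1) in blast)
  \<comment> \<open>Minimality of the pick bounds the leading code of \<open>u\<close> from below,
    the construction bounds it from above. So the leading term sits where \<open>v j\<close> has its
    own, and there the coefficient of \<open>u\<close> was cancelled.\<close>
  then have "C c' m' = C (c j) (m j)" using le cm'(3) cm(3)[of j] by simp
  then have "c' = c j" "m' = m j" using C by blast+
  moreover have "Poly_Mapping.lookup (u (c j)) (m j) = 0"
    using lookup_single_mult_add[of d "- a" "v i (c j)" "m i"] cm(2)[of i] ij(2,3)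
    by (simp add: u_def lookup_add a_def add.commute)
  ultimately show False using cm'(2) by simp
qed

lemma hvec_decomp:
  fixes v :: "nat \<Rightarrow> ('v::finite, 'k::field) mpoly"
  assumes "vec {..<n} v"
  obtains T where "finite T" "v = (\<lambda>r. \<Sum>t\<in>T. hvcomp \<xi> t v r)"
proof -
  define T where "T = (\<Union>r<n. (\<lambda>m. int (total_degree m) + \<xi> r) ` Poly_Mapping.keys (v r))"
  have "v r = (\<Sum>t\<in>T. hvcomp \<xi> t v r)" for r
  proof (rule poly_mapping_eqI)
    fix m
    have "(\<Sum>t\<in>T. Poly_Mapping.lookup (hvcomp \<xi> t v r) m)
        = (\<Sum>t\<in>T. if t = int (total_degree m) + \<xi> r then Poly_Mapping.lookup (v r) m else 0)"
      by (intro sum.cong) (auto simp: lookup_hcomp hvcomp_def)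
    also have "\<dots> = Poly_Mapping.lookup (v r) m"
    proof (cases "Poly_Mapping.lookup (v r) m = 0")
      case False
      then have "v r \<noteq> 0" by auto
      then have "r < n" using assms by (metis lessThan_iff vec_def)
      then have "int (total_degree m) + \<xi> r \<in> T"
        unfolding T_def using False by (auto simp: in_keys_iff intro!: bexI[of _ r] image_eqI[of _ _ m])
      moreover have "finite T" by (simp add: T_def)
      ultimately show ?thesis by simp
    qed (simp add: sum.neutral)
    finally show "Poly_Mapping.lookup (v r) m = Poly_Mapping.lookup (\<Sum>t\<in>T. hvcomp \<xi> t v r) m"
      by (simp add: lookup_sum)
  qed
  then have "v = (\<lambda>r. \<Sum>t\<in>T. hvcomp \<xi> t v r)" by (rule ext)
  moreover have "finite T" by (simp add: T_def)
  ultimately show ?thesis using that by blast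
qed

definition graded_submodule :: "nat \<Rightarrow> (nat \<Rightarrow> int) \<Rightarrow> (nat \<Rightarrow> ('v::finite, 'k::field) mpoly) set \<Rightarrow> bool" where
  "graded_submodule n \<xi> N \<longleftrightarrow> submodule_of n N \<and> (\<forall>v\<in>N. \<forall>t. hvcomp \<xi> t v \<in> N)"

lemma homogeneous_generators:
  assumes N: "graded_submodule n \<xi> N"
  obtains W where "finite W" "W \<subseteq> N" "spanned W = N" "\<forall>w\<in>W. \<exists>t. hvec \<xi> t w"
proof -
  have sN: "submodule_of n N" using N by (simp add: graded_submodule_def)
  obtain W where W: "finite W" "W \<subseteq> N" "spanned W = N" by (rule noetherian[OF sN])
  have "\<exists>T. finite T \<and> w = (\<lambda>r. \<Sum>t\<in>T. hvcomp \<xi> t w r)" if "w \<in> W" for w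
  proof -
    have "vec {..<n} w" using that W(2) sN by (auto simp: submodule_of_def)
    from hvec_decomp[OF this] show ?thesis by metis
  qed
  then obtain T where T: "\<And>w. w \<in> W \<Longrightarrow> finite (T w)"
    "\<And>w. w \<in> W \<Longrightarrow> w = (\<lambda>r. \<Sum>t\<in>T w. hvcomp \<xi> t w r)" by metis
  define W' where "W' = (\<Union>w\<in>W. (\<lambda>t. hvcomp \<xi> t w) ` T w)"
  have f: "finite W'" using W(1) T(1) by (auto simp: W'_def)
  have s: "W' \<subseteq> N" using W(2) N by (auto simp: W'_def graded_submodule_def)
  have "w \<in> spanned W'" if "w \<in> W" for w
  proof -
    have "(\<lambda>r. \<Sum>t\<in>T w. 1 * hvcomp \<xi> t w r) \<in> spanned W'"
      using f that by (intro spanned_sum spanned_superset) (auto simp: W'_def)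
    then show ?thesis using T(2)[OF that] by simp
  qed
  then have "spanned W \<subseteq> spanned W'"
    unfolding spanned_def[of W] lincomb_def by (auto intro!: spanned_sum)
  then have "spanned W' = N" using spanned_in[OF sN s] W(3) by auto
  moreover have "\<forall>w\<in>W'. \<exists>t. hvec \<xi> t w" using hvec_hvcomp by (auto simp: W'_def)
  ultimately show ?thesis using that f s by blast
qed

text \<open>A homogeneous generating set of least cardinality is minimal: a relation with a constant
  coefficient would, in the appropriate degree, express one generator through the others.\<close>

lemma minimal_generators:
  fixes N :: "(nat \<Rightarrow> ('v::finite, 'k::field) mpoly) set"
  assumes N: "graded_submodule n \<xi> N"
  obtains k :: nat and t w where "\<forall>c<k. hvec \<xi> (t c) (w c) \<and> w c \<in> N"
    "N = {lincomb {..<k} w q | q. vec {..<k} q}" "minimal_on {..<k} (lincomb {..<k} w)"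
proof -
  define G where "G W \<longleftrightarrow> finite W \<and> W \<subseteq> N \<and> spanned W = N \<and> (\<forall>w\<in>W. \<exists>t. hvec \<xi> t w)" for W
  obtain W0 where "G W0" unfolding G_def by (rule homogeneous_generators[OF N]) blast
  then obtain W where W: "G W" "\<And>W'. G W' \<Longrightarrow> card W \<le> card W'"
    using ex_has_least_nat[of G W0 card] by blast
  have fW: "finite W" "W \<subseteq> N" "spanned W = N" using W by (auto simp: G_def)
  obtain \<tau> where \<tau>: "\<And>w. w \<in> W \<Longrightarrow> hvec \<xi> (\<tau> w) w" using W(1) unfolding G_def by metis
  let ?D = "lincomb W (\<lambda>w. w)"
  have gr: "graded_map W \<tau> \<xi> ?D" using \<tau> fW(1) by (simp add: graded_map_def lincomb_unitv)
  have min: "Poly_Mapping.lookup (q w0) 0 = 0" if q: "vec W q" "?D q = (\<lambda>_. 0)" for q w0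
  proof (rule ccontr)
    assume nz: "Poly_Mapping.lookup (q w0) 0 \<noteq> 0"
    then have w0: "w0 \<in> W" using q(1) by (auto simp: vec_def)
    \<comment> \<open>In the degree of \<open>w0\<close> the coefficient of \<open>w0\<close> is a
      nonzero constant, so the relation can be solved for \<open>w0\<close>.\<close>
    define p where "p = hvcomp \<tau> (\<tau> w0) q"
    have Dp: "?D p = (\<lambda>_. 0)"
      unfolding p_def graded_hvcomp[OF fW(1) qlinear_lincomb gr q(1)] q(2) by (simp add: hvcomp_def)
    define a where "a = Poly_Mapping.lookup (q w0) 0"
    have pw0: "p w0 = Poly_Mapping.single 0 a"
      by (rule poly_mapping_eqI)
         (auto simp: p_def hvcomp_def lookup_hcomp a_def lookup_single when_def total_degree_eq_0)
    have "w0 r = (\<Sum>w\<in>W - {w0}. (- Poly_Mapping.single 0 (1 / a) * p w) * w r)" for r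
    proof -
      have "0 = (\<Sum>w\<in>W. p w * w r)" using fun_cong[OF Dp, of r] by (simp add: lincomb_def)
      also have "\<dots> = Poly_Mapping.single 0 a * w0 r + (\<Sum>w\<in>W - {w0}. p w * w r)"
        using fW(1) w0 by (simp add: sum.remove[of W w0] pw0)
      finally have "Poly_Mapping.single 0 a * w0 r = - (\<Sum>w\<in>W - {w0}. p w * w r)"
        by (simp add: eq_neg_iff_add_eq_0)
      then have "Poly_Mapping.single 0 (1 / a) * (Poly_Mapping.single 0 a * w0 r)
          = Poly_Mapping.single 0 (1 / a) * - (\<Sum>w\<in>W - {w0}. p w * w r)" by (rule arg_cong)
      moreover have "Poly_Mapping.single 0 (1 / a) * (Poly_Mapping.single 0 a * w0 r) = w0 r"
        using nz unfolding mult.assoc[symmetric] mult_single by (simp add: a_def)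
      ultimately show ?thesis by (simp add: sum_distrib_left sum_negf mult.assoc)
    qed
    then have "w0 = lincomb (W - {w0}) (\<lambda>w. w) (\<lambda>w. - Poly_Mapping.single 0 (1 / a) * p w)"
      unfolding lincomb_def by (rule ext)
    then have "w0 \<in> spanned (W - {w0})" unfolding spanned_def by blast
    then have "w \<in> spanned (W - {w0})" if "w \<in> W" for w
      using that fW(1) by (cases "w = w0") (auto intro: spanned_superset)
    then have "spanned W \<subseteq> spanned (W - {w0})"
      unfolding spanned_def[of W] lincomb_def by (auto intro!: spanned_sum)
    moreover have "spanned (W - {w0}) \<subseteq> N"
      using N fW by (intro spanned_in) (auto simp: graded_submodule_def)
    ultimately have "G (W - {w0})" using W(1) by (auto simp: G_def)
    from W(2)[OF this] show False using fW(1) w0 by (metis card_Diff1_less not_le)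
  qed
  \<comment> \<open>The record \<open>cplx\<close> numbers its bases, so the generators are
    renumbered by \<open>{..<k}\<close>.\<close>
  define k where "k = card W"
  obtain e where e: "bij_betw e {..<k} W"
    using ex_bij_betw_nat_finite[OF fW(1)] by (auto simp: k_def atLeast0LessThan)
  have eW: "e c \<in> W" if "c < k" for c using e that by (auto simp: bij_betw_def)
  have lin: "lincomb {..<k} e q = ?D (\<lambda>w. if w \<in> W then q (inv_into {..<k} e w) else 0)" for q
  proof
    fix r
    have "(\<Sum>w\<in>W. (if w \<in> W then q (inv_into {..<k} e w) else 0) * w r)
       = (\<Sum>c<k. (if e c \<in> W then q (inv_into {..<k} e (e c)) else 0) * e c r)"
      by (rule sum.reindex_bij_betw[OF e, symmetric])
    also have "\<dots> = (\<Sum>c<k. q c * e c r)"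
      using eW e by (intro sum.cong) (auto simp: bij_betw_def)
    finally show "lincomb {..<k} e q r = ?D (\<lambda>w. if w \<in> W then q (inv_into {..<k} e w) else 0) r"
      by (simp add: lincomb_def)
  qed
  show ?thesis
  proof (rule that[of k "\<lambda>c. \<tau> (e c)" e])
    show "\<forall>c<k. hvec \<xi> (\<tau> (e c)) (e c) \<and> e c \<in> N" using \<tau> eW fW(2) by blast
    show "N = {lincomb {..<k} e q | q. vec {..<k} q}"
    proof
      show "{lincomb {..<k} e q | q. vec {..<k} q} \<subseteq> N"
        using fW(3) lin by (auto simp: spanned_def)
      show "N \<subseteq> {lincomb {..<k} e q | q. vec {..<k} q}"
      proof
        fix x assume "x \<in> N"
        then obtain q where q: "x = ?D q" using fW(3) by (auto simp: spanned_def)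
        have "?D q = lincomb {..<k} e (\<lambda>c. if c < k then q (e c) else 0)"
          unfolding lin using e
          by (auto simp: lincomb_def fun_eq_iff bij_betw_def inv_into_into f_inv_into_f intro!: sum.cong)
        moreover have "vec {..<k} (\<lambda>c. if c < k then q (e c) else 0)" by (simp add: vec_def)
        ultimately show "x \<in> {lincomb {..<k} e q | q. vec {..<k} q}" using q by blast
      qed
    qed
    show "minimal_on {..<k} (lincomb {..<k} e)"
      unfolding minimal_on_def
    proof (intro allI impI)
      fix q b assume q: "vec {..<k} q" "lincomb {..<k} e q = (\<lambda>_. 0)"
      let ?q = "\<lambda>w. if w \<in> W then q (inv_into {..<k} e w) else 0"
      have z: "Poly_Mapping.lookup (?q w) 0 = 0" for w
        by (rule min) (use q(2) lin in \<open>auto simp: vec_def\<close>)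
      show "Poly_Mapping.lookup (q b) 0 = 0"
      proof (cases "b < k")
        case True
        then show ?thesis using z[of "e b"] eW e by (auto simp: bij_betw_def)
      next
        case False
        then show ?thesis using q(1) by (simp add: vec_def)
      qed
    qed
  qed
qed

lemma graded_submodule_kernel:
  assumes "\<forall>c<(k::nat). hvec \<xi> (t c) (w c)"
  shows "graded_submodule k t {q. vec {..<k} q \<and> lincomb {..<k} w q = (\<lambda>_. 0)}"
proof -
  have gr: "graded_map {..<k} t \<xi> (lincomb {..<k} w)"
    using assms by (simp add: graded_map_def lincomb_unitv)
  have "lincomb {..<k} w (hvcomp t s q) = (\<lambda>_. 0)" if "vec {..<k} q" "lincomb {..<k} w q = (\<lambda>_. 0)" for q s
    using graded_hvcomp[OF _ qlinear_lincomb gr that(1)] that(2) by (simp add: hvcomp_def)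
  then show ?thesis
    by (auto simp: graded_submodule_def submodule_of_def vec_add vec_scale vec_hvcomp
        qlinear_zero[OF qlinear_lincomb] qlinear_add[OF qlinear_lincomb] qlinear_scale[OF qlinear_lincomb])
qed

section \<open>The edge ideal as a homogeneous ideal, and the iterated syzygy construction\<close>

lemma lookup_edge_monomial_0:
  assumes "card e = 2"
  shows "Poly_Mapping.lookup (edge_monomial e :: ('v, 'k::field) mpoly) 0 = 0"
proof -
  obtain v where v: "v \<in> e" "finite e" using assms by (metis card_eq_0_iff ex_in_conv zero_neq_numeral)
  have "edge_monomial e = var v * (\<Prod>u\<in>e - {v}. var u :: ('v, 'k) mpoly)"
    unfolding edge_monomial_def using v by (simp add: prod.remove)
  then show ?thesis by (simp add: lookup_var_mult)
qed

lemma edge_ideal_const: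
  assumes "simple_graph E" "p \<in> edge_ideal E"
  shows "Poly_Mapping.lookup (p :: ('v::finite, 'k::field) mpoly) 0 = 0"
  using assms
  by (auto simp: edge_ideal_def simple_graph_def lookup_sum lookup_mult_zero lookup_edge_monomial_0)

lemma edge_ideal_add: "p \<in> edge_ideal E \<Longrightarrow> q \<in> edge_ideal E \<Longrightarrow> p + q \<in> edge_ideal E"
proof -
  assume "p \<in> edge_ideal E" "q \<in> edge_ideal E"
  then obtain f g where "p = (\<Sum>e\<in>E. f e * edge_monomial e)" "q = (\<Sum>e\<in>E. g e * edge_monomial e)"
    by (auto simp: edge_ideal_def)
  then have "p + q = (\<Sum>e\<in>E. (f e + g e) * edge_monomial e)"
    by (simp add: sum.distrib algebra_simps)
  then show ?thesis unfolding edge_ideal_def by (intro CollectI exI[of _ "\<lambda>e. f e + g e"]) simp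
qed

lemma edge_ideal_mult: "p \<in> edge_ideal E \<Longrightarrow> q * p \<in> edge_ideal E"
proof -
  assume "p \<in> edge_ideal E"
  then obtain f where "p = (\<Sum>e\<in>E. f e * edge_monomial e)" by (auto simp: edge_ideal_def)
  then have "q * p = (\<Sum>e\<in>E. (q * f e) * edge_monomial e)"
    by (simp add: sum_distrib_left mult.assoc)
  then show ?thesis unfolding edge_ideal_def by (intro CollectI exI[of _ "\<lambda>e. q * f e"]) simp
qed

lemma edge_ideal_hcomp: "p \<in> edge_ideal E \<Longrightarrow> hcomp t p \<in> edge_ideal E"
proof -
  assume "p \<in> edge_ideal E"
  then obtain f where f: "p = (\<Sum>e\<in>E. f e * edge_monomial e)" by (auto simp: edge_ideal_def)
  have "hcomp t p = (\<Sum>e\<in>E. hcomp (t - int (card e)) (f e) * edge_monomial e)"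
    unfolding f hcomp_sum edge_monomial_def
    by (intro sum.cong refl hcomp_mult homogeneous_prod_var)
  then show ?thesis unfolding edge_ideal_def by (intro CollectI exI[of _ "\<lambda>e. hcomp (t - int (card e)) (f e)"]) simp
qed

lemma edge_ideal_zero: "0 \<in> edge_ideal E"
  unfolding edge_ideal_def by (intro CollectI exI[of _ "\<lambda>e. 0"]) simp

text \<open>Covering a module by minimal generators and passing to the kernel of the cover is
  iterated. A state records the rank, the degrees, the submodule still to be covered, and the
  columns of the latest matrix.\<close>

theorem ex_min_free_res:
  assumes "simple_graph E"
  shows "\<exists>F :: ('v::finite, 'k::field) mpoly cplx. is_min_free_res E F"
proof -
  define N0 where "N0 = {v :: nat \<Rightarrow> ('v, 'k) mpoly. vec {..<1} v \<and> v 0 \<in> edge_ideal E}"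
  \<comment> \<open>Vanishing constant terms in \<open>N\<close> make the next matrix minimal;
    \<open>minimal_on\<close> reproduces the property for the next kernel.\<close>
  define P where "P s \<longleftrightarrow> (case s of (n, \<xi>, N, w) \<Rightarrow> graded_submodule n \<xi> N \<and>
      (\<forall>v\<in>N. \<forall>r. Poly_Mapping.lookup (v r) 0 = 0))"
    for s :: "nat \<times> (nat \<Rightarrow> int) \<times> (nat \<Rightarrow> ('v, 'k) mpoly) set \<times> (nat \<Rightarrow> nat \<Rightarrow> ('v, 'k) mpoly)"
  define R where "R s s' \<longleftrightarrow> (case s of (n, \<xi>, N, w) \<Rightarrow> case s' of (n', \<xi>', N', w') \<Rightarrow>
      (\<forall>c<n'. hvec \<xi> (\<xi>' c) (w' c) \<and> w' c \<in> N) \<and> N = {lincomb {..<n'} w' q | q. vec {..<n'} q} \<and>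
      N' = {q. vec {..<n'} q \<and> lincomb {..<n'} w' q = (\<lambda>_. 0)})"
    for s s' :: "nat \<times> (nat \<Rightarrow> int) \<times> (nat \<Rightarrow> ('v, 'k) mpoly) set \<times> (nat \<Rightarrow> nat \<Rightarrow> ('v, 'k) mpoly)"
  have "\<exists>s. s 0 = (1, (\<lambda>_. 0), N0, \<lambda>_ _. 0) \<and> (\<forall>i. P (s i) \<and> R (s i) (s (Suc i)))"
  proof -
    have N0c: "Poly_Mapping.lookup (v r) 0 = 0" if "v \<in> N0" for v r
      using that edge_ideal_const[OF assms, of "v 0"] by (cases "r = 0") (auto simp: N0_def vec_def)
    have P0: "P (1, (\<lambda>_. 0), N0, \<lambda>_ _. 0)"
      using N0c
      by (auto simp: P_def) (auto simp: N0_def graded_submodule_def submodule_of_def vec_add vec_scale edge_ideal_zero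
          edge_ideal_add edge_ideal_mult vec_hvcomp hvcomp_def edge_ideal_hcomp vec_def)
    have step: "\<exists>s'. P s' \<and> R s s'" if "P s" for s
    proof -
      obtain n \<xi> N w where s: "s = (n, \<xi>, N, w)" by (metis prod_cases4)
      have N: "graded_submodule n \<xi> N" using that s by (simp add: P_def)
      obtain k :: nat and t and w' :: "nat \<Rightarrow> nat \<Rightarrow> ('v, 'k) mpoly" where w': "\<forall>c<k. hvec \<xi> (t c) (w' c) \<and> w' c \<in> N"
        "N = {lincomb {..<k} w' q | q. vec {..<k} q}" "minimal_on {..<k} (lincomb {..<k} w')"
        by (rule minimal_generators[OF N])
      let ?s = "(k, t, {q. vec {..<k} q \<and> lincomb {..<k} w' q = (\<lambda>_. 0)}, w')"
      have "P ?s"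
        using w'(1,3) graded_submodule_kernel[of k \<xi> t w'] by (auto simp: P_def minimal_on_def)
      moreover have "R s ?s" using w'(1,2) by (simp add: R_def s)
      ultimately show ?thesis by blast
    qed
    define nx where "nx s = (SOME s'. P s' \<and> R s s')" for s
    have nx: "P (nx s) \<and> R s (nx s)" if "P s" for s
      unfolding nx_def by (rule someI_ex) (rule step[OF that])
    define sq where "sq = rec_nat (1, (\<lambda>_. 0), N0, \<lambda>_ _. 0) (\<lambda>_ s. nx s)"
    have sq: "sq 0 = (1, (\<lambda>_. 0), N0, \<lambda>_ _. 0)" "\<And>i. sq (Suc i) = nx (sq i)"
      by (simp_all add: sq_def)
    have "P (sq i)" for i by (induction i) (use P0 nx sq in auto)
    then show ?thesis using sq nx by (intro exI[of _ sq]) auto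
  qed
  then obtain s where s0: "s 0 = (1, (\<lambda>_. 0), N0, \<lambda>_ _. 0)" and PR: "\<And>i. P (s i)" "\<And>i. R (s i) (s (Suc i))"
    by blast
  define n where "n i = fst (s i)" for i
  define \<xi> where "\<xi> i = fst (snd (s i))" for i
  define N where "N i = fst (snd (snd (s i)))" for i
  define w where "w i = snd (snd (snd (s i)))" for i
  have se: "s i = (n i, \<xi> i, N i, w i)" for i by (simp add: n_def \<xi>_def N_def w_def)
  have z: "n 0 = 1" "\<xi> 0 = (\<lambda>_. 0)" "N 0 = N0" using s0 by (auto simp: n_def \<xi>_def N_def)
  have g: "graded_submodule (n i) (\<xi> i) (N i)" "v \<in> N i \<Longrightarrow> Poly_Mapping.lookup (v r) 0 = 0" for i v r
    using PR(1)[of i] by (auto simp: P_def se)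
  have Rw: "c < n (Suc i) \<Longrightarrow> hvec (\<xi> i) (\<xi> (Suc i) c) (w (Suc i) c)"
    "c < n (Suc i) \<Longrightarrow> w (Suc i) c \<in> N i"
    "N i = {lincomb {..<n (Suc i)} (w (Suc i)) q | q. vec {..<n (Suc i)} q}"
    "N (Suc i) = {q. vec {..<n (Suc i)} q \<and> lincomb {..<n (Suc i)} (w (Suc i)) q = (\<lambda>_. 0)}" for i c
    using PR(2)[of i] by (auto simp: R_def se)
  define F where "F = \<lparr> rk = n, dg = \<xi>,
    mat = (\<lambda>i r c. if 1 \<le> i \<and> r < n (i - 1) \<and> c < n i then w i c r else 0) \<rparr>"
  have F[simp]: "rk F = n" "dg F = \<xi>"
    "mat F = (\<lambda>i r c. if 1 \<le> i \<and> r < n (i - 1) \<and> c < n i then w i c r else 0)" by (simp_all add: F_def)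
  have dF: "dd F (Suc i) v = lincomb {..<n (Suc i)} (w (Suc i)) v" for i v
  proof
    fix r
    have "w (Suc i) c r = 0" if "\<not> r < n i" "c < n (Suc i)" for c
    proof -
      have "vec {..<n i} (w (Suc i) c)"
        using Rw(2)[OF that(2)] g(1)[of i] by (auto simp: graded_submodule_def submodule_of_def)
      then show ?thesis using that(1) by (simp add: vec_def)
    qed
    then show "dd F (Suc i) v r = lincomb {..<n (Suc i)} (w (Suc i)) v r"
      by (auto simp: dd_def lincomb_def mult.commute intro!: sum.cong)
  qed
  have "is_min_free_res E F"
    unfolding is_min_free_res_def
  proof (intro conjI allI impI)
    show "rk F 0 = 1" "dg F 0 0 = 0" using z by simp_all
    show "homogeneous (mat F i r c) (dg F i c - dg F (i - 1) r)"
      if "1 \<le> i" "r < rk F (i - 1)" "c < rk F i" for i r c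
      using that Rw(1)[of c "i - 1"] by (auto simp: hvec_def)
    show "mat F i r c = 0" if "1 \<le> i" "rk F (i - 1) \<le> r \<or> rk F i \<le> c" for i r c
      using that by auto
    show "{dd F 1 v 0 | v. inF F 1 v} = edge_ideal E"
    proof
      have *: "lincomb {..<n (Suc 0)} (w (Suc 0)) v \<in> N0" if "vec {..<n (Suc 0)} v" for v
        using that Rw(3)[of 0] z by blast
      then show "{dd F 1 v 0 | v. inF F 1 v} \<subseteq> edge_ideal E"
        using dF[of 0] by (auto simp: inF_vec N0_def)
      show "edge_ideal E \<subseteq> {dd F 1 v 0 | v. inF F 1 v}"
      proof
        fix p :: "('v, 'k) mpoly" assume p: "p \<in> edge_ideal E"
        have "(\<lambda>r. if r = 0 then p else 0) \<in> N 0" using p z by (auto simp: N0_def vec_def)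
        then obtain q where q: "vec {..<n (Suc 0)} q" "(\<lambda>r. if r = 0 then p else 0) = lincomb {..<n (Suc 0)} (w (Suc 0)) q"
          using Rw(3)[of 0] by blast
        from fun_cong[OF q(2), of 0] have "p = dd F 1 q 0" using dF[of 0] by simp
        then show "p \<in> {dd F 1 v 0 | v. inF F 1 v}" using q(1) by (auto simp: inF_vec)
      qed
    qed
    show "{v. inF F i v \<and> dd F i v = (\<lambda>_. 0)} = {dd F (Suc i) w | w. inF F (Suc i) w}" if i1: "1 \<le> i" for i
    proof -
      obtain j where i: "i = Suc j" using i1 by (cases i) auto
      show ?thesis unfolding i dF inF_vec using Rw(3)[of "Suc j"] Rw(4)[of j] by simp
    qed
    show "Poly_Mapping.lookup (mat F i r c) 0 = 0" for i r c
    proof (cases "1 \<le> i \<and> r < n (i - 1) \<and> c < n i")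
      case True
      then show ?thesis using g(2)[OF Rw(2)[of c "i - 1"]] by simp
    next
      case False
      then show ?thesis by auto
    qed
  qed
  then show ?thesis by blast
qed

section \<open>Trees of small and large diameter\<close>

lemma is_path_iff: "is_path E p \<longleftrightarrow> p \<noteq> [] \<and> distinct p \<and> successively (adj E) p"
  by (auto simp: is_path_def successively_conv_nth)

lemma adj_commute: "adj E u v \<longleftrightarrow> adj E v u"
  by (simp add: adj_def insert_commute)

lemma successively_rev_adj: "successively (adj E) (rev p) \<longleftrightarrow> successively (adj E) p"
proof -
  have "(\<lambda>x y. adj E y x) = adj E" by (intro ext) (rule adj_commute)
  then show ?thesis by (simp only: successively_rev)
qed

lemma is_path_take_drop:
  assumes "is_path E p" "i < length p" "0 < k"
  shows "is_path E (take k (drop i p))"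
  using assms by (auto simp: is_path_def)

text \<open>A chord would close the segment between its endpoints to a cycle with at least three
  vertices.\<close>

lemma tree_no_chord:
  assumes E: "is_tree E" and p: "is_path E p" and i: "i < j" "j < length p" and a: "adj E (p ! i) (p ! j)"
  shows "j = Suc i"
proof (rule ccontr)
  assume "j \<noteq> Suc i"
  define c where "c = take (Suc j - i) (drop i p)"
  have len: "length c = Suc j - i" using i by (simp add: c_def)
  have "is_path E c" unfolding c_def using p i by (intro is_path_take_drop) auto
  moreover have "length c \<ge> 3" using len i \<open>j \<noteq> Suc i\<close> by simp
  moreover have "hd c = p ! i" using i by (simp add: c_def hd_drop_conv_nth)
  moreover have "last c = p ! j"
  proof -
    have "last c = c ! (j - i)" using len i by (metis Suc_diff_le diff_Suc_1 last_conv_nth length_greater_0_conv less_imp_le_nat zero_less_Suc)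
    then show ?thesis using i by (simp add: c_def)
  qed
  ultimately have "is_cycle E c" using a by (simp add: is_cycle_def adj_commute)
  then show False using E by (auto simp: is_tree_def)
qed

lemma path_lengths_finite: "finite {length p - 1 | p. is_path (E :: ('v::finite) set set) p}"
proof (rule finite_subset)
  show "{length p - 1 | p. is_path E p} \<subseteq> {..card (UNIV :: 'v set)}"
  proof
    fix n assume "n \<in> {length p - 1 | p. is_path E p}"
    then obtain p where p: "n = length p - 1" "is_path E p" by blast
    then have "distinct p" by (simp add: is_path_def)
    have "length p = card (set p)" using distinct_card[OF \<open>distinct p\<close>] by simp
    also have "\<dots> \<le> card (UNIV :: 'v set)" by (intro card_mono) auto
    finally show "n \<in> {..card (UNIV :: 'v set)}" using p(1) by simp
  qed
qed simp

lemma path_length_le: "is_path (E :: ('v::finite) set set) p \<Longrightarrow> length p \<le> Suc (diameter E)"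
proof -
  assume "is_path E p"
  then have "length p - 1 \<le> diameter E"
    unfolding diameter_def using path_lengths_finite by (intro Max_ge) auto
  then show ?thesis by simp
qed

lemma longest_path:
  obtains p where "is_path (E :: ('v::finite) set set) p" "length p = Suc (diameter E)"
proof -
  have "is_path E [undefined]" by (simp add: is_path_iff)
  then have ne: "{length p - 1 | p. is_path E p} \<noteq> {}" by blast
  have "diameter E \<in> {length p - 1 | p. is_path E p}"
    unfolding diameter_def by (rule Max_in[OF path_lengths_finite ne])
  then obtain p where p: "is_path E p" "diameter E = length p - 1" by blast
  then have "length p = Suc (diameter E)" by (cases p) (auto simp: is_path_def)
  then show ?thesis using that p by blast
qed

lemma induced_path6:
  assumes E: "is_tree (E :: ('v::finite) set set)" and d: "diameter E \<ge> 5"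
  obtains p where "is_path E p" "length p = 6"
    "\<And>i j. i < 6 \<Longrightarrow> j < 6 \<Longrightarrow> {p ! i, p ! j} \<in> E \<Longrightarrow> j = Suc i \<or> i = Suc j"
proof -
  obtain p where p: "is_path E p" "length p = Suc (diameter E)" by (rule longest_path)
  define q where "q = take 6 (drop 0 p)"
  have q: "is_path E q" unfolding q_def using p by (intro is_path_take_drop) auto
  have len: "length q = 6" using p d by (simp add: q_def)
  have "j = Suc i \<or> i = Suc j" if "i < 6" "j < 6" "{q ! i, q ! j} \<in> E" for i j
  proof -
    have "i \<noteq> j"
    proof
      assume "i = j"
      then have "card {q ! i, q ! j} \<noteq> 2" by simp
      then show False using that(3) E by (auto simp: is_tree_def simple_graph_def)
    qed
    then show ?thesis
      using tree_no_chord[OF E q, of i j] tree_no_chord[OF E q, of j i] that len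
      by (auto simp: adj_def insert_commute neq_iff)
  qed
  then show ?thesis using that q len by blast
qed

text \<open>If the branches met, the first vertex of \<open>p\<close> lying on \<open>q\<close>
  would close a cycle through \<open>c\<close>; the different first steps guarantee at least three
  vertices.\<close>

lemma tree_branches_disjoint:
  assumes E: "is_tree E" and p: "is_path E (c # p)" and q: "is_path E (c # q)"
    and ne: "p \<noteq> []" "q \<noteq> []" "hd p \<noteq> hd q"
  shows "set p \<inter> set q = {}"
proof (rule ccontr)
  assume "set p \<inter> set q \<noteq> {}"
  then obtain a p1 p2 where ps: "p = p1 @ a # p2" and a: "a \<in> set q" and p1: "\<forall>y\<in>set p1. y \<notin> set q"
    using split_list_first_prop[of p "\<lambda>y. y \<in> set q"] by blast
  obtain q1 q2 where qs: "q = q1 @ a # q2" using a by (metis split_list)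
  let ?c = "c # p1 @ a # rev q1"
  have P: "successively (adj E) (c # p1 @ a # p2)" "distinct (c # p1 @ a # p2)"
    using p by (simp_all add: is_path_iff ps)
  have Q: "successively (adj E) (c # q1 @ a # q2)" "distinct (c # q1 @ a # q2)"
    using q by (simp_all add: is_path_iff qs)
  have "successively (adj E) ((c # p1 @ [a]) @ p2)" using P(1) by simp
  then have s1: "successively (adj E) (c # p1 @ [a])" by (simp only: successively_append_iff)
  have "successively (adj E) ((c # q1 @ [a]) @ q2)" using Q(1) by simp
  then have "successively (adj E) (c # q1 @ [a])" by (simp only: successively_append_iff)
  then have s2: "successively (adj E) (rev (c # q1 @ [a]))" by (simp only: successively_rev_adj)
  have s2': "successively (adj E) (a # rev q1 @ [c])" using s2 by simp
  then have s3: "successively (adj E) ((a # rev q1) @ [c])" by simp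
  then have s4: "successively (adj E) (a # rev q1)" "adj E (last (a # rev q1)) c"
    by (simp_all only: successively_append_iff) simp_all
  have "successively (adj E) (c # p1 @ a # rev q1)"
  proof -
    have "hd ((c # p1) @ [a]) = c" by simp
    have "successively (adj E) ((c # p1) @ [a])" using s1 by simp
    then have "successively (adj E) (c # p1)" "adj E (last (c # p1)) a"
      by (simp_all only: successively_append_iff) simp_all
    then have "successively (adj E) ((c # p1) @ (a # rev q1))"
      using s4(1) by (simp only: successively_append_iff) simp
    then show ?thesis by simp
  qed
  moreover have "distinct ?c" using P(2) Q(2) p1 qs by auto
  moreover have "length ?c \<ge> 3"
  proof (rule ccontr)
    assume "\<not> length ?c \<ge> 3"
    then have "length p1 = 0" "length q1 = 0" unfolding length_Cons length_append length_rev by linarith+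
    then have "p1 = []" "q1 = []" by simp_all
    then show False using ne(3) ps qs by simp
  qed
  moreover have "adj E (last ?c) (hd ?c)" using s4(2) by simp
  ultimately have "is_cycle E ?c" by (simp add: is_cycle_def is_path_iff)
  then show False using E by (auto simp: is_tree_def)
qed

lemma tree_join_branches:
  assumes E: "is_tree E" and p: "is_path E (c # p)" and q: "is_path E (c # q)"
    and ne: "p = [] \<or> q = [] \<or> hd p \<noteq> hd q"
  shows "is_path E (rev p @ c # q)"
proof -
  have "set p \<inter> set q = {}"
    using tree_branches_disjoint[OF E p q] ne by (cases "p = []"; cases "q = []") auto
  moreover have "successively (adj E) (rev (c # p))"
    using p unfolding is_path_iff successively_rev_adj by simp
  ultimately show ?thesis using p q
    by (auto simp: is_path_iff successively_append_iff)
qed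

text \<open>The third vertex of a longest path works. A branch with three further vertices leaves it
  in a direction different from one of the two arms of that path; joined to this arm it gives a path
  that is too long.\<close>

lemma tree_center:
  assumes E: "is_tree (E :: ('v::finite) set set)" and d: "diameter E \<le> 4"
  obtains c where "\<And>q. is_path E (c # q) \<Longrightarrow> length q \<le> 2"
proof (cases "diameter E < 2")
  case True
  have "length q \<le> 2" if "is_path E (undefined # q)" for q
    using path_length_le[OF that] True by simp
  then show ?thesis using that by blast
next
  case False
  obtain p where p: "is_path E p" "length p = Suc (diameter E)" by (rule longest_path)
  have "Suc (Suc (Suc 0)) \<le> length p" using p(2) False by simp
  then have "\<exists>p0 p1 c r. p = p0 # p1 # c # r" by (auto simp: Suc_le_length_iff)
  then obtain p0 p1 c r where ps: "p = p0 # p1 # c # r" by blast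
  have len: "length r + 2 = diameter E" using p(2) ps by simp
  have S: "successively (adj E) (p0 # p1 # c # r)" "distinct (p0 # p1 # c # r)"
    using p(1) ps by (auto simp: is_path_iff)
  have P1: "is_path E (c # [p1, p0])" using S by (auto simp: is_path_iff adj_commute)
  have P2: "is_path E (c # r)" using S by (auto simp: is_path_iff successively_Cons)
  have "length q \<le> 2" if q: "is_path E (c # q)" for q
  proof (rule ccontr)
    assume l: "\<not> length q \<le> 2"
    then have qn: "q \<noteq> []" by auto
    show False
    proof (cases "hd q = p1")
      case True
      have "r = [] \<or> q = [] \<or> hd r \<noteq> hd q" using True S(2) by (cases r) auto
      from path_length_le[OF tree_join_branches[OF E P2 q this]] show False using l len by simp
    next
      case False
      then have "[p1, p0] = [] \<or> q = [] \<or> hd [p1, p0] \<noteq> hd q" by simp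
      from path_length_le[OF tree_join_branches[OF E P1 q this]] show False using l d by simp
    qed
  qed
  then show ?thesis using that by blast
qed

text \<open>All vertices are within distance two of the centre; \<open>Y\<close> is the first layer
  and \<open>X\<close> the second. Any edge beyond the listed ones would close a cycle with three,
  four or five vertices.\<close>

lemma tree_diameter4_structure:
  assumes E: "is_tree (E :: ('v::finite) set set)" and d: "diameter E \<le> 4"
  obtains c Y X par where "c \<notin> Y" "c \<notin> X" "X \<inter> Y = {}" "\<forall>x\<in>X. par x \<in> Y"
    "E = (\<lambda>y. {c, y}) ` Y \<union> (\<lambda>x. {par x, x}) ` X"
proof -
  obtain c where c: "\<And>q. is_path E (c # q) \<Longrightarrow> length q \<le> 2" by (rule tree_center[OF E d]) blast
  have simp2: "card e = 2" if "e \<in> E" for e using E that by (auto simp: is_tree_def simple_graph_def)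
  have ncyc: "\<not> is_cycle E l" for l using E by (auto simp: is_tree_def)
  have irr: "\<not> adj E u u" for u using simp2[of "{u}"] by (auto simp: adj_def)
  define Y where "Y = {y. adj E c y}"
  define X where "X = {x. x \<noteq> c \<and> x \<notin> Y}"
  have ex: "\<exists>y. y \<in> Y \<and> adj E y x" if x: "x \<in> X" for x
  proof -
    obtain p where p: "is_path E p" "hd p = c" "last p = x"
      using E unfolding is_tree_def connected_graph_def by metis
    then obtain q where q: "p = c # q" by (cases p) (auto simp: is_path_def)
    have l: "length q \<le> 2" using c p(1) q by blast
    have s: "successively (adj E) (c # q)" using p(1) q by (simp add: is_path_iff)
    have "q = [] \<or> (\<exists>y. q = [y]) \<or> (\<exists>y z. q = [y, z])"
      using l by (cases q rule: remdups_adj.cases) auto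
    then consider "q = []" | y where "q = [y]" | y z where "q = [y, z]" by blast
    then show ?thesis
      using s p(3) x q by cases (auto simp: X_def Y_def)
  qed
  define par where "par x = (SOME y. y \<in> Y \<and> adj E y x)" for x
  have par: "par x \<in> Y \<and> adj E (par x) x" if "x \<in> X" for x
    unfolding par_def by (rule someI_ex[OF ex[OF that]])
  have cY: "c \<notin> Y" using irr by (simp add: Y_def)
  have YX: "X \<inter> Y = {}" by (auto simp: X_def)
  have cX: "c \<notin> X" by (simp add: X_def)
  have Ya: "adj E c y" "adj E y c" if "y \<in> Y" for y
    using that adj_commute[of E y c] by (simp_all add: Y_def)
  have para: "adj E x (par x)" if "x \<in> X" for x
    using par[OF that] adj_commute[of E x "par x"] by simp
  have YY: "\<not> adj E u v" if "u \<in> Y" "v \<in> Y" for u v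
  proof
    assume a: "adj E u v"
    then have "u \<noteq> v" "u \<noteq> c" "v \<noteq> c" using irr that cY by auto
    then have "is_cycle E [c, u, v]"
      using a that Ya by (auto simp: is_cycle_def is_path_iff)
    then show False using ncyc by blast
  qed
  have YX1: "u = par v" if "u \<in> Y" "v \<in> X" "adj E u v" for u v
  proof (rule ccontr)
    assume n: "u \<noteq> par v"
    have "is_cycle E [c, u, v, par v]"
      using n that par[OF that(2)] para[OF that(2)] Ya cY cX YX irr
      by (auto simp: is_cycle_def is_path_iff)
    then show False using ncyc by blast
  qed
  have XX: "\<not> adj E u v" if "u \<in> X" "v \<in> X" for u v
  proof
    assume a: "adj E u v"
    have n: "u \<noteq> v" using a irr by auto
    show False
    proof (cases "par u = par v")
      case True
      have "is_cycle E [par u, u, v]"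
        using a n True par[OF that(1)] par[OF that(2)] para[OF that(1)] para[OF that(2)] that YX
        by (auto simp: is_cycle_def is_path_iff)
      then show False using ncyc by blast
    next
      case False
      have "is_cycle E [c, par u, u, v, par v]"
        using a n False par[OF that(1)] par[OF that(2)] para[OF that(1)] para[OF that(2)] that YX cX cY Ya
        by (auto simp: is_cycle_def is_path_iff)
      then show False using ncyc by blast
    qed
  qed
  have "E = (\<lambda>y. {c, y}) ` Y \<union> (\<lambda>x. {par x, x}) ` X" (is "_ = ?R")
  proof
    show "?R \<subseteq> E" using Ya par by (auto simp: adj_def)
    show "E \<subseteq> ?R"
    proof
      fix e assume e: "e \<in> E"
      obtain u v where uv: "e = {u, v}" using simp2[OF e] by (auto simp: card_2_iff)
      then have a: "adj E u v" "adj E v u" using e by (auto simp: adj_def insert_commute)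
      have cases: "w = c \<or> w \<in> Y \<or> w \<in> X" for w by (auto simp: X_def)
      consider "u = c" | "v = c" | "u \<in> Y" "v \<in> Y" | "u \<in> Y" "v \<in> X" | "u \<in> X" "v \<in> Y" | "u \<in> X" "v \<in> X"
        using cases[of u] cases[of v] by blast
      then show "e \<in> ?R"
      proof cases
        case 1
        then show ?thesis using a uv by (auto simp: Y_def)
      next
        case 2
        then show ?thesis using a uv by (auto simp: Y_def insert_commute)
      next
        case 3
        then show ?thesis using YY a by blast
      next
        case 4
        then show ?thesis using YX1[of u v] a uv by auto
      next
        case 5
        then show ?thesis using YX1[of v u] a uv by (auto simp: insert_commute)
      next
        case 6
        then show ?thesis using XX a by blast
      qed
    qed
  qed
  then show ?thesis using that cY cX YX par by blast
qed

section \<open>The obstruction on a path with six vertices\<close>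

text \<open>Multiplication by a fixed element of degree one, after rescaling the product so that its
  unit is the standard generator of \<open>F\<^sub>0\<close>.\<close>

lemma dga_left_multiplication:
  fixes F :: "('v::finite, 'k::field) mpoly cplx"
  assumes F: "is_min_free_res E F" and mu: "is_dga_structure F mu"
  obtains L :: "(nat \<Rightarrow> ('v, 'k) mpoly) \<Rightarrow> nat \<Rightarrow> (nat \<Rightarrow> ('v, 'k) mpoly) \<Rightarrow> (nat \<Rightarrow> ('v, 'k) mpoly)"
  where "\<And>g i. inF F 1 g \<Longrightarrow> qlinear (L g i)"
    "\<And>g i a. inF F 1 g \<Longrightarrow> inF F (Suc i) (L g i a)"
    "\<And>g i a. inF F 1 g \<Longrightarrow> inF F (Suc i) a \<Longrightarrow>
       dd F (Suc (Suc i)) (L g (Suc i) a) = (\<lambda>r. dd F 1 g 0 * a r - L g i (dd F (Suc i) a) r)"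
    "\<And>g a. inF F 1 g \<Longrightarrow> inF F 0 a \<Longrightarrow> L g 0 a = (\<lambda>r. a 0 * g r)"
    "\<And>g h i a. inF F 1 g \<Longrightarrow> inF F 1 h \<Longrightarrow> inF F i a \<Longrightarrow>
       L g (Suc i) (L h i a) = (\<lambda>r. - L h (Suc i) (L g i a) r)"
proof -
  have rk0: "rk F 0 = 1" using F by (simp add: is_min_free_res_def)
  note dga = mu[unfolded is_dga_structure_def]
  note mu_in = dga[THEN conjunct1, rule_format]
    and mu_ar = dga[THEN conjunct2, THEN conjunct2, THEN conjunct1, rule_format]
    and mu_sl = dga[THEN conjunct2, THEN conjunct2, THEN conjunct2, THEN conjunct1, rule_format, THEN conjunct1]
    and mu_sr = dga[THEN conjunct2, THEN conjunct2, THEN conjunct2, THEN conjunct1, rule_format, THEN conjunct2]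
    and mu_1 = dga[THEN conjunct2, THEN conjunct2, THEN conjunct2, THEN conjunct2, THEN conjunct1]
    and mu_assoc = dga[THEN conjunct2, THEN conjunct2, THEN conjunct2, THEN conjunct2, THEN conjunct2,
      THEN conjunct1, rule_format]
    and mu_comm = dga[THEN conjunct2, THEN conjunct2, THEN conjunct2, THEN conjunct2, THEN conjunct2,
      THEN conjunct2, THEN conjunct1, rule_format]
    and mu_leib = dga[THEN conjunct2, THEN conjunct2, THEN conjunct2, THEN conjunct2, THEN conjunct2,
      THEN conjunct2, THEN conjunct2, THEN conjunct2, rule_format]
  obtain u where u: "inF F 0 u" "\<And>i a. inF F i a \<Longrightarrow> mu 0 i u a = a" "\<And>i a. inF F i a \<Longrightarrow> mu i 0 a u = a"
    using mu_1 by blast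
  let ?e = "\<lambda>r::nat. if r = 0 then 1 else (0::('v, 'k) mpoly)"
  have e: "inF F 0 ?e" using rk0 by (simp add: inF_def)
  have F0: "a = (\<lambda>r. a 0 * ?e r)" if "inF F 0 a" for a
    using that rk0 by (auto simp: inF_def fun_eq_iff)
  have e_left: "(\<lambda>r. u 0 * mu 0 i ?e a r) = a" if a: "inF F i a" for i a
    using mu_sl[OF e a, of "u 0"] u(2)[OF a] F0[OF u(1)] by simp
  have e_right: "(\<lambda>r. u 0 * mu i 0 a ?e r) = a" if a: "inF F i a" for i a
    using mu_sr[OF a e, of "u 0"] u(3)[OF a] F0[OF u(1)] by simp
  \<comment> \<open>\<open>mu\<close> is controlled only on elements of the modules; cutting a
    function down to them first makes \<open>L g i\<close> linear on all functions.\<close>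
  define mask where "mask i a = (\<lambda>r. if r < rk F i then a r else 0)" for i and a :: "nat \<Rightarrow> ('v, 'k) mpoly"
  have mk: "inF F i (mask i a)" for i a by (simp add: mask_def inF_def)
  have mk_id: "inF F i a \<Longrightarrow> mask i a = a" for i a by (auto simp: mask_def inF_def fun_eq_iff)
  \<comment> \<open>The unit \<open>u\<close> is \<open>u 0\<close> times the standard generator, so
    the factor \<open>u 0\<close> turns that generator into the unit.\<close>
  define L where "L g i a = (\<lambda>r. u 0 * mu 1 i g (mask i a) r)" for g i a
  have inL: "inF F (Suc i) (L g i a)" if "inF F 1 g" for g i a
    using mu_in[OF that mk, of i a] by (simp add: L_def inF_def)
  have dinF: "inF F i (dd F (Suc i) a)" for i a using inF_dd[of F "Suc i" a] by simp
  show ?thesis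
  proof (rule that[of L])
    fix g i assume g: "inF F 1 g"
    have "mask i (\<lambda>r. a r + b r) = (\<lambda>r. mask i a r + mask i b r)" "mask i (\<lambda>r. q * a r) = (\<lambda>r. q * mask i a r)" for a b q
      by (auto simp: mask_def)
    then show "qlinear (L g i)"
      using mu_ar[OF g mk mk] mu_sr[OF g mk] by (simp add: qlinear_def L_def algebra_simps)
    show "inF F (Suc i) (L g i a)" for a by (rule inL[OF g])
    show "dd F (Suc (Suc i)) (L g (Suc i) a) = (\<lambda>r. dd F 1 g 0 * a r - L g i (dd F (Suc i) a) r)"
      if a: "inF F (Suc i) a" for a
    proof -
      have d0: "inF F 0 (dd F 1 g)" using dinF[of 0 g] by simp
      have "mu 0 (Suc i) (dd F 1 g) a = (\<lambda>r. dd F 1 g 0 * mu 0 (Suc i) ?e a r)"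
        using mu_sl[OF e a, of "dd F 1 g 0"] F0[OF d0] by simp
      then have "u 0 * mu 0 (Suc i) (dd F 1 g) a r = dd F 1 g 0 * (u 0 * mu 0 (Suc i) ?e a r)" for r
        by (simp only: mult.left_commute)
      moreover have "u 0 * mu 0 (Suc i) ?e a r = a r" for r using fun_cong[OF e_left[OF a], of r] .
      ultimately have 1: "u 0 * mu 0 (Suc i) (dd F 1 g) a r = dd F 1 g 0 * a r" for r
        by (simp only:)
      have "dd F (Suc (Suc i)) (mu 1 (Suc i) g a) =
         (\<lambda>r. mu 0 (Suc i) (dd F 1 g) a r - mu 1 i g (dd F (Suc i) a) r)"
        using mu_leib[OF g a] by simp
      then show ?thesis
        unfolding L_def mk_id[OF a] mk_id[OF dinF] qlinear_scale[OF qlinear_dd]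
        by (simp only: right_diff_distrib 1)
    qed
  next
    fix g a assume g: "inF F 1 g" and a: "inF F 0 a"
    have "mu 1 0 g a = (\<lambda>r. a 0 * mu 1 0 g ?e r)"
      using mu_sr[OF g e, of "a 0"] F0[OF a] by simp
    then have "u 0 * mu 1 0 g a r = a 0 * (u 0 * mu 1 0 g ?e r)" for r
      by (simp only: mult.left_commute)
    moreover have "u 0 * mu 1 0 g ?e r = g r" for r using fun_cong[OF e_right[OF g], of r] .
    ultimately show "L g 0 a = (\<lambda>r. a 0 * g r)"
      unfolding L_def mk_id[OF a] by (simp only:)
  next
    fix g h i a assume g: "inF F 1 g" and h: "inF F 1 h" and a: "inF F i a"
    have LL: "L g (Suc i) (L h i a) = (\<lambda>r. u 0 * (u 0 * mu 2 i (mu 1 1 g h) a r))"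
      if g: "inF F 1 g" and h: "inF F 1 h" for g h
    proof -
      have m: "inF F (Suc i) (mu 1 i h a)" using mu_in[OF h a] by simp
      have "L g (Suc i) (L h i a) = (\<lambda>r. u 0 * mu 1 (Suc i) g (\<lambda>r. u 0 * mu 1 i h a r) r)"
        unfolding L_def[of g] mk_id[OF inL[OF h]] unfolding L_def mk_id[OF a] ..
      also have "\<dots> = (\<lambda>r. u 0 * (u 0 * mu 1 (Suc i) g (mu 1 i h a) r))"
        using mu_sr[OF g m] by simp
      also have "mu 1 (Suc i) g (mu 1 i h a) = mu 2 i (mu 1 1 g h) a"
        using mu_assoc[OF g h a] by (simp add: numeral_2_eq_2)
      finally show ?thesis .
    qed
    have hg: "inF F 2 (mu 1 1 h g)" using mu_in[OF h g] by (simp add: numeral_2_eq_2)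
    have "mu 1 1 g h = (\<lambda>r. (-1) * mu 1 1 h g r)" using mu_comm[OF g h] by simp
    then have "mu 2 i (mu 1 1 g h) a = (\<lambda>r. (-1) * mu 2 i (mu 1 1 h g) a r)"
      using mu_sl[OF hg a, of "-1"] by simp
    then show "L g (Suc i) (L h i a) = (\<lambda>r. - L h (Suc i) (L g i a) r)"
      unfolding LL[OF g h] LL[OF h g] by simp
  qed
qed

subsection \<open>Semilinear functionals\<close>

text \<open>Linearity along the ring map \<open>kill S\<close>. It replaces linearity over the
  quotient by the variables in \<open>S\<close>, so that the quotient ring is never formed.\<close>

definition semilin :: "'v set \<Rightarrow> ((nat \<Rightarrow> ('v, 'k::field) mpoly) \<Rightarrow> ('v, 'k) mpoly) \<Rightarrow> bool" where
  "semilin S \<Theta> \<longleftrightarrow> (\<forall>v w. \<Theta> (\<lambda>r. v r + w r) = \<Theta> v + \<Theta> w) \<and> (\<forall>q v. \<Theta> (\<lambda>r. q * v r) = kill S q * \<Theta> v)"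

lemma semilin_add: "semilin S \<Theta> \<Longrightarrow> \<Theta> (\<lambda>r. v r + w r) = \<Theta> v + \<Theta> w"
  by (simp add: semilin_def)

lemma semilin_scale: "semilin S \<Theta> \<Longrightarrow> \<Theta> (\<lambda>r. q * v r) = kill S q * \<Theta> v"
  by (simp add: semilin_def)

lemma semilin_zero: "semilin S \<Theta> \<Longrightarrow> \<Theta> (\<lambda>_. 0) = 0"
  using semilin_scale[of S \<Theta> 0 "\<lambda>_. 0"] by simp

lemma semilin_uminus: "semilin S \<Theta> \<Longrightarrow> \<Theta> (\<lambda>r. - v r) = - \<Theta> v"
  using semilin_scale[of S \<Theta> "-1" v] by (simp add: kill_uminus kill_one)

lemma semilin_diff: "semilin S \<Theta> \<Longrightarrow> \<Theta> (\<lambda>r. v r - w r) = \<Theta> v - \<Theta> w"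
  using semilin_add[of S \<Theta> v "\<lambda>r. - w r"] semilin_uminus[of S \<Theta> w] by simp

lemma semilin_comp: "semilin S \<Theta> \<Longrightarrow> qlinear D \<Longrightarrow> semilin S (\<lambda>v. \<Theta> (D v))"
  by (simp add: semilin_def qlinear_def)

lemma semilin_plus: "semilin S \<Theta> \<Longrightarrow> semilin S \<Theta>' \<Longrightarrow> semilin S (\<lambda>v. \<Theta> v + \<Theta>' v)"
  by (simp add: semilin_def algebra_simps)

lemma semilin_minus: "semilin S \<Theta> \<Longrightarrow> semilin S \<Theta>' \<Longrightarrow> semilin S (\<lambda>v. \<Theta> v - \<Theta>' v)"
  by (simp add: semilin_def algebra_simps)

lemma semilin_neg: "semilin S \<Theta> \<Longrightarrow> semilin S (\<lambda>v. - \<Theta> v)"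
  by (simp add: semilin_def)

lemma semilin_mult: "semilin S \<Theta> \<Longrightarrow> semilin S (\<lambda>v. p * \<Theta> v)"
  by (simp add: semilin_def algebra_simps)

lemma semilin_expand:
  assumes "semilin S \<Theta>" "vec {..<n} v"
  shows "\<Theta> v = (\<Sum>c<n. kill S (v c) * \<Theta> (unitv c))"
proof -
  have "\<Theta> (\<lambda>r. \<Sum>c\<in>A. v c * unitv c r) = (\<Sum>c\<in>A. kill S (v c) * \<Theta> (unitv c))" if "finite A" for A
    using that
  proof (induction A rule: finite_induct)
    case (insert x A)
    then show ?case
      using semilin_add[OF assms(1), of "\<lambda>r. v x * unitv x r" "\<lambda>r. \<Sum>c\<in>A. v c * unitv c r"]
        semilin_scale[OF assms(1)] by simp
  qed (simp add: semilin_zero[OF assms(1)])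
  from this[of "{..<n}"] show ?thesis using vec_expand[OF _ assms(2)] by simp
qed

lemma semilin_eqI:
  assumes "semilin S \<Theta>" "semilin S \<Theta>'" "vec {..<n} v" "\<And>c. c < n \<Longrightarrow> \<Theta> (unitv c) = \<Theta>' (unitv c)"
  shows "\<Theta> v = \<Theta>' v"
  unfolding semilin_expand[OF assms(1,3)] semilin_expand[OF assms(2,3)] using assms(4) by simp

definition semi_ext :: "'v set \<Rightarrow> nat \<Rightarrow> (nat \<Rightarrow> ('v, 'k::field) mpoly) \<Rightarrow> (nat \<Rightarrow> ('v, 'k) mpoly) \<Rightarrow> ('v, 'k) mpoly" where
  "semi_ext S n y v = (\<Sum>c<n. kill S (v c) * y c)"

lemma semilin_semi_ext: "semilin S (semi_ext S n y)"
  by (simp add: semilin_def semi_ext_def kill_add kill_mult algebra_simps sum.distrib sum_distrib_left)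

lemma semi_ext_unitv: "c < n \<Longrightarrow> semi_ext S n y (unitv c) = y c"
proof -
  assume c: "c < n"
  have "(\<Sum>x<n. kill S (unitv c x) * y x) = (\<Sum>x<n. if x = c then y x else 0)"
    by (intro sum.cong) (auto simp: unitv_def kill_one)
  then show ?thesis using c by (simp add: semi_ext_def)
qed

abbreviation "cf \<equiv> Poly_Mapping.lookup"

abbreviation mon :: "'v \<Rightarrow> 'v \<Rightarrow>\<^sub>0 nat" where
  "mon v \<equiv> Poly_Mapping.single v 1"

lemma cf_var_eq: "cf (var a * p) (mon a + m) = cf p m"
  unfolding var_def by (simp add: lookup_single_mult_add)

lemma cf_var_eq1: "cf (var a * p) (mon a) = cf p 0"
  using cf_var_eq[of a p 0] by simp

text \<open>If no coefficient of \<open>v\<close> has a constant term, the linear coefficients of \<open>\<Theta> v\<close> only depend on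
  the constant terms of \<open>\<Theta>\<close> on the basis.\<close>

lemma cf_semilin_linear:
  assumes "semilin S \<Theta>" "vec {..<n} v" "\<And>c. cf (v c) 0 = 0" "a \<notin> S"
  shows "cf (\<Theta> v) (mon a) = (\<Sum>c<n. cf (v c) (mon a) * cf (\<Theta> (unitv c)) 0)"
proof -
  have "cf (kill S (v c)) 0 = 0" for c using assms(3) by (simp add: lookup_kill)
  moreover have "cf (kill S (v c)) (mon a) = cf (v c) (mon a)" for c
    using assms(4) by (auto simp: lookup_kill lookup_single when_def)
  ultimately show ?thesis
    unfolding semilin_expand[OF assms(1,2)] by (simp only: lookup_sum lookup_mult_single_var) simp
qed

subsection \<open>A functional on the resolution\<close>

text \<open>Modulo the variables outside the path, \<open>I : x\<^sub>5x\<^sub>6\<close> restricted to the first four edges is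
  \<open>(x\<^sub>4, x\<^sub>1x\<^sub>2, x\<^sub>2x\<^sub>3)\<close>. The functionals below are the components of a chain map from \<open>F\<close> to the shifted
  resolution of that ideal, with differential
  \<open>h\<^sub>4 \<mapsto> x\<^sub>4\<close>, \<open>h\<^sub>1 \<mapsto> x\<^sub>1x\<^sub>2\<close>, \<open>h\<^sub>2 \<mapsto> x\<^sub>2x\<^sub>3\<close>, \<open>h\<^sub>4\<^sub>1 \<mapsto> x\<^sub>4h\<^sub>1 - x\<^sub>1x\<^sub>2h\<^sub>4\<close>, \<open>h\<^sub>4\<^sub>2 \<mapsto> x\<^sub>4h\<^sub>2 - x\<^sub>2x\<^sub>3h\<^sub>4\<close>,
  \<open>h\<^sub>1\<^sub>2 \<mapsto> x\<^sub>3h\<^sub>1 - x\<^sub>1h\<^sub>2\<close> and \<open>h\<^sub>4\<^sub>1\<^sub>2 \<mapsto> x\<^sub>4h\<^sub>1\<^sub>2 - x\<^sub>3h\<^sub>4\<^sub>1 + x\<^sub>1h\<^sub>4\<^sub>2\<close>.\<close>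

lemma mult_var_var_eq_0:
  "(p::('v, 'k::field) mpoly) * (var v * var w) = 0 \<longleftrightarrow> p = 0"
  by (simp only: mult.commute[of p] mult.assoc var_mult_eq_0)

lemma kill_kill: "kill S (kill T p) = kill (S \<union> T) p"
  by (rule poly_mapping_eqI) (auto simp: lookup_kill)

text \<open>Modulo x4, setting x2 to 0 leaves only the last term, so \<open>A5\<close> is divisible
  by x2. After cancelling x2, setting x1 and x3 to 0 puts the quotient into (x1, x3).\<close>

lemma path_colon:
  fixes A1 :: "('v, 'k::field) mpoly"
  assumes d: "distinct [a1, a2, a3, a4, a5, a6]"
    and e: "A1 * (var a1 * var a2) + A2 * (var a2 * var a3) + A3 * (var a3 * var a4) + A4 * (var a4 * var a5)
      + A5 * (var a5 * var a6) = 0"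
  obtains u4 u1 u2 where "A5 = var a4 * u4 + var a1 * var a2 * u1 + var a2 * var a3 * u2"
proof -
  have nd: "a1 \<noteq> a2" "a1 \<noteq> a3" "a1 \<noteq> a4" "a1 \<noteq> a5" "a1 \<noteq> a6" "a2 \<noteq> a1" "a2 \<noteq> a3" "a2 \<noteq> a4" "a2 \<noteq> a5" "a2 \<noteq> a6" "a3 \<noteq> a1" "a3 \<noteq> a2" "a3 \<noteq> a4" "a3 \<noteq> a5" "a3 \<noteq> a6" "a4 \<noteq> a1" "a4 \<noteq> a2" "a4 \<noteq> a3" "a4 \<noteq> a5" "a4 \<noteq> a6" "a5 \<noteq> a1" "a5 \<noteq> a2" "a5 \<noteq> a3" "a5 \<noteq> a4" "a5 \<noteq> a6" "a6 \<noteq> a1" "a6 \<noteq> a2" "a6 \<noteq> a3" "a6 \<noteq> a4" "a6 \<noteq> a5"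
    using d by auto
  obtain u4 where u4: "A5 = var a4 * u4 + kill {a4} A5" by (rule var_split)
  have e4: "kill {a4} A1 * (var a1 * var a2) + kill {a4} A2 * (var a2 * var a3)
      + kill {a4} A5 * (var a5 * var a6) = 0"
    using arg_cong[OF e, of "kill {a4}"] nd by (simp add: kill_add kill_mult kill_var)
  have "kill {a2} (kill {a4} A5) * (var a5 * var a6) = 0"
    using arg_cong[OF e4, of "kill {a2}"] nd by (simp add: kill_add kill_mult kill_var)
  then have "kill {a2} (kill {a4} A5) = 0"
    by (simp only: mult_var_var_eq_0)
  then obtain B where B: "kill {a4} A5 = var a2 * B" by (rule kill_eq_0_var_dvd)
  have "var a2 * (kill {a4} A1 * var a1 + kill {a4} A2 * var a3 + B * (var a5 * var a6)) = 0"
    using e4 unfolding B by (simp add: algebra_simps)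
  then have e2: "kill {a4} A1 * var a1 + kill {a4} A2 * var a3 + B * (var a5 * var a6) = 0"
    by (simp only: var_mult_eq_0)
  have "kill {a1, a3} B * (var a5 * var a6) = 0"
    using arg_cong[OF e2, of "kill {a1, a3}"] nd by (simp add: kill_add kill_mult kill_var)
  then have "kill {a3} (kill {a1} B) = 0"
    unfolding kill_kill mult_var_var_eq_0 by (simp add: insert_commute)
  then obtain u2 where u2: "kill {a1} B = var a3 * u2" by (rule kill_eq_0_var_dvd)
  obtain u1 where u1: "B = var a1 * u1 + kill {a1} B" by (rule var_split)
  show ?thesis
    by (rule that[of u4 u1 u2], subst u4, subst B, subst u1, subst u2) (simp add: algebra_simps)
qed

text \<open>Exactness of the resolution of (x4, x1 x2, x2 x3) at its generators. Modulo x4 the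
  common factor x2 cancels, and a syzygy of the coprime pair x1, x3 remains; its multiplier is
  \<open>s12\<close>.\<close>

lemma colon_syzygies_1:
  fixes y4 :: "('v, 'k::field) mpoly"
  assumes d: "distinct [a1, a2, a3, a4]"
    and e: "var a4 * y4 + var a1 * var a2 * y1 + var a2 * var a3 * y2 = 0"
  obtains s41 s42 s12 where "y4 = - (var a1 * var a2 * s41) - var a2 * var a3 * s42"
    "y1 = var a4 * s41 + var a3 * s12" "y2 = var a4 * s42 - var a1 * s12"
proof -
  have nd: "a1 \<noteq> a2" "a1 \<noteq> a3" "a1 \<noteq> a4" "a2 \<noteq> a1" "a2 \<noteq> a3" "a2 \<noteq> a4" "a3 \<noteq> a1" "a3 \<noteq> a2" "a3 \<noteq> a4" "a4 \<noteq> a1" "a4 \<noteq> a2" "a4 \<noteq> a3"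
    using d by auto
  obtain s41 where s41: "y1 = var a4 * s41 + kill {a4} y1" by (rule var_split)
  obtain s42 where s42: "y2 = var a4 * s42 + kill {a4} y2" by (rule var_split)
  have "var a2 * (var a1 * kill {a4} y1 + var a3 * kill {a4} y2) = 0"
    using arg_cong[OF e, of "kill {a4}"] nd by (simp add: kill_add kill_mult kill_var algebra_simps)
  then have z: "var a1 * kill {a4} y1 + var a3 * kill {a4} y2 = 0" by (simp only: var_mult_eq_0)
  then have z': "var a1 * kill {a4} y1 = var a3 * (- kill {a4} y2)"
    by (simp add: eq_neg_iff_add_eq_0)
  obtain r where r: "- kill {a4} y2 = var a1 * r"
    by (rule var_dvd_var_mult[OF z']) (use d in auto)
  have "var a1 * kill {a4} y1 = var a1 * (var a3 * r)" using z' r by (simp add: mult.left_commute)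
  then have k1: "kill {a4} y1 = var a3 * r" by (simp only: var_cancel)
  have k2: "kill {a4} y2 = - (var a1 * r)" using r by (metis minus_minus)
  have y1: "y1 = var a4 * s41 + var a3 * r" using s41 k1 by simp
  have y2: "y2 = var a4 * s42 - var a1 * r" using s42 k2 by simp
  have "var a4 * (y4 + var a1 * var a2 * s41 + var a2 * var a3 * s42) = 0"
    using e unfolding y1 y2 by (simp add: algebra_simps)
  then have "y4 + var a1 * var a2 * s41 + var a2 * var a3 * s42 = 0" by (simp only: var_mult_eq_0)
  then have "y4 = - (var a1 * var a2 * s41) - var a2 * var a3 * s42"
    by (metis (no_types, lifting) add.assoc diff_minus_eq_add eq_neg_iff_add_eq_0 minus_add_distrib uminus_add_conv_diff add.commute)
  then show ?thesis using that y1 y2 by blast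
qed

text \<open>Exactness one step further: as x3 and x4 are coprime, \<open>s12\<close> is divisible by
  x4, and the quotient \<open>t\<close> is the coefficient of the last basis element.\<close>

lemma colon_syzygies_2:
  fixes s41 :: "('v, 'k::field) mpoly"
  assumes d: "a3 \<noteq> a4"
    and e: "var a4 * s41 + var a3 * s12 = 0" "var a4 * s42 - var a1 * s12 = 0"
  obtains t where "s41 = - (var a3 * t)" "s42 = var a1 * t" "s12 = var a4 * t"
proof -
  have z: "var a4 * (- s41) = var a3 * s12"
    using e(1) by (simp add: neg_eq_iff_add_eq_0)
  obtain t where t: "s12 = var a4 * t" by (rule var_dvd_var_mult[OF z]) (use d in auto)
  have "var a4 * (- s41) = var a4 * (var a3 * t)" using z t by (simp add: mult.left_commute)
  then have 1: "- s41 = var a3 * t" by (simp only: var_cancel)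
  have "var a4 * s42 = var a4 * (var a1 * t)" using e(2) t by (simp add: mult.left_commute)
  then have 2: "s42 = var a1 * t" by (simp only: var_cancel)
  show ?thesis using that 1 2 t by (metis minus_minus)
qed

lemma kill_edge_monomial:
  assumes "finite e"
  shows "kill S (edge_monomial e :: ('v, 'k::field) mpoly) = (if e \<inter> S = {} then edge_monomial e else 0)"
proof -
  have "kill S (\<Prod>v\<in>e. var v :: ('v, 'k) mpoly) = (\<Prod>v\<in>e. kill S (var v))"
    using assms by (induction e rule: finite_induct) (simp_all add: kill_mult kill_one)
  also have "\<dots> = (if e \<inter> S = {} then edge_monomial e else 0)"
    using assms by (auto simp: edge_monomial_def kill_var disjoint_iff intro!: prod.cong prod_zero)
  finally show ?thesis by (simp add: edge_monomial_def)
qed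

lemma edge_monomial_pair: "u \<noteq> v \<Longrightarrow> edge_monomial {u, v} = var u * var v"
  by (simp add: edge_monomial_def)

text \<open>\<open>edges\<close> says that the path is induced: once the variables outside it are
  set to 0, exactly the five consecutive edges survive.\<close>

locale res_path6 =
  fixes E :: "('v::finite) set set" and F :: "('v, 'k::field) mpoly cplx" and a1 a2 a3 a4 a5 a6 :: 'v
  assumes F: "is_min_free_res E F" and E: "simple_graph E"
    and dist: "distinct [a1, a2, a3, a4, a5, a6]"
    and edges: "{e \<in> E. e \<subseteq> {a1, a2, a3, a4, a5, a6}} = {{a1, a2}, {a2, a3}, {a3, a4}, {a4, a5}, {a5, a6}}"
begin

abbreviation "out \<equiv> - {a1, a2, a3, a4, a5, a6}"

lemma d1_in: "inF F 1 v \<Longrightarrow> dd F 1 v 0 \<in> edge_ideal E"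
  using F unfolding is_min_free_res_def by blast

text \<open>\<open>f\<close> reads off the coefficient of x5 x6 after an expression through edges
  has been chosen for each basis element of F_1. By \<open>path_colon\<close> the choice matters
  only up to the colon ideal, whose elements have no constant term.\<close>

lemma ex_path_functional:
  obtains f where "semilin out f"
    "\<And>v. inF F 1 v \<Longrightarrow> \<exists>A1 A2 A3 A4. kill out (dd F 1 v 0) = A1 * (var a1 * var a2) + A2 * (var a2 * var a3)
       + A3 * (var a3 * var a4) + A4 * (var a4 * var a5) + f v * (var a5 * var a6)"
proof -
  have "\<exists>h. dd F 1 (unitv c) 0 = (\<Sum>e\<in>E. h e * edge_monomial e)" if "c < rk F 1" for c
    using d1_in[of "unitv c"] that by (auto simp: inF_vec vec_unitv edge_ideal_def)
  then obtain h where h: "\<And>c. c < rk F 1 \<Longrightarrow> dd F 1 (unitv c) 0 = (\<Sum>e\<in>E. h c e * edge_monomial e)"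
    by metis
  define G where "G e v = semi_ext out (rk F 1) (\<lambda>c. kill out (h c e)) v" for e v
  have fE: "finite e" if "e \<in> E" for e by (rule finite)
  have "kill out (dd F 1 v 0) = G {a1, a2} v * (var a1 * var a2) + G {a2, a3} v * (var a2 * var a3)
       + G {a3, a4} v * (var a3 * var a4) + G {a4, a5} v * (var a4 * var a5) + G {a5, a6} v * (var a5 * var a6)"
    if v: "inF F 1 v" for v
  proof -
    have "dd F 1 v 0 = (\<Sum>c<rk F 1. v c * dd F 1 (unitv c) 0)"
      using fun_cong[OF qlinear_expand[OF _ v[unfolded inF_vec] qlinear_dd[of F 1]], of 0] by simp
    also have "\<dots> = (\<Sum>c<rk F 1. \<Sum>e\<in>E. v c * (h c e * edge_monomial e))"
      using h by (simp add: sum_distrib_left)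
    also have "\<dots> = (\<Sum>e\<in>E. \<Sum>c<rk F 1. v c * (h c e * edge_monomial e))"
      by (rule sum.swap)
    finally have "kill out (dd F 1 v 0) = (\<Sum>e\<in>E. G e v * kill out (edge_monomial e))"
      by (simp add: kill_sum kill_mult G_def semi_ext_def sum_distrib_right mult.assoc)
    also have "\<dots> = (\<Sum>e\<in>{e \<in> E. e \<subseteq> {a1, a2, a3, a4, a5, a6}}. G e v * kill out (edge_monomial e))"
      by (rule sum.mono_neutral_right) (auto simp: kill_edge_monomial)
    also have "\<dots> = (\<Sum>e\<in>{{a1, a2}, {a2, a3}, {a3, a4}, {a4, a5}, {a5, a6}}. G e v * edge_monomial e)"
      unfolding edges by (rule sum.cong) (auto simp: kill_edge_monomial)
    also have "\<dots> = G {a1, a2} v * (var a1 * var a2) + G {a2, a3} v * (var a2 * var a3)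
       + G {a3, a4} v * (var a3 * var a4) + G {a4, a5} v * (var a4 * var a5) + G {a5, a6} v * (var a5 * var a6)"
      using dist by (simp add: doubleton_eq_iff edge_monomial_pair add.assoc)
    finally show ?thesis .
  qed
  moreover have "semilin out (G {a5, a6})"
    unfolding G_def by (rule semilin_semi_ext)
  ultimately show ?thesis using that[of "G {a5, a6}"] by blast
qed

lemma dd_dd_unitv: "c < rk F (Suc (Suc i)) \<Longrightarrow> dd F (Suc i) (dd F (Suc (Suc i)) (unitv c)) = (\<lambda>_. 0)"
  by (rule dd_dd_Suc[OF F]) (simp add: inF_vec vec_unitv)

text \<open>\<open>f\<close>, the three \<open>u\<close>, the three \<open>s\<close> and
  \<open>t\<close> live on F_1, F_2, F_3 and F_4; the index names the basis element of the target.
  The constant terms of \<open>f\<close> are fixed for every lift of the two edges, so later choices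
  of lifts do not matter.\<close>

definition path_functionals where
  "path_functionals f u4 u1 u2 s41 s42 s12 t \<longleftrightarrow>
    (semilin out f \<and> semilin out u4 \<and> semilin out u1 \<and> semilin out u2 \<and>
     semilin out s41 \<and> semilin out s42 \<and> semilin out s12 \<and> semilin out t) \<and>
    (\<forall>g. inF F 1 g \<longrightarrow> dd F 1 g 0 = var a5 * var a6 \<longrightarrow> cf (f g) 0 = 1) \<and>
    (\<forall>g. inF F 1 g \<longrightarrow> dd F 1 g 0 = var a1 * var a2 \<longrightarrow> cf (f g) 0 = 0) \<and>
    (\<forall>v. inF F 2 v \<longrightarrow> f (dd F 2 v) = var a4 * u4 v + var a1 * var a2 * u1 v + var a2 * var a3 * u2 v) \<and>
    (\<forall>v. inF F 3 v \<longrightarrow> u4 (dd F 3 v) = - (var a1 * var a2 * s41 v) - var a2 * var a3 * s42 v) \<and>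
    (\<forall>v. inF F 3 v \<longrightarrow> u1 (dd F 3 v) = var a4 * s41 v + var a3 * s12 v) \<and>
    (\<forall>v. inF F 4 v \<longrightarrow> s41 (dd F 4 v) = - (var a3 * t v)) \<and>
    (\<forall>v. inF F 5 v \<longrightarrow> t (dd F 5 v) = 0)"

text \<open>The comparison theorem by hand: the exactness lemmas for the target provide values on
  basis elements, which are extended semilinearly.\<close>

lemma ex_chain_map: "\<exists>f u4 u1 u2 s41 s42 s12 t. path_functionals f u4 u1 u2 s41 s42 s12 t"
proof -
  obtain f where f: "semilin out f"
    "\<And>v. inF F 1 v \<Longrightarrow> \<exists>A1 A2 A3 A4. kill out (dd F 1 v 0) = A1 * (var a1 * var a2) + A2 * (var a2 * var a3)
       + A3 * (var a3 * var a4) + A4 * (var a4 * var a5) + f v * (var a5 * var a6)"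
    by (rule ex_path_functional) blast
  have ker: "\<exists>u4 u1 u2. f v = var a4 * u4 + var a1 * var a2 * u1 + var a2 * var a3 * u2"
    if asm: "inF F 1 v" "dd F 1 v = (\<lambda>_. 0)" for v
  proof -
    obtain A1 A2 A3 A4 where "kill out (dd F 1 v 0) = A1 * (var a1 * var a2) + A2 * (var a2 * var a3)
       + A3 * (var a3 * var a4) + A4 * (var a4 * var a5) + f v * (var a5 * var a6)" using f(2)[OF asm(1)] by blast
    then have "A1 * (var a1 * var a2) + A2 * (var a2 * var a3)
       + A3 * (var a3 * var a4) + A4 * (var a4 * var a5) + f v * (var a5 * var a6) = 0" using asm(2) by simp
    from path_colon[OF dist this] show ?thesis by metis
  qed
  have f5: "cf (f g) 0 = 1" if asm: "inF F 1 g" "dd F 1 g 0 = var a5 * var a6" for g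
  proof -
    obtain A1 A2 A3 A4 where A: "kill out (dd F 1 g 0) = A1 * (var a1 * var a2) + A2 * (var a2 * var a3)
       + A3 * (var a3 * var a4) + A4 * (var a4 * var a5) + f g * (var a5 * var a6)" using f(2)[OF asm(1)] by blast
    have "kill out (dd F 1 g 0) = var a5 * var a6" unfolding asm(2) by (simp add: kill_mult kill_var)
    \<comment> \<open>With \<open>f g\<close> replaced by \<open>f g - 1\<close> the relation sums
      to zero, so \<open>f g - 1\<close> lies in the colon ideal and has no constant term.\<close>
    moreover have "A1 * (var a1 * var a2) + A2 * (var a2 * var a3)
       + A3 * (var a3 * var a4) + A4 * (var a4 * var a5) + (f g - 1) * (var a5 * var a6)
       = (A1 * (var a1 * var a2) + A2 * (var a2 * var a3)
       + A3 * (var a3 * var a4) + A4 * (var a4 * var a5) + f g * (var a5 * var a6)) - var a5 * var a6"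
      by (simp add: left_diff_distrib)
    ultimately have "A1 * (var a1 * var a2) + A2 * (var a2 * var a3)
       + A3 * (var a3 * var a4) + A4 * (var a4 * var a5) + (f g - 1) * (var a5 * var a6) = 0"
      by (simp only: A[symmetric]) simp
    from path_colon[OF dist this] obtain u4 u1 u2
      where "f g - 1 = var a4 * u4 + var a1 * var a2 * u1 + var a2 * var a3 * u2" by metis
    then have "cf (f g - 1) 0 = 0" by (simp add: lookup_add lookup_var_mult mult.assoc)
    then show ?thesis by (simp add: lookup_minus)
  qed
  have f1: "cf (f g) 0 = 0" if asm: "inF F 1 g" "dd F 1 g 0 = var a1 * var a2" for g
  proof -
    obtain A1 A2 A3 A4 where A: "kill out (dd F 1 g 0) = A1 * (var a1 * var a2) + A2 * (var a2 * var a3)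
       + A3 * (var a3 * var a4) + A4 * (var a4 * var a5) + f g * (var a5 * var a6)" using f(2)[OF asm(1)] by blast
    have "kill out (dd F 1 g 0) = var a1 * var a2" unfolding asm(2) by (simp add: kill_mult kill_var)
    moreover have "(A1 - 1) * (var a1 * var a2) + A2 * (var a2 * var a3)
       + A3 * (var a3 * var a4) + A4 * (var a4 * var a5) + f g * (var a5 * var a6)
       = (A1 * (var a1 * var a2) + A2 * (var a2 * var a3)
       + A3 * (var a3 * var a4) + A4 * (var a4 * var a5) + f g * (var a5 * var a6)) - var a1 * var a2"
      by (simp add: left_diff_distrib)
    ultimately have "(A1 - 1) * (var a1 * var a2) + A2 * (var a2 * var a3)
       + A3 * (var a3 * var a4) + A4 * (var a4 * var a5) + f g * (var a5 * var a6) = 0"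
      by (simp only: A[symmetric]) simp
    from path_colon[OF dist this] obtain u4 u1 u2
      where "f g = var a4 * u4 + var a1 * var a2 * u1 + var a2 * var a3 * u2" by metis
    then show ?thesis by (simp add: lookup_add lookup_var_mult mult.assoc)
  qed
  have inF_d: "inF F i (dd F (Suc i) v)" for i v using inF_dd[of F "Suc i" v] by simp
  have "\<exists>y4 y1 y2. f (dd F 2 (unitv c)) = var a4 * y4 + var a1 * var a2 * y1 + var a2 * var a3 * y2"
    if c: "c < rk F 2" for c
  proof (rule ker)
    show "inF F 1 (dd F 2 (unitv c))" using inF_d[of 1 "unitv c"] by (simp add: numeral_2_eq_2)
    show "dd F 1 (dd F 2 (unitv c)) = (\<lambda>_. 0)" using dd_dd_unitv[of c 0] c by (simp add: numeral_2_eq_2)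
  qed
  then obtain y4 y1 y2 where y: "\<And>c. c < rk F 2 \<Longrightarrow>
      f (dd F 2 (unitv c)) = var a4 * y4 c + var a1 * var a2 * y1 c + var a2 * var a3 * y2 c"
    by metis
  define u4 u1 u2 where u: "u4 = semi_ext out (rk F 2) y4" "u1 = semi_ext out (rk F 2) y1"
    "u2 = semi_ext out (rk F 2) y2"
  have su: "semilin out u4" "semilin out u1" "semilin out u2" unfolding u by (rule semilin_semi_ext)+
  have R2: "f (dd F 2 v) = var a4 * u4 v + var a1 * var a2 * u1 v + var a2 * var a3 * u2 v"
    if v: "inF F 2 v" for v
    by (rule semilin_eqI[OF semilin_comp[OF f(1) qlinear_dd] _ v[unfolded inF_vec]])
       (auto simp: u semi_ext_unitv y intro!: semilin_plus semilin_mult semilin_semi_ext)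
  have "\<exists>z41 z42 z12. u4 (dd F 3 (unitv c)) = - (var a1 * var a2 * z41) - var a2 * var a3 * z42 \<and>
      u1 (dd F 3 (unitv c)) = var a4 * z41 + var a3 * z12 \<and> u2 (dd F 3 (unitv c)) = var a4 * z42 - var a1 * z12"
    if c: "c < rk F 3" for c
  proof -
    have w: "inF F 2 (dd F 3 (unitv c))" using inF_d[of 2 "unitv c"] by (simp add: numeral_3_eq_3)
    have "dd F 2 (dd F 3 (unitv c)) = (\<lambda>_. 0)"
      using dd_dd_unitv[of c 1] c by (simp add: numeral_2_eq_2 numeral_3_eq_3)
    then have "f (dd F 2 (dd F 3 (unitv c))) = 0" by (simp add: semilin_zero[OF f(1)])
    then have "var a4 * u4 (dd F 3 (unitv c)) + var a1 * var a2 * u1 (dd F 3 (unitv c))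
        + var a2 * var a3 * u2 (dd F 3 (unitv c)) = 0" using R2[OF w] by simp
    from colon_syzygies_1[OF _ this] dist show ?thesis by (metis distinct.simps(2) distinct_length_2_or_more)
  qed
  then obtain z41 z42 z12 where z: "\<And>c. c < rk F 3 \<Longrightarrow>
      u4 (dd F 3 (unitv c)) = - (var a1 * var a2 * z41 c) - var a2 * var a3 * z42 c \<and>
      u1 (dd F 3 (unitv c)) = var a4 * z41 c + var a3 * z12 c \<and> u2 (dd F 3 (unitv c)) = var a4 * z42 c - var a1 * z12 c"
    by metis
  define s41 s42 s12 where s: "s41 = semi_ext out (rk F 3) z41" "s42 = semi_ext out (rk F 3) z42"
    "s12 = semi_ext out (rk F 3) z12"
  have ss: "semilin out s41" "semilin out s42" "semilin out s12" unfolding s by (rule semilin_semi_ext)+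
  have R3a: "u4 (dd F 3 v) = - (var a1 * var a2 * s41 v) - var a2 * var a3 * s42 v" if v: "inF F 3 v" for v
    by (rule semilin_eqI[OF semilin_comp[OF su(1) qlinear_dd] _ v[unfolded inF_vec]])
       (auto simp: s semi_ext_unitv z intro!: semilin_minus semilin_neg semilin_mult semilin_semi_ext)
  have R3b: "u1 (dd F 3 v) = var a4 * s41 v + var a3 * s12 v" if v: "inF F 3 v" for v
    by (rule semilin_eqI[OF semilin_comp[OF su(2) qlinear_dd] _ v[unfolded inF_vec]])
       (auto simp: s semi_ext_unitv z intro!: semilin_plus semilin_mult semilin_semi_ext)
  have R3c: "u2 (dd F 3 v) = var a4 * s42 v - var a1 * s12 v" if v: "inF F 3 v" for v
    by (rule semilin_eqI[OF semilin_comp[OF su(3) qlinear_dd] _ v[unfolded inF_vec]])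
       (auto simp: s semi_ext_unitv z intro!: semilin_minus semilin_neg semilin_mult semilin_semi_ext)
  have S4: "\<exists>t. s41 w = - (var a3 * t) \<and> s42 w = var a1 * t \<and> s12 w = var a4 * t"
    if w: "inF F 3 w" "dd F 3 w = (\<lambda>_. 0)" for w
  proof -
    have "var a4 * s41 w + var a3 * s12 w = 0"
      using R3b[OF w(1)] w(2) semilin_zero[OF su(2)] by simp
    moreover have "var a4 * s42 w - var a1 * s12 w = 0"
      using R3c[OF w(1)] w(2) semilin_zero[OF su(3)] by simp
    moreover have "a3 \<noteq> a4" using dist by auto
    ultimately show ?thesis using colon_syzygies_2 by metis
  qed
  have "\<exists>t. s41 (dd F 4 (unitv c)) = - (var a3 * t)" if c: "c < rk F 4" for c
  proof -
    have w: "inF F 3 (dd F 4 (unitv c))" using inF_d[of 3 "unitv c"] by simp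
    have "dd F 3 (dd F 4 (unitv c)) = (\<lambda>_. 0)"
      using dd_dd_unitv[of c 2] c by (simp add: numeral_2_eq_2 numeral_3_eq_3 eval_nat_numeral)
    from S4[OF w this] show ?thesis by blast
  qed
  then obtain \<tau> where \<tau>: "\<And>c. c < rk F 4 \<Longrightarrow> s41 (dd F 4 (unitv c)) = - (var a3 * \<tau> c)" by metis
  define t where t: "t = semi_ext out (rk F 4) \<tau>"
  have st: "semilin out t" unfolding t by (rule semilin_semi_ext)
  have R4: "s41 (dd F 4 v) = - (var a3 * t v)" if v: "inF F 4 v" for v
    by (rule semilin_eqI[OF semilin_comp[OF ss(1) qlinear_dd] _ v[unfolded inF_vec]])
       (auto simp: t semi_ext_unitv \<tau> intro!: semilin_neg semilin_mult semilin_semi_ext)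
  have R5: "t (dd F 5 v) = 0" if v: "inF F 5 v" for v
  proof -
    have w: "inF F 4 (dd F 5 v)" using inF_d[of 4 v] by simp
    have "dd F 4 (dd F 5 v) = (\<lambda>_. 0)"
      using dd_dd_Suc[OF F, of 3 v] v by (simp add: eval_nat_numeral)
    then have "var a3 * t (dd F 5 v) = 0" using R4[OF w] semilin_zero[OF ss(1)] by simp
    then show ?thesis unfolding var_mult_eq_0 by simp
  qed
  have "path_functionals f u4 u1 u2 s41 s42 s12 t"
    unfolding path_functionals_def
    by (intro conjI allI impI; fact f(1) su ss st f5 f1 R2 R3a R3b R4 R5)
  then show ?thesis by blast
qed

end

section \<open>Comparison of low coefficients and the contradiction\<close>

context res_path6
begin

lemma nd: "a1 \<noteq> a2" "a1 \<noteq> a3" "a1 \<noteq> a4" "a1 \<noteq> a5" "a1 \<noteq> a6" "a2 \<noteq> a1" "a2 \<noteq> a3" "a2 \<noteq> a4" "a2 \<noteq> a5" "a2 \<noteq> a6" "a3 \<noteq> a1" "a3 \<noteq> a2" "a3 \<noteq> a4" "a3 \<noteq> a5" "a3 \<noteq> a6" "a4 \<noteq> a1" "a4 \<noteq> a2" "a4 \<noteq> a3" "a4 \<noteq> a5" "a4 \<noteq> a6" "a5 \<noteq> a1" "a5 \<noteq> a2" "a5 \<noteq> a3" "a5 \<noteq> a4" "a5 \<noteq> a6" "a6 \<noteq> a1" "a6 \<noteq> a2" "a6 \<noteq> a3" "a6 \<noteq> a4" "a6 \<noteq> a5"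
  using dist by auto

lemma inF_add: "inF F i v \<Longrightarrow> inF F i w \<Longrightarrow> inF F i (\<lambda>r. v r + w r)" by (simp add: inF_def)
lemma inF_diff: "inF F i v \<Longrightarrow> inF F i w \<Longrightarrow> inF F i (\<lambda>r. v r - w r)" by (simp add: inF_def)
lemma inF_scale: "inF F i v \<Longrightarrow> inF F i (\<lambda>r. q * v r)" by (simp add: inF_def)

lemmas dd_lin = qlinear_add[OF qlinear_dd] qlinear_diff[OF qlinear_dd] qlinear_scale[OF qlinear_dd]

lemma ex_generator:
  assumes "{u, v} \<in> E" "u \<noteq> v"
  obtains g where "inF F 1 g" "dd F 1 g 0 = var u * var v"
proof -
  have "(\<Sum>e\<in>E. (if e = {u, v} then 1 else 0) * edge_monomial e) = (\<Sum>e\<in>E. if e = {u, v} then edge_monomial e else 0)"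
    by (rule sum.cong) auto
  also have "\<dots> = (edge_monomial {u, v} :: ('v, 'k) mpoly)" using assms(1) by simp
  finally have "edge_monomial {u, v} \<in> (edge_ideal E :: ('v, 'k) mpoly set)"
    unfolding edge_ideal_def by (intro CollectI exI[of _ "\<lambda>e. if e = {u, v} then 1 else 0"]) simp
  then have "edge_monomial {u, v} \<in> {dd F 1 v 0 | v. inF F 1 v}"
    using F unfolding is_min_free_res_def by metis
  then obtain w where "inF F 1 w" "edge_monomial {u, v} = dd F 1 w 0" by blast
  moreover from this have "dd F 1 w 0 = var u * var v" using edge_monomial_pair[OF assms(2)] by metis
  ultimately show ?thesis using that by blast
qed

lemma ex_preimage:
  assumes "inF F 1 v" "dd F 1 v 0 = 0"
  obtains w where "inF F 2 w" "dd F 2 w = v"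
proof -
  have rk0: "rk F 0 = 1" using F by (simp add: is_min_free_res_def)
  have z: "dd F (Suc 0) v = (\<lambda>_. 0)"
  proof
    fix r
    show "dd F (Suc 0) v r = 0" using assms(2) rk0 by (cases "r = 0") (simp_all add: dd_def)
  qed
  show ?thesis
    by (rule res_exact[OF F _ z]) (use assms(1) that in \<open>auto simp: numeral_2_eq_2\<close>)
qed

text \<open>A single edge survives the substitution, so the ideal becomes principal.\<close>

lemma edge_ideal_kill:
  assumes D: "(D :: ('v, 'k) mpoly) \<in> edge_ideal E" and W: "{e \<in> E. e \<subseteq> W} = {{a1, a2}}"
  obtains h where "kill (- W) D = kill (- W) h * (var a1 * var a2)"
proof -
  obtain h where h: "D = (\<Sum>e\<in>E. h e * edge_monomial e)" using D by (auto simp: edge_ideal_def)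
  have "kill (- W) D = (\<Sum>e\<in>E. kill (- W) (h e) * kill (- W) (edge_monomial e))"
    by (simp add: h kill_sum kill_mult)
  also have "\<dots> = (\<Sum>e\<in>{e \<in> E. e \<subseteq> W}. kill (- W) (h e) * kill (- W) (edge_monomial e))"
    by (rule sum.mono_neutral_right) (auto simp: kill_edge_monomial)
  also have "\<dots> = kill (- W) (h {a1, a2}) * (var a1 * var a2)"
  proof -
    have "a1 \<in> W" "a2 \<in> W" using W by blast+
    then show ?thesis unfolding W using nd by (simp add: edge_monomial_pair kill_mult kill_var)
  qed
  finally show ?thesis using that by blast
qed

lemma cf_kill: "(\<And>v. v \<in> S \<Longrightarrow> cf m v = 0) \<Longrightarrow> cf (kill S p) m = cf p m"
  by (simp add: lookup_kill)

lemma edges_12: "{e \<in> E. e \<subseteq> {a1, a2}} = {{a1, a2}}" "{e \<in> E. e \<subseteq> {a1, a2, a4}} = {{a1, a2}}"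
proof -
  have *: "{e \<in> E. e \<subseteq> W} = {e \<in> {{a1, a2}, {a2, a3}, {a3, a4}, {a4, a5}, {a5, a6}}. e \<subseteq> W}"
    if "W \<subseteq> {a1, a2, a3, a4, a5, a6}" for W
    unfolding edges[symmetric] using that by auto
  have sel: "{e \<in> {A, B, C, D, G}. P e} = {A}" if "P A" "\<not> P B" "\<not> P C" "\<not> P D" "\<not> P G"
    for P :: "'v set \<Rightarrow> bool" and A B C D G using that by blast
  show "{e \<in> E. e \<subseteq> {a1, a2}} = {{a1, a2}}" by (subst *, simp, rule sel) (simp_all add: nd)
  show "{e \<in> E. e \<subseteq> {a1, a2, a4}} = {{a1, a2}}" by (subst *, simp, rule sel) (simp_all add: nd)
qed

text \<open>The only edge dividing x1 x2 is that monomial itself, so the other factor contributes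
  just its constant term.\<close>

lemma edge_ideal_cf_12:
  assumes D: "(D :: ('v, 'k) mpoly) \<in> edge_ideal E"
  shows "cf (kill out D * q) (mon a1 + mon a2) = cf D (mon a1 + mon a2) * cf q 0"
proof -
  let ?S = "- {a1, a2}"
  obtain h where h: "kill ?S D = kill ?S h * (var a1 * var a2)"
    by (rule edge_ideal_kill[OF D edges_12(1)])
  have c: "cf (kill ?S p) (mon a1 + mon a2) = cf p (mon a1 + mon a2)" for p :: "('v, 'k) mpoly"
    by (rule cf_kill) (auto simp: lookup_add lookup_single when_def)
  have so: "?S \<union> out = ?S" by auto
  have v: "cf (p * (var a1 * var a2)) (mon a1 + mon a2) = cf p 0" for p :: "('v, 'k) mpoly"
  proof -
    have "p * (var a1 * var a2) = var a1 * (var a2 * p)" by (simp add: mult_ac)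
    then show ?thesis by (simp only: cf_var_eq cf_var_eq1)
  qed
  have "cf (kill out D * q) (mon a1 + mon a2) = cf (kill ?S (kill out D * q)) (mon a1 + mon a2)"
    by (rule c[symmetric])
  also have "kill ?S (kill out D * q) = (kill ?S h * kill ?S q) * (var a1 * var a2)"
    unfolding kill_mult kill_kill so h by (simp add: mult_ac)
  also have "cf \<dots> (mon a1 + mon a2) = cf h 0 * cf q 0"
    unfolding v lookup_mult_zero by (simp add: lookup_kill)
  also have "cf h 0 = cf D (mon a1 + mon a2)"
    using v[of "kill ?S h"] unfolding h[symmetric] c by (simp add: lookup_kill)
  finally show ?thesis .
qed

text \<open>Only the edge x1 x2 divides x1 x2 x4. It leaves x4, which must come from
  \<open>q\<close> because \<open>q\<close> has no constant term.\<close>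

lemma edge_ideal_cf_124:
  assumes D: "(D :: ('v, 'k) mpoly) \<in> edge_ideal E" and q: "cf q 0 = 0"
  shows "cf (q * D) (mon a1 + (mon a2 + mon a4)) = cf q (mon a4) * cf D (mon a1 + mon a2)"
proof -
  let ?S = "- {a1, a2, a4}"
  obtain h where h: "kill ?S D = kill ?S h * (var a1 * var a2)"
    by (rule edge_ideal_kill[OF D edges_12(2)])
  have c: "cf (kill ?S p) (mon a1 + (mon a2 + mon a4)) = cf p (mon a1 + (mon a2 + mon a4))" for p :: "('v, 'k) mpoly"
    by (rule cf_kill) (auto simp: lookup_add lookup_single when_def)
  have c': "cf (kill ?S p) (mon a1 + mon a2) = cf p (mon a1 + mon a2)" for p :: "('v, 'k) mpoly"
    by (rule cf_kill) (auto simp: lookup_add lookup_single when_def)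
  have c4: "cf (kill ?S p) (mon a4) = cf p (mon a4)" for p :: "('v, 'k) mpoly"
    by (rule cf_kill) (auto simp: lookup_single when_def)
  have m: "p * (var a1 * var a2) = var a1 * (var a2 * p)" for p :: "('v, 'k) mpoly" by (simp add: mult_ac)
  have "cf (q * D) (mon a1 + (mon a2 + mon a4)) = cf (kill ?S (q * D)) (mon a1 + (mon a2 + mon a4))"
    by (rule c[symmetric])
  also have "kill ?S (q * D) = (kill ?S q * kill ?S h) * (var a1 * var a2)"
    unfolding kill_mult h by (simp add: mult_ac)
  also have "cf \<dots> (mon a1 + (mon a2 + mon a4)) = cf (kill ?S q * kill ?S h) (mon a4)"
    unfolding m cf_var_eq ..
  also have "\<dots> = cf q (mon a4) * cf h 0"
    unfolding lookup_mult_single_var c4 using q by (simp add: lookup_kill)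
  also have "cf h 0 = cf D (mon a1 + mon a2)"
  proof -
    have "cf D (mon a1 + mon a2) = cf (var a1 * (var a2 * kill ?S h)) (mon a1 + mon a2)"
      using c'[of D] unfolding h m by simp
    then show ?thesis unfolding cf_var_eq cf_var_eq1 by (simp add: lookup_kill)
  qed
  finally show ?thesis .
qed

text \<open>Let \<open>g\<^sub>i\<close> lift \<open>x\<^sub>ix\<^sub>i\<^sub>+\<^sub>1\<close>, let \<open>g\<^sub>i\<^sub>j\<close> lift the syzygies of consecutive edges and
  \<open>p = x\<^sub>5g\<^sub>2\<^sub>3 + x\<^sub>2g\<^sub>3\<^sub>4\<close>. Comparing low coefficients, \<open>t (g\<^sub>1w)\<close> and \<open>t (g\<^sub>5w)\<close> have constant term 0 for
  every \<open>w\<close>, hence \<open>x\<^sub>2x\<^sub>5\<close> does not occur in \<open>t (g\<^sub>1g\<^sub>5p)\<close>. But \<open>s\<^sub>4\<^sub>1\<close> maps the boundary of \<open>g\<^sub>1g\<^sub>5p\<close>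
  to \<open>- x\<^sub>3\<close> times that value, and there the summand \<open>x\<^sub>2x\<^sub>3g\<^sub>1g\<^sub>5g\<^sub>4\<close> contributes \<open>x\<^sub>2x\<^sub>3x\<^sub>5\<close>.\<close>

lemma no_dga_structure:
  assumes "is_dga_structure F mu"
  shows False
proof -
  obtain f u4 u1 u2 s41 s42 s12 t where PF: "path_functionals f u4 u1 u2 s41 s42 s12 t"
    using ex_chain_map by blast
  have sl: "semilin out f" "semilin out u4" "semilin out u1" "semilin out u2"
      "semilin out s41" "semilin out s42" "semilin out s12" "semilin out t"
    and f5: "\<And>g. inF F 1 g \<Longrightarrow> dd F 1 g 0 = var a5 * var a6 \<Longrightarrow> cf (f g) 0 = 1"
    and f1: "\<And>g. inF F 1 g \<Longrightarrow> dd F 1 g 0 = var a1 * var a2 \<Longrightarrow> cf (f g) 0 = 0"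
    and R2: "\<And>v. inF F 2 v \<Longrightarrow> f (dd F 2 v) = var a4 * u4 v + var a1 * var a2 * u1 v + var a2 * var a3 * u2 v"
    and R3a: "\<And>v. inF F 3 v \<Longrightarrow> u4 (dd F 3 v) = - (var a1 * var a2 * s41 v) - var a2 * var a3 * s42 v"
    and R3b: "\<And>v. inF F 3 v \<Longrightarrow> u1 (dd F 3 v) = var a4 * s41 v + var a3 * s12 v"
    and R4: "\<And>v. inF F 4 v \<Longrightarrow> s41 (dd F 4 v) = - (var a3 * t v)"
    and R5: "\<And>v. inF F 5 v \<Longrightarrow> t (dd F 5 v) = 0"
    using PF[unfolded path_functionals_def] by (elim conjE; simp)+
  obtain L where L: "\<And>g i. inF F 1 g \<Longrightarrow> qlinear (L g i)"
    "\<And>g i a. inF F 1 g \<Longrightarrow> inF F (Suc i) (L g i a)"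
    "\<And>g i a. inF F 1 g \<Longrightarrow> inF F (Suc i) a \<Longrightarrow>
       dd F (Suc (Suc i)) (L g (Suc i) a) = (\<lambda>r. dd F 1 g 0 * a r - L g i (dd F (Suc i) a) r)"
    "\<And>g a. inF F 1 g \<Longrightarrow> inF F 0 a \<Longrightarrow> L g 0 a = (\<lambda>r. a 0 * g r)"
    "\<And>g h i a. inF F 1 g \<Longrightarrow> inF F 1 h \<Longrightarrow> inF F i a \<Longrightarrow>
       L g (Suc i) (L h i a) = (\<lambda>r. - L h (Suc i) (L g i a) r)"
    by (rule dga_left_multiplication[OF F assms]) blast
  have dS: "inF F i (dd F (Suc i) a)" for i a using inF_dd[of F "Suc i" a] by simp
  have din: "inF F 1 (dd F 2 a)" "inF F 2 (dd F 3 a)" "inF F 3 (dd F 4 a)" "inF F 4 (dd F 5 a)" for a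
    using dS[of 1 a] dS[of 2 a] dS[of 3 a] dS[of 4 a] by (simp_all add: eval_nat_numeral)
  have Lin: "inF F 2 (L g 1 a)" "inF F 3 (L g 2 a)" "inF F 4 (L g 3 a)" "inF F 5 (L g 4 a)"
    if "inF F 1 g" for g a
    using L(2)[OF that, of 1 a] L(2)[OF that, of 2 a] L(2)[OF that, of 3 a] L(2)[OF that, of 4 a]
    by (simp_all add: eval_nat_numeral)
  have dL1: "dd F 2 (L g 1 a) = (\<lambda>r. dd F 1 g 0 * a r - dd F 1 a 0 * g r)"
    if g: "inF F 1 g" and a: "inF F 1 a" for g a
    using L(3)[OF g, of 0 a] a L(4)[OF g dS[of 0 a]] by (simp add: numeral_2_eq_2)
  have dL2: "dd F 3 (L g 2 a) = (\<lambda>r. dd F 1 g 0 * a r - L g 1 (dd F 2 a) r)"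
    if g: "inF F 1 g" and a: "inF F 2 a" for g a
    using L(3)[OF g, of 1 a] a by (simp add: numeral_2_eq_2 numeral_3_eq_3)
  have dL3: "dd F 4 (L g 3 a) = (\<lambda>r. dd F 1 g 0 * a r - L g 2 (dd F 3 a) r)"
    if g: "inF F 1 g" and a: "inF F 3 a" for g a
    using L(3)[OF g, of 2 a] a by (simp add: eval_nat_numeral)
  have dL4: "dd F 5 (L g 4 a) = (\<lambda>r. dd F 1 g 0 * a r - L g 3 (dd F 4 a) r)"
    if g: "inF F 1 g" and a: "inF F 4 a" for g a
    using L(3)[OF g, of 3 a] a by (simp add: eval_nat_numeral)
  have LL1: "L g 2 (L h 1 a) = (\<lambda>r. - L h 2 (L g 1 a) r)"
    if "inF F 1 g" "inF F 1 h" "inF F 1 a" for g h a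
    using L(5)[OF that] by (simp add: numeral_2_eq_2)
  have LL2: "L g 3 (L h 2 a) = (\<lambda>r. - L h 3 (L g 2 a) r)"
    if "inF F 1 g" "inF F 1 h" "inF F 2 a" for g h a
    using L(5)[OF that] by (simp add: numeral_2_eq_2 numeral_3_eq_3)
  have Llin: "L g i (\<lambda>r. v r + w r) = (\<lambda>r. L g i v r + L g i w r)"
    "L g i (\<lambda>r. v r - w r) = (\<lambda>r. L g i v r - L g i w r)"
    "L g i (\<lambda>r. q * v r) = (\<lambda>r. q * L g i v r)" if "inF F 1 g" for g i v w q
    using qlinear_add[OF L(1)[OF that]] qlinear_diff[OF L(1)[OF that]] qlinear_scale[OF L(1)[OF that]]
    by simp_all
  have ex2: "\<exists>w. inF F 3 w \<and> dd F 3 w = v" if v: "inF F 2 v" "dd F 2 v = (\<lambda>_. 0)" for v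
  proof -
    obtain w where "inF F (Suc (Suc 1)) w" "dd F (Suc (Suc 1)) w = v"
      by (rule res_exact[OF F, of 1 v]) (use v in \<open>simp_all add: numeral_2_eq_2\<close>)
    then show ?thesis by (auto simp: numeral_3_eq_3)
  qed
  have ex3: "\<exists>w. inF F 4 w \<and> dd F 4 w = v" if v: "inF F 3 v" "dd F 3 v = (\<lambda>_. 0)" for v
  proof -
    obtain w where "inF F (Suc (Suc 2)) w" "dd F (Suc (Suc 2)) w = v"
      by (rule res_exact[OF F, of 2 v]) (use v in \<open>simp_all add: numeral_2_eq_2 numeral_3_eq_3\<close>)
    then show ?thesis by (auto simp: eval_nat_numeral)
  qed
  note One_nat_def [simp del]
  have inE: "{a1, a2} \<in> E" "{a2, a3} \<in> E" "{a3, a4} \<in> E" "{a4, a5} \<in> E" "{a5, a6} \<in> E"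
    using edges by blast+
  obtain g1 where g1: "inF F 1 g1" "dd F 1 g1 0 = var a1 * var a2" by (rule ex_generator[OF inE(1)]) (use nd in auto)
  obtain g2 where g2: "inF F 1 g2" "dd F 1 g2 0 = var a2 * var a3" by (rule ex_generator[OF inE(2)]) (use nd in auto)
  obtain g3 where g3: "inF F 1 g3" "dd F 1 g3 0 = var a3 * var a4" by (rule ex_generator[OF inE(3)]) (use nd in auto)
  obtain g4 where g4: "inF F 1 g4" "dd F 1 g4 0 = var a4 * var a5" by (rule ex_generator[OF inE(4)]) (use nd in auto)
  obtain g5 where g5: "inF F 1 g5" "dd F 1 g5 0 = var a5 * var a6" by (rule ex_generator[OF inE(5)]) (use nd in auto)
  note gs = g1(1) g2(1) g3(1) g4(1) g5(1)
  note inI = inF_add inF_diff inF_scale gs Lin[OF g1(1)] Lin[OF g5(1)]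
  obtain g12 where g12: "inF F 2 g12" "dd F 2 g12 = (\<lambda>r. var a3 * g1 r - var a1 * g2 r)"
    by (rule ex_preimage[of "\<lambda>r. var a3 * g1 r - var a1 * g2 r"]) (auto simp: dd_lin g1(2) g2(2) mult_ac intro!: inI)
  obtain g23 where g23: "inF F 2 g23" "dd F 2 g23 = (\<lambda>r. var a4 * g2 r - var a2 * g3 r)"
    by (rule ex_preimage[of "\<lambda>r. var a4 * g2 r - var a2 * g3 r"]) (auto simp: dd_lin g2(2) g3(2) mult_ac intro!: inI)
  obtain g34 where g34: "inF F 2 g34" "dd F 2 g34 = (\<lambda>r. var a5 * g3 r - var a3 * g4 r)"
    by (rule ex_preimage[of "\<lambda>r. var a5 * g3 r - var a3 * g4 r"]) (auto simp: dd_lin g3(2) g4(2) mult_ac intro!: inI)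
  obtain g45 where g45: "inF F 2 g45" "dd F 2 g45 = (\<lambda>r. var a6 * g4 r - var a4 * g5 r)"
    by (rule ex_preimage[of "\<lambda>r. var a6 * g4 r - var a4 * g5 r"]) (auto simp: dd_lin g4(2) g5(2) mult_ac intro!: inI)
  note inI = inI g12(1) g23(1) g34(1) g45(1)
  note dg = g12(2) g23(2) g34(2) g45(2)
  note dLs = dL1[OF g1(1)] dL1[OF g5(1)] g1(2) g2(2) g3(2) g4(2) g5(2)
  \<comment> \<open>g1 g2 and - x2 g12 have the same boundary, so exactness provides
    \<open>w12\<close>; \<open>w13\<close>, \<open>w54\<close> and \<open>w53\<close> compare the
    other products in the same way.\<close>
  have "\<exists>w. inF F 3 w \<and> dd F 3 w = (\<lambda>r. L g1 1 g2 r + var a2 * g12 r)"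
    by (rule ex2) (intro inI, simp add: dd_lin dLs gs dg algebra_simps)
  then obtain w12 where w12: "inF F 3 w12" "dd F 3 w12 = (\<lambda>r. L g1 1 g2 r + var a2 * g12 r)" by blast
  have "\<exists>w. inF F 3 w \<and> dd F 3 w = (\<lambda>r. L g1 1 g3 r + var a4 * g12 r + var a1 * g23 r)"
    by (rule ex2) (intro inI, simp add: dd_lin dLs gs dg algebra_simps)
  then obtain w13 where w13: "inF F 3 w13" "dd F 3 w13 = (\<lambda>r. L g1 1 g3 r + var a4 * g12 r + var a1 * g23 r)" by blast
  have "\<exists>w. inF F 3 w \<and> dd F 3 w = (\<lambda>r. L g5 1 g4 r - var a5 * g45 r)"
    by (rule ex2) (intro inI, simp add: dd_lin dLs gs dg algebra_simps)
  then obtain w54 where w54: "inF F 3 w54" "dd F 3 w54 = (\<lambda>r. L g5 1 g4 r - var a5 * g45 r)" by blast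
  have "\<exists>w. inF F 3 w \<and> dd F 3 w = (\<lambda>r. L g5 1 g3 r - var a6 * g34 r - var a3 * g45 r)"
    by (rule ex2) (intro inI, simp add: dd_lin dLs gs dg algebra_simps)
  then obtain w53 where w53: "inF F 3 w53" "dd F 3 w53 = (\<lambda>r. L g5 1 g3 r - var a6 * g34 r - var a3 * g45 r)" by blast
  note inI = inI w12(1) w13(1) w54(1) w53(1)
  note dw = w12(2) w13(2) w54(2) w53(2)
  note Ll = Llin[OF g1(1)] Llin[OF g5(1)]
  \<comment> \<open>One degree higher: up to a boundary, g1 g23 is expressed through
    \<open>w12\<close> and \<open>w13\<close>, and likewise g5 g34 through \<open>w53\<close> and
    \<open>w54\<close>.\<close>
  have "\<exists>w. inF F 4 w \<and> dd F 4 w = (\<lambda>r. L g1 2 g23 r + var a4 * w12 r - var a2 * w13 r)"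
    by (rule ex3) (intro inI, simp add: dd_lin dL2[OF g1(1)] g1(2) g23 dw Ll algebra_simps)
  then obtain v1 where v1: "inF F 4 v1" "dd F 4 v1 = (\<lambda>r. L g1 2 g23 r + var a4 * w12 r - var a2 * w13 r)" by blast
  have "\<exists>w. inF F 4 w \<and> dd F 4 w = (\<lambda>r. L g5 2 g34 r + var a5 * w53 r - var a3 * w54 r)"
    by (rule ex3) (intro inI, simp add: dd_lin dL2[OF g5(1)] g5(2) g34 dw Ll algebra_simps)
  then obtain v5 where v5: "inF F 4 v5" "dd F 4 v5 = (\<lambda>r. L g5 2 g34 r + var a5 * w53 r - var a3 * w54 r)" by blast
  have kv: "kill out (var a1) = var a1" "kill out (var a2) = var a2" "kill out (var a3) = var a3"
    "kill out (var a4) = var a4" "kill out (var a5) = var a5" "kill out (var a6) = var a6"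
    by (auto simp: kill_var)
  have sll: "\<Theta> (\<lambda>r. v r + w r) = \<Theta> v + \<Theta> w" "\<Theta> (\<lambda>r. v r - w r) = \<Theta> v - \<Theta> w"
      "\<Theta> (\<lambda>r. - v r) = - \<Theta> v" "\<Theta> (\<lambda>r. q * v r) = kill out q * \<Theta> v"
    if "semilin out \<Theta>" for \<Theta> v w q
    using that semilin_add semilin_diff semilin_uminus semilin_scale by blast+
  note slf = sll[OF sl(1)] and slu1 = sll[OF sl(3)] and sls = sll[OF sl(5)] and slt = sll[OF sl(8)]
  note cfs = lookup_add lookup_minus lookup_var_mult mult.assoc lookup_single when_def nd
  note km = kill_mult kv
  have m12: "mon a1 + mon a2 - mon a1 = mon a2" "mon a1 + mon a2 - mon a2 = mon a1" by simp_all
  have dc: "cf (dd F i v c) 0 = 0" for i v c by (rule dd_const_zero[OF F])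
  \<comment> \<open>Coefficients of x1 x2 in \<open>f\<close> of the boundary of g5 v: on the side
    of the target only \<open>u1\<close> contributes, on the other side only the term with
    \<open>f g5\<close>, whose constant term is 1.\<close>
  have u5: "cf (u1 (L g5 1 v)) 0 = - cf (dd F 1 v 0) (mon a1 + mon a2)" if v: "inF F 1 v" for v
  proof -
    have "f (dd F 2 (L g5 1 v)) = var a5 * (var a6 * f v) - kill out (dd F 1 v 0) * f g5"
      unfolding dL1[OF g5(1) v] slf g5(2) km by (simp add: mult.assoc)
    then have e: "var a4 * u4 (L g5 1 v) + var a1 * (var a2 * u1 (L g5 1 v)) + var a2 * (var a3 * u2 (L g5 1 v))
       = var a5 * (var a6 * f v) - kill out (dd F 1 v 0) * f g5"
      unfolding R2[OF Lin(1)[OF g5(1)]] by (simp add: mult.assoc)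
    have "cf (kill out (dd F 1 v 0) * f g5) (mon a1 + mon a2) = cf (dd F 1 v 0) (mon a1 + mon a2)"
      unfolding edge_ideal_cf_12[OF d1_in[OF v]] f5[OF g5] by simp
    then show ?thesis
      using arg_cong[OF e, of "\<lambda>p. cf p (mon a1 + mon a2)"] by (simp add: cfs)
  qed
  have u1': "cf (u1 (L g1 1 v)) 0 = cf (f v) 0" if v: "inF F 1 v" for v
  proof -
    have "f (dd F 2 (L g1 1 v)) = var a1 * (var a2 * f v) - kill out (dd F 1 v 0) * f g1"
      unfolding dL1[OF g1(1) v] slf g1(2) km by (simp add: mult.assoc)
    then have e: "var a4 * u4 (L g1 1 v) + var a1 * (var a2 * u1 (L g1 1 v)) + var a2 * (var a3 * u2 (L g1 1 v))
       = var a1 * (var a2 * f v) - kill out (dd F 1 v 0) * f g1"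
      unfolding R2[OF Lin(1)[OF g1(1)]] by (simp add: mult.assoc)
    have "cf (kill out (dd F 1 v 0) * f g1) (mon a1 + mon a2) = 0"
      unfolding edge_ideal_cf_12[OF d1_in[OF v]] f1[OF g1] by simp
    then show ?thesis
      using arg_cong[OF e, of "\<lambda>p. cf p (mon a1 + mon a2)"] by (simp add: cfs)
  qed
  have s5: "cf (s41 (L g5 2 b)) 0 = 0" if b: "inF F 2 b" for b
  proof -
    have "u1 (dd F 3 (L g5 2 b)) = var a5 * (var a6 * u1 b) - u1 (L g5 1 (dd F 2 b))"
      unfolding dL2[OF g5(1) b] slu1 g5(2) km by (simp add: mult.assoc)
    then have e: "var a4 * s41 (L g5 2 b) + var a3 * s12 (L g5 2 b)
       = var a5 * (var a6 * u1 b) - u1 (L g5 1 (dd F 2 b))"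
      unfolding R3b[OF Lin(2)[OF g5(1)]] .
    have 1: "cf (s41 (L g5 2 b)) 0 = - cf (u1 (L g5 1 (dd F 2 b))) (mon a4)"
      using arg_cong[OF e, of "\<lambda>p. cf p (mon a4)"] by (simp add: cfs)
    have d2: "vec {..<rk F 1} (dd F 2 b)" using din(1)[of b] by (simp add: inF_vec)
    have "cf (u1 (L g5 1 (dd F 2 b))) (mon a4)
        = (\<Sum>c<rk F 1. cf (dd F 2 b c) (mon a4) * cf (u1 (L g5 1 (unitv c))) 0)"
      by (rule cf_semilin_linear[OF semilin_comp[OF sl(3) L(1)[OF g5(1)]] d2 dc]) simp
    \<comment> \<open>By \<open>u5\<close> each summand is a coefficient of a product, and the
      products add up to two successive differentials applied to \<open>b\<close>, which is
      0.\<close>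
    also have "\<dots> = (\<Sum>c<rk F 1. - cf (dd F 2 b c * dd F 1 (unitv c) 0) (mon a1 + (mon a2 + mon a4)))"
    proof (rule sum.cong[OF refl])
      fix c assume "c \<in> {..<rk F 1}"
      then have c: "inF F 1 (unitv c)" by (simp add: inF_vec vec_unitv)
      show "cf (dd F 2 b c) (mon a4) * cf (u1 (L g5 1 (unitv c))) 0
          = - cf (dd F 2 b c * dd F 1 (unitv c) 0) (mon a1 + (mon a2 + mon a4))"
        unfolding u5[OF c] edge_ideal_cf_124[OF d1_in[OF c] dc] by simp
    qed
    also have "\<dots> = - cf (\<Sum>c<rk F 1. dd F 2 b c * dd F 1 (unitv c) 0) (mon a1 + (mon a2 + mon a4))"
      by (simp only: lookup_sum sum_negf)
    also have "(\<Sum>c<rk F 1. dd F 2 b c * dd F 1 (unitv c) 0) = dd F 1 (dd F 2 b) 0"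
      using fun_cong[OF qlinear_expand[OF _ d2 qlinear_dd[of F 1]], of 0] by simp
    also have "dd F 1 (dd F 2 b) 0 = 0"
      using dd_dd_Suc[OF F, of 0 b] b by (simp add: numeral_2_eq_2 One_nat_def)
    finally show ?thesis using 1 by simp
  qed
  \<comment> \<open>For g1 the comparison at x4 returns \<open>f\<close> of a boundary, where only
    the summand x4 \<open>u4\<close> counts.\<close>
  have s1: "cf (s41 (L g1 2 b)) 0 = - cf (u4 b) 0" if b: "inF F 2 b" for b
  proof -
    have "u1 (dd F 3 (L g1 2 b)) = var a1 * (var a2 * u1 b) - u1 (L g1 1 (dd F 2 b))"
      unfolding dL2[OF g1(1) b] slu1 g1(2) km by (simp add: mult.assoc)
    then have e: "var a4 * s41 (L g1 2 b) + var a3 * s12 (L g1 2 b)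
       = var a1 * (var a2 * u1 b) - u1 (L g1 1 (dd F 2 b))"
      unfolding R3b[OF Lin(2)[OF g1(1)]] .
    have 1: "cf (s41 (L g1 2 b)) 0 = - cf (u1 (L g1 1 (dd F 2 b))) (mon a4)"
      using arg_cong[OF e, of "\<lambda>p. cf p (mon a4)"] by (simp add: cfs)
    have d2: "vec {..<rk F 1} (dd F 2 b)" using din(1)[of b] by (simp add: inF_vec)
    have "cf (u1 (L g1 1 (dd F 2 b))) (mon a4)
        = (\<Sum>c<rk F 1. cf (dd F 2 b c) (mon a4) * cf (u1 (L g1 1 (unitv c))) 0)"
      by (rule cf_semilin_linear[OF semilin_comp[OF sl(3) L(1)[OF g1(1)]] d2 dc]) simp
    also have "\<dots> = (\<Sum>c<rk F 1. cf (dd F 2 b c) (mon a4) * cf (f (unitv c)) 0)"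
      by (rule sum.cong[OF refl]) (use u1' in \<open>auto simp: inF_vec vec_unitv\<close>)
    also have "\<dots> = cf (f (dd F 2 b)) (mon a4)"
      by (rule cf_semilin_linear[OF sl(1) d2 dc, symmetric]) simp
    also have "\<dots> = cf (u4 b) 0"
      unfolding R2[OF b] by (simp add: cfs)
    finally show ?thesis using 1 by simp
  qed
  have t5: "cf (t (L g5 3 w)) 0 = 0" if w: "inF F 3 w" for w
  proof -
    have "s41 (dd F 4 (L g5 3 w)) = var a5 * (var a6 * s41 w) - s41 (L g5 2 (dd F 3 w))"
      unfolding dL3[OF g5(1) w] sls g5(2) km by (simp add: mult.assoc)
    then have e: "- (var a3 * t (L g5 3 w)) = var a5 * (var a6 * s41 w) - s41 (L g5 2 (dd F 3 w))"
      unfolding R4[OF Lin(3)[OF g5(1)]] .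
    have 1: "cf (t (L g5 3 w)) 0 = cf (s41 (L g5 2 (dd F 3 w))) (mon a3)"
      using arg_cong[OF e, of "\<lambda>p. cf p (mon a3)"] by (simp add: cfs)
    have d3: "vec {..<rk F 2} (dd F 3 w)" using din(2)[of w] by (simp add: inF_vec)
    have "cf (s41 (L g5 2 (dd F 3 w))) (mon a3)
        = (\<Sum>c<rk F 2. cf (dd F 3 w c) (mon a3) * cf (s41 (L g5 2 (unitv c))) 0)"
      by (rule cf_semilin_linear[OF semilin_comp[OF sl(5) L(1)[OF g5(1)]] d3 dc]) simp
    also have "\<dots> = 0" by (rule sum.neutral) (use s5 in \<open>auto simp: inF_vec vec_unitv\<close>)
    finally show ?thesis using 1 by simp
  qed
  \<comment> \<open>By \<open>s1\<close> the relevant sum is minus the coefficient of x3 in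
    \<open>u4\<close> of a boundary, and such values have no linear terms.\<close>
  have t1: "cf (t (L g1 3 w)) 0 = 0" if w: "inF F 3 w" for w
  proof -
    have "s41 (dd F 4 (L g1 3 w)) = var a1 * (var a2 * s41 w) - s41 (L g1 2 (dd F 3 w))"
      unfolding dL3[OF g1(1) w] sls g1(2) km by (simp add: mult.assoc)
    then have e: "- (var a3 * t (L g1 3 w)) = var a1 * (var a2 * s41 w) - s41 (L g1 2 (dd F 3 w))"
      unfolding R4[OF Lin(3)[OF g1(1)]] .
    have 1: "cf (t (L g1 3 w)) 0 = cf (s41 (L g1 2 (dd F 3 w))) (mon a3)"
      using arg_cong[OF e, of "\<lambda>p. cf p (mon a3)"] by (simp add: cfs)
    have d3: "vec {..<rk F 2} (dd F 3 w)" using din(2)[of w] by (simp add: inF_vec)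
    have "cf (s41 (L g1 2 (dd F 3 w))) (mon a3)
        = (\<Sum>c<rk F 2. cf (dd F 3 w c) (mon a3) * cf (s41 (L g1 2 (unitv c))) 0)"
      by (rule cf_semilin_linear[OF semilin_comp[OF sl(5) L(1)[OF g1(1)]] d3 dc]) simp
    also have "\<dots> = (\<Sum>c<rk F 2. - (cf (dd F 3 w c) (mon a3) * cf (u4 (unitv c)) 0))"
      by (rule sum.cong[OF refl]) (use s1 in \<open>auto simp: inF_vec vec_unitv\<close>)
    also have "\<dots> = - cf (u4 (dd F 3 w)) (mon a3)"
      unfolding sum_negf using cf_semilin_linear[OF sl(2) d3 dc, of a3] by simp
    also have "\<dots> = 0" unfolding R3a[OF w] by (simp add: cfs)
    finally show ?thesis using 1 by simp
  qed
  \<comment> \<open>The source of the nonzero coefficient: the term - x4 g5 in the boundary of g45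
    produces \<open>u1\<close> of g1 g5, whose constant term is that of \<open>f g5\<close>, namely
    1.\<close>
  have \<sigma>: "cf (s41 (L g1 2 g45)) 0 = 1"
  proof -
    have "u1 (dd F 3 (L g1 2 g45)) = var a1 * (var a2 * u1 g45) - (var a6 * u1 (L g1 1 g4) - var a4 * u1 (L g1 1 g5))"
      unfolding dL2[OF g1(1) g45(1)] g45(2) Ll slu1 g1(2) km by (simp add: mult.assoc)
    then have e: "var a4 * s41 (L g1 2 g45) + var a3 * s12 (L g1 2 g45)
       = var a1 * (var a2 * u1 g45) - (var a6 * u1 (L g1 1 g4) - var a4 * u1 (L g1 1 g5))"
      unfolding R3b[OF Lin(2)[OF g1(1)]] .
    have "cf (s41 (L g1 2 g45)) 0 = cf (u1 (L g1 1 g5)) 0"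
      using arg_cong[OF e, of "\<lambda>p. cf p (mon a4)"] by (simp add: cfs)
    then show ?thesis using u1'[OF g5(1)] f5[OF g5] by simp
  qed
  \<comment> \<open>The factors x5 and x2 make the g3 terms of the two boundaries cancel, leaving
    multiples of g2 and g4 only.\<close>
  define p where "p = (\<lambda>r. var a5 * g23 r + var a2 * g34 r)"
  have p: "inF F 2 p" unfolding p_def by (intro inI)
  have dp: "dd F 2 p = (\<lambda>r. var a4 * var a5 * g2 r - var a2 * var a3 * g4 r)"
    unfolding p_def dd_lin dg by (simp add: algebra_simps)
  have tv1: "t (L g5 3 (L g1 2 g23)) = var a5 * (var a6 * t v1) - var a4 * t (L g5 3 w12) + var a2 * t (L g5 3 w13)"
  proof -
    have "t (L g5 3 (dd F 4 v1)) = var a5 * (var a6 * t v1)"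
    proof -
      have "t (dd F 5 (L g5 4 v1)) = var a5 * (var a6 * t v1) - t (L g5 3 (dd F 4 v1))"
        unfolding dL4[OF g5(1) v1(1)] slt g5(2) km by (simp add: mult.assoc)
      then show ?thesis using R5[OF Lin(4)[OF g5(1)]] by simp
    qed
    moreover have "t (L g5 3 (dd F 4 v1)) = t (L g5 3 (L g1 2 g23)) + var a4 * t (L g5 3 w12) - var a2 * t (L g5 3 w13)"
      unfolding v1(2) Ll slt km ..
    ultimately show ?thesis by (simp add: algebra_simps)
  qed
  have tv5: "t (L g1 3 (L g5 2 g34)) = var a1 * (var a2 * t v5) - var a5 * t (L g1 3 w53) + var a3 * t (L g1 3 w54)"
  proof -
    have "t (L g1 3 (dd F 4 v5)) = var a1 * (var a2 * t v5)"
    proof -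
      have "t (dd F 5 (L g1 4 v5)) = var a1 * (var a2 * t v5) - t (L g1 3 (dd F 4 v5))"
        unfolding dL4[OF g1(1) v5(1)] slt g1(2) km by (simp add: mult.assoc)
      then show ?thesis using R5[OF Lin(4)[OF g1(1)]] by simp
    qed
    moreover have "t (L g1 3 (dd F 4 v5)) = t (L g1 3 (L g5 2 g34)) + var a5 * t (L g1 3 w53) - var a3 * t (L g1 3 w54)"
      unfolding v5(2) Ll slt km ..
    ultimately show ?thesis by (simp add: algebra_simps)
  qed
  \<comment> \<open>Anticommutativity enters here: it lets g5 act last on the g23 summand while g1
    acts last on the g34 summand, so that \<open>tv1\<close> and \<open>tv5\<close> apply.\<close>
  have "t (L g1 3 (L g5 2 p)) = var a2 * t (L g1 3 (L g5 2 g34)) - var a5 * t (L g5 3 (L g1 2 g23))"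
    unfolding p_def Ll slt km LL2[OF g1(1) g5(1) g23(1)] by simp
  then have "cf (t (L g1 3 (L g5 2 p))) (mon a2 + mon a5) = 0"
    unfolding tv1 tv5 by (simp add: cfs t1[OF w53(1)] t5[OF w13(1)])
  moreover have m: "mon a2 + (mon a3 + mon a5) = mon a3 + (mon a2 + mon a5)" by (simp add: ac_simps)
  ultimately have lhs: "cf (- (var a3 * t (L g1 3 (L g5 2 p)))) (mon a2 + (mon a3 + mon a5)) = 0"
    unfolding m by (simp only: lookup_uminus cf_var_eq) simp
  have B: "s41 (L g1 2 (L g5 1 g4)) = var a1 * (var a2 * s41 w54) + var a3 * t (L g1 3 w54) + var a5 * s41 (L g1 2 g45)"
  proof -
    have "s41 (dd F 4 (L g1 3 w54)) = var a1 * (var a2 * s41 w54) - (s41 (L g1 2 (L g5 1 g4)) - var a5 * s41 (L g1 2 g45))"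
      unfolding dL3[OF g1(1) w54(1)] w54(2) Ll sls g1(2) km by (simp add: mult.assoc)
    then show ?thesis
      unfolding R4[OF Lin(3)[OF g1(1)]] by (simp add: algebra_simps)
  qed
  have "s41 (dd F 4 (L g1 3 (L g5 2 p))) = var a1 * (var a2 * s41 (L g5 2 p)) - (var a5 * (var a6 * s41 (L g1 2 p))
      - (var a4 * (var a5 * s41 (L g1 2 (L g5 1 g2))) - var a2 * (var a3 * s41 (L g1 2 (L g5 1 g4)))))"
    unfolding dL3[OF g1(1) Lin(2)[OF g5(1)]] dL2[OF g5(1) p] dp Ll sls g1(2) g5(2) km by (simp add: mult.assoc)
  then have e: "- (var a3 * t (L g1 3 (L g5 2 p))) = var a1 * (var a2 * s41 (L g5 2 p)) - (var a5 * (var a6 * s41 (L g1 2 p))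
      - (var a4 * (var a5 * s41 (L g1 2 (L g5 1 g2))) - var a2 * (var a3 * s41 (L g1 2 (L g5 1 g4)))))"
    unfolding R4[OF Lin(3)[OF g1(1)]] .
  have m': "mon a2 + (mon a3 + mon a5) - mon a5 = mon a2 + mon a3"
    by (simp only: add.assoc[symmetric] add_diff_cancel_right')
  have "cf (var a1 * (var a2 * s41 (L g5 2 p)) - (var a5 * (var a6 * s41 (L g1 2 p))
      - (var a4 * (var a5 * s41 (L g1 2 (L g5 1 g2))) - var a2 * (var a3 * s41 (L g1 2 (L g5 1 g4))))))
      (mon a2 + (mon a3 + mon a5)) = - 1"
    unfolding B by (simp add: cfs m' \<sigma>)
  then show False using lhs unfolding e by simp
qed

end

section \<open>The Koszul algebra\<close>

text \<open>An element of the exterior algebra is given by its coefficients with respect to the basis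
  indexed by the subsets of \<open>'v\<close>; the enumeration \<open>r\<close> orders the factors of a basis element.\<close>

locale koszul =
  fixes r :: "'v::finite \<Rightarrow> nat" and x :: "'v \<Rightarrow> 'q::comm_ring_1"
  assumes inj_r: "inj r"
begin

text \<open>The sign of the shuffle that sorts \<open>U\<close> followed by \<open>W\<close>, by
  counting inversions.\<close>

definition sg :: "'v set \<Rightarrow> 'v set \<Rightarrow> 'q" where
  "sg U W = (-1) ^ card {(u, w). u \<in> U \<and> w \<in> W \<and> r w < r u}"

lemma sg_empty [simp]: "sg {} W = 1" "sg U {} = 1"
  by (simp_all add: sg_def)

lemma sg_Un_left:
  assumes "U \<inter> U' = {}"
  shows "sg (U \<union> U') W = sg U W * sg U' W"
proof -
  have "{(u, w). u \<in> U \<union> U' \<and> w \<in> W \<and> r w < r u} =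
    {(u, w). u \<in> U \<and> w \<in> W \<and> r w < r u} \<union> {(u, w). u \<in> U' \<and> w \<in> W \<and> r w < r u}" by auto
  moreover have "card ({(u, w). u \<in> U \<and> w \<in> W \<and> r w < r u} \<union> {(u, w). u \<in> U' \<and> w \<in> W \<and> r w < r u})
    = card {(u, w). u \<in> U \<and> w \<in> W \<and> r w < r u} + card {(u, w). u \<in> U' \<and> w \<in> W \<and> r w < r u}"
    using assms by (intro card_Un_disjoint) auto
  ultimately show ?thesis by (simp add: sg_def power_add)
qed

lemma sg_Un_right:
  assumes "W \<inter> W' = {}"
  shows "sg U (W \<union> W') = sg U W * sg U W'"
proof -
  have "{(u, w). u \<in> U \<and> w \<in> W \<union> W' \<and> r w < r u} =
    {(u, w). u \<in> U \<and> w \<in> W \<and> r w < r u} \<union> {(u, w). u \<in> U \<and> w \<in> W' \<and> r w < r u}" by auto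
  moreover have "card ({(u, w). u \<in> U \<and> w \<in> W \<and> r w < r u} \<union> {(u, w). u \<in> U \<and> w \<in> W' \<and> r w < r u})
    = card {(u, w). u \<in> U \<and> w \<in> W \<and> r w < r u} + card {(u, w). u \<in> U \<and> w \<in> W' \<and> r w < r u}"
    using assms by (intro card_Un_disjoint) auto
  ultimately show ?thesis by (simp add: sg_def power_add)
qed

lemma sg_insert_left: "v \<notin> U \<Longrightarrow> sg (insert v U) W = sg {v} W * sg U W"
  using sg_Un_left[of "{v}" U W] by simp

lemma sg_insert_right: "v \<notin> W \<Longrightarrow> sg U (insert v W) = sg U {v} * sg U W"
  using sg_Un_right[of "{v}" W U] by simp

lemma sg_sq [simp]: "sg U W * sg U W = 1"
  by (simp add: sg_def power_mult_distrib[symmetric])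

lemma sg_swap:
  assumes "U \<inter> W = {}"
  shows "sg U W * sg W U = (-1) ^ (card U * card W)"
proof -
  let ?A = "{(u, w). u \<in> U \<and> w \<in> W \<and> r w < r u}" and ?B = "{(w, u). w \<in> W \<and> u \<in> U \<and> r u < r w}"
  have "card ?B = card (prod.swap ` ?B)" by (intro card_image[symmetric] inj_onI) auto
  also have "prod.swap ` ?B = {(u, w). u \<in> U \<and> w \<in> W \<and> r u < r w}" by (auto simp: image_iff)
  finally have "card ?A + card ?B = card ?A + card {(u, w). u \<in> U \<and> w \<in> W \<and> r u < r w}" by simp
  also have "\<dots> = card (?A \<union> {(u, w). u \<in> U \<and> w \<in> W \<and> r u < r w})"
    by (intro card_Un_disjoint[symmetric]) auto
  also have "?A \<union> {(u, w). u \<in> U \<and> w \<in> W \<and> r u < r w} = U \<times> W"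
  proof -
    have "r u \<noteq> r w" if "u \<in> U" "w \<in> W" for u w
      using that assms inj_r by (auto simp: inj_eq)
    then show ?thesis by (fastforce simp: neq_iff)
  qed
  finally show ?thesis by (simp add: sg_def power_add[symmetric] card_cartesian_product)
qed

lemma sg_swap': "U \<inter> W = {} \<Longrightarrow> sg U W = (-1) ^ (card U * card W) * sg W U"
  using sg_swap[of U W] sg_sq[of W U] by (metis mult.assoc mult.right_neutral)

definition wedge :: "('v set \<Rightarrow> 'q) \<Rightarrow> ('v set \<Rightarrow> 'q) \<Rightarrow> ('v set \<Rightarrow> 'q)" where
  "wedge a b S = (\<Sum>U\<in>Pow S. sg U (S - U) * a U * b (S - U))"

text \<open>Contraction with the dual basis vector of \<open>v\<close>. The Koszul differential is a
  weighted sum of contractions, which reduces its Leibniz rule to one vector at a time.\<close>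

definition contr :: "'v \<Rightarrow> ('v set \<Rightarrow> 'q) \<Rightarrow> ('v set \<Rightarrow> 'q)" where
  "contr v a S = (if v \<in> S then 0 else sg {v} S * a (insert v S))"

definition dK :: "('v set \<Rightarrow> 'q) \<Rightarrow> ('v set \<Rightarrow> 'q)" where
  "dK a S = (\<Sum>v\<in>UNIV. x v * contr v a S)"

definition pure :: "nat \<Rightarrow> ('v set \<Rightarrow> 'q) \<Rightarrow> bool" where
  "pure n a \<longleftrightarrow> (\<forall>S. a S \<noteq> 0 \<longrightarrow> card S = n)"

definition oneK :: "'v set \<Rightarrow> 'q" where
  "oneK S = (if S = {} then 1 else 0)"

lemma wedge_add_left: "wedge (\<lambda>S. a S + a' S) b = (\<lambda>S. wedge a b S + wedge a' b S)"
  by (simp add: wedge_def fun_eq_iff algebra_simps sum.distrib)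

lemma wedge_add_right: "wedge a (\<lambda>S. b S + b' S) = (\<lambda>S. wedge a b S + wedge a b' S)"
  by (simp add: wedge_def fun_eq_iff algebra_simps sum.distrib)

lemma wedge_scale_left: "wedge (\<lambda>S. q * a S) b = (\<lambda>S. q * wedge a b S)"
  by (simp add: wedge_def fun_eq_iff sum_distrib_left algebra_simps)

lemma wedge_scale_right: "wedge a (\<lambda>S. q * b S) = (\<lambda>S. q * wedge a b S)"
  by (simp add: wedge_def fun_eq_iff sum_distrib_left algebra_simps)

lemma wedge_oneK_left: "wedge oneK a = a"
proof
  fix S
  have "wedge oneK a S = (\<Sum>U\<in>Pow S. if U = {} then a S else 0)"
    unfolding wedge_def by (intro sum.cong) (auto simp: oneK_def)
  then show "wedge oneK a S = a S" by simp
qed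

lemma wedge_oneK_right: "wedge a oneK = a"
proof
  fix S
  have "wedge a oneK S = (\<Sum>U\<in>Pow S. if U = S then a S else 0)"
    unfolding wedge_def by (intro sum.cong) (auto simp: oneK_def)
  then show "wedge a oneK S = a S" by simp
qed

text \<open>Both sides sum over ordered partitions of \<open>S\<close> into three blocks, and either
  sign is the product of the three pairwise signs.\<close>

lemma wedge_assoc: "wedge (wedge a b) c = wedge a (wedge b c)"
proof
  fix S
  have "wedge (wedge a b) c S =
      (\<Sum>(U, A)\<in>Sigma (Pow S) Pow. sg U (S - U) * (sg A (U - A) * a A * b (U - A)) * c (S - U))"
    unfolding wedge_def sum_distrib_left sum_distrib_right by (rule sum.Sigma) auto
  also have "\<dots> = (\<Sum>(A, B)\<in>Sigma (Pow S) (\<lambda>A. Pow (S - A)).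
      sg A (S - A) * a A * (sg B (S - A - B) * b B * c (S - A - B)))"
  proof (rule sum.reindex_bij_witness[of _ "\<lambda>(A, B). (A \<union> B, A)" "\<lambda>(U, A). (A, U - A)"])
    fix z assume "z \<in> Sigma (Pow S) Pow"
    then obtain U A where z: "z = (U, A)" "U \<subseteq> S" "A \<subseteq> U" by auto
    have 1: "S - A - (U - A) = S - U" using z by auto
    have "sg (A \<union> (U - A)) (S - U) = sg A (S - U) * sg (U - A) (S - U)"
      by (rule sg_Un_left) auto
    moreover have "A \<union> (U - A) = U" using z by auto
    ultimately have 2: "sg U (S - U) = sg A (S - U) * sg (U - A) (S - U)" by simp
    have "sg A ((U - A) \<union> (S - U)) = sg A (U - A) * sg A (S - U)"
      by (rule sg_Un_right) auto
    moreover have "(U - A) \<union> (S - U) = S - A" using z by auto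
    ultimately have 3: "sg A (S - A) = sg A (U - A) * sg A (S - U)" by simp
    show "(case case z of (U, A) \<Rightarrow> (A, U - A) of (A, B) \<Rightarrow>
        sg A (S - A) * a A * (sg B (S - A - B) * b B * c (S - A - B))) =
      (case z of (U, A) \<Rightarrow> sg U (S - U) * (sg A (U - A) * a A * b (U - A)) * c (S - U))"
      unfolding z(1) by (simp add: 1 2 3 algebra_simps)
  qed auto
  also have "\<dots> = wedge a (wedge b c) S"
    unfolding wedge_def sum_distrib_left by (rule sum.Sigma[symmetric]) auto
  finally show "wedge (wedge a b) c S = wedge a (wedge b c) S" .
qed

lemma wedge_swap: "wedge a b S = (\<Sum>U\<in>Pow S. sg (S - U) U * a (S - U) * b U)"
  unfolding wedge_def
  by (rule sum.reindex_bij_witness[of _ "\<lambda>U. S - U" "\<lambda>U. S - U"]) (auto simp: double_diff)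

lemma wedge_commute:
  assumes "pure i a" "pure j b"
  shows "wedge a b = (\<lambda>S. (-1) ^ (i * j) * wedge b a S)"
proof
  fix S
  have "sg (S - U) U * a (S - U) * b U = (-1) ^ (i * j) * (sg U (S - U) * b U * a (S - U))"
    if "U \<in> Pow S" for U
  proof (cases "a (S - U) = 0 \<or> b U = 0")
    case False
    then have "card (S - U) = i" "card U = j" using assms by (auto simp: pure_def)
    moreover have "(S - U) \<inter> U = {}" by auto
    ultimately have "sg (S - U) U = (-1) ^ (i * j) * sg U (S - U)" using sg_swap'[of "S - U" U] by simp
    then show ?thesis by (simp add: algebra_simps)
  qed auto
  then show "wedge a b S = (-1) ^ (i * j) * wedge b a S"
    unfolding wedge_swap[of a b] wedge_def[of b a] sum_distrib_left by (rule sum.cong[OF refl])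
qed

lemma sum_Pow_insert:
  fixes f :: "'v set \<Rightarrow> 'q"
  assumes "v \<notin> S"
  shows "(\<Sum>U\<in>Pow (insert v S). f U) = (\<Sum>U\<in>Pow S. f U) + (\<Sum>U\<in>Pow S. f (insert v U))"
proof -
  have "(\<Sum>U\<in>Pow (insert v S). f U) = (\<Sum>U\<in>Pow S. f U) + (\<Sum>U\<in>insert v ` Pow S. f U)"
    unfolding Pow_insert using assms by (intro sum.union_disjoint) auto
  also have "(\<Sum>U\<in>insert v ` Pow S. f U) = (\<Sum>U\<in>Pow S. f (insert v U))"
    using assms by (subst sum.reindex) (auto simp: inj_on_def)
  finally show ?thesis .
qed

text \<open>Graded commutativity alone would only kill twice the square. Pairing each
  \<open>U\<close> with its complement cancels terms in every characteristic; the fixed element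
  \<open>v\<close> distinguishes the two members of a pair.\<close>

lemma wedge_odd_square:
  assumes "pure i a" "odd i"
  shows "wedge a a = (\<lambda>_. 0)"
proof
  fix S
  show "wedge a a S = 0"
  proof (cases "S = {}")
    case True
    have "a {} = 0" using assms by (auto simp: pure_def)
    then show ?thesis using True by (simp add: wedge_def)
  next
    case False
    then obtain v T where S: "S = insert v T" "v \<notin> T" by (metis all_not_in_conv mk_disjoint_insert)
    have "(\<Sum>U\<in>Pow T. sg (insert v U) (S - insert v U) * a (insert v U) * a (S - insert v U))
        = (\<Sum>U\<in>Pow T. sg (S - U) U * a (S - U) * a U)"
    proof (rule sum.reindex_bij_witness[of _ "\<lambda>U. T - U" "\<lambda>U. T - U"])
      fix U assume U: "U \<in> Pow T"
      have "S - (T - U) = insert v U" "S - insert v U = T - U" using S U by auto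
      then show "sg (S - (T - U)) (T - U) * a (S - (T - U)) * a (T - U) =
        sg (insert v U) (S - insert v U) * a (insert v U) * a (S - insert v U)" by simp
    qed auto
    then have "wedge a a S = (\<Sum>U\<in>Pow T. sg U (S - U) * a U * a (S - U) + sg (S - U) U * a (S - U) * a U)"
      unfolding wedge_def using sum_Pow_insert[OF S(2)] S(1) by (simp add: sum.distrib)
    also have "\<dots> = (\<Sum>U\<in>Pow T. 0)"
    proof (rule sum.cong)
      fix U assume "U \<in> Pow T"
      show "sg U (S - U) * a U * a (S - U) + sg (S - U) U * a (S - U) * a U = 0"
      proof (cases "a (S - U) = 0 \<or> a U = 0")
        case False
        then have "card (S - U) = i" "card U = i" using assms by (auto simp: pure_def)
        moreover have "(S - U) \<inter> U = {}" by auto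
        ultimately have "sg (S - U) U = - sg U (S - U)"
          using sg_swap'[of "S - U" U] assms(2) by simp
        then show ?thesis by (simp add: algebra_simps)
      qed auto
    qed simp
    finally show ?thesis by simp
  qed
qed

text \<open>For \<open>v\<close> outside \<open>S\<close>, subsets of \<open>insert v S\<close>
  containing \<open>v\<close> give the first product and the others the second. For \<open>v\<close>
  in \<open>S\<close> the left side vanishes and the two products cancel term by term.\<close>

lemma contr_wedge:
  assumes "pure i a"
  shows "contr v (wedge a b) S = wedge (contr v a) b S + (-1) ^ i * wedge a (contr v b) S"
proof (cases "v \<in> S")
  case False
  have "contr v (wedge a b) S = sg {v} S *
      ((\<Sum>U\<in>Pow S. sg U (insert v S - U) * a U * b (insert v S - U)) +
       (\<Sum>U\<in>Pow S. sg (insert v U) (insert v S - insert v U) * a (insert v U) * b (insert v S - insert v U)))"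
    using False by (simp add: contr_def wedge_def sum_Pow_insert)
  also have "\<dots> = (\<Sum>U\<in>Pow S. sg {v} S * (sg U (insert v S - U) * a U * b (insert v S - U))) +
       (\<Sum>U\<in>Pow S. sg {v} S * (sg (insert v U) (insert v S - insert v U) * a (insert v U) * b (insert v S - insert v U)))"
    by (simp add: distrib_left sum_distrib_left)
  also have "(\<Sum>U\<in>Pow S. sg {v} S * (sg (insert v U) (insert v S - insert v U) * a (insert v U) * b (insert v S - insert v U)))
      = wedge (contr v a) b S"
    unfolding wedge_def
  proof (rule sum.cong[OF refl])
    fix U assume U: "U \<in> Pow S"
    then have nU: "v \<notin> U" using False by auto
    have 1: "insert v S - insert v U = S - U" using False U by auto
    have "sg {v} (U \<union> (S - U)) = sg {v} U * sg {v} (S - U)" by (rule sg_Un_right) auto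
    moreover have "U \<union> (S - U) = S" using U by auto
    ultimately have 2: "sg {v} S = sg {v} U * sg {v} (S - U)" by simp
    have 3: "sg {v} (S - U) * (sg {v} (S - U) * z) = z" for z
      using sg_sq[of "{v}" "S - U"] by (metis mult.assoc mult_1)
    show "sg {v} S * (sg (insert v U) (insert v S - insert v U) * a (insert v U) * b (insert v S - insert v U))
      = sg U (S - U) * contr v a U * b (S - U)"
      using nU by (simp add: 1 2 contr_def sg_insert_left[OF nU] mult.assoc mult.left_commute 3)
  qed
  also have "(\<Sum>U\<in>Pow S. sg {v} S * (sg U (insert v S - U) * a U * b (insert v S - U)))
      = (-1) ^ i * wedge a (contr v b) S"
    unfolding wedge_def sum_distrib_left
  proof (rule sum.cong[OF refl])
    fix U assume U: "U \<in> Pow S"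
    then have nU: "v \<notin> U" "v \<notin> S - U" using False by auto
    have 1: "insert v S - U = insert v (S - U)" using False U by auto
    have "sg {v} (U \<union> (S - U)) = sg {v} U * sg {v} (S - U)" by (rule sg_Un_right) auto
    moreover have "U \<union> (S - U) = S" using U by auto
    ultimately have 2: "sg {v} S = sg {v} U * sg {v} (S - U)" by simp
    have 3: "sg U {v} = (-1) ^ card U * sg {v} U" using sg_swap'[of U "{v}"] nU by simp
    have 4: "sg {v} U * (sg {v} U * z) = z" for z
      using sg_sq[of "{v}" U] by (metis mult.assoc mult_1)
    show "sg {v} S * (sg U (insert v S - U) * a U * b (insert v S - U))
      = (-1) ^ i * (sg U (S - U) * a U * contr v b (S - U))"
    proof (cases "a U = 0")
      case False
      then have "card U = i" using assms by (simp add: pure_def)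
      then show ?thesis
        using nU by (simp add: 1 2 3 contr_def sg_insert_right[OF nU(2)] mult.assoc mult.left_commute 4)
    qed simp
  qed
  finally show ?thesis by (simp add: add.commute)
next
  case True
  then obtain T where S: "S = insert v T" "v \<notin> T" by (metis mk_disjoint_insert)
  have "wedge (contr v a) b S = (\<Sum>U\<in>Pow T. sg U (S - U) * contr v a U * b (S - U))"
    unfolding wedge_def unfolding S(1) sum_Pow_insert[OF S(2)] by (simp add: contr_def)
  moreover have "wedge a (contr v b) S = (\<Sum>U\<in>Pow T. sg (insert v U) (S - insert v U) * a (insert v U) * contr v b (S - insert v U))"
  proof -
    have "sg U (S - U) * a U * contr v b (S - U) = 0" if "U \<in> Pow T" for U
      using that S by (auto simp: contr_def)
    then show ?thesis
      unfolding wedge_def using sum_Pow_insert[OF S(2)] S(1) by (simp add: sum.neutral)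
  qed
  moreover have "sg U (S - U) * contr v a U * b (S - U) =
      - ((-1) ^ i * (sg (insert v U) (S - insert v U) * a (insert v U) * contr v b (S - insert v U)))"
    if U: "U \<in> Pow T" for U
  proof (cases "a (insert v U) = 0")
    case True
    then show ?thesis by (simp add: contr_def)
  next
    case False
    have nU: "v \<notin> U" "v \<notin> T - U" using U S by auto
    then have i: "i = Suc (card U)" using False assms by (auto simp: pure_def)
    have 1: "S - U = insert v (T - U)" "S - insert v U = T - U" using S U by auto
    have 2: "sg U {v} = (-1) ^ card U * sg {v} U" using sg_swap'[of U "{v}"] nU by simp
    have 3: "sg {v} U * (sg {v} U * z) = z" for z
      using sg_sq[of "{v}" U] by (metis mult.assoc mult_1)
    have 4: "sg {v} (T - U) * (sg {v} (T - U) * z) = z" for z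
      using sg_sq[of "{v}" "T - U"] by (metis mult.assoc mult_1)
    show ?thesis
      using nU by (simp add: 1 2 i contr_def sg_insert_right[OF nU(2)] sg_insert_left[OF nU(1)]
          mult.assoc mult.left_commute 3 4)
  qed
  ultimately show ?thesis
    using True by (simp add: contr_def sum_negf sum_distrib_left)
qed

lemma wedge_sum_left: "wedge (\<lambda>S. \<Sum>i\<in>I. f i S) b = (\<lambda>S. \<Sum>i\<in>I. wedge (f i) b S)"
  unfolding wedge_def sum_distrib_left sum_distrib_right by (rule ext) (rule sum.swap)

lemma wedge_sum_right: "wedge a (\<lambda>S. \<Sum>i\<in>I. f i S) = (\<lambda>S. \<Sum>i\<in>I. wedge a (f i) S)"
  unfolding wedge_def sum_distrib_left by (rule ext) (rule sum.swap)

lemma dK_wedge: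
  assumes "pure i a"
  shows "dK (wedge a b) = (\<lambda>S. wedge (dK a) b S + (-1) ^ i * wedge a (dK b) S)"
proof
  fix S
  have da: "dK a = (\<lambda>S. \<Sum>v\<in>UNIV. x v * contr v a S)" for a by (rule ext) (simp add: dK_def)
  have "wedge (dK a) b S + (-1) ^ i * wedge a (dK b) S
      = (\<Sum>v\<in>UNIV. x v * wedge (contr v a) b S) + (-1) ^ i * (\<Sum>v\<in>UNIV. x v * wedge a (contr v b) S)"
    unfolding da wedge_sum_left wedge_sum_right wedge_scale_left wedge_scale_right ..
  also have "\<dots> = (\<Sum>v\<in>UNIV. x v * contr v (wedge a b) S)"
    unfolding contr_wedge[OF assms] by (simp add: distrib_left sum.distrib sum_distrib_left mult.left_commute)
  finally show "dK (wedge a b) S = wedge (dK a) b S + (-1) ^ i * wedge a (dK b) S"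
    by (simp add: dK_def)
qed

lemma contr_contr: "contr v (contr w a) S = - contr w (contr v a) S"
proof (cases "v = w \<or> v \<in> S \<or> w \<in> S")
  case True
  then show ?thesis by (auto simp: contr_def)
next
  case False
  then have "{v} \<inter> {w} = {}" by auto
  from sg_swap'[OF this] have e: "sg {v} {w} = - sg {w} {v}" by simp
  have 1: "contr v (contr w a) S = sg {v} S * (sg {w} {v} * sg {w} S * a (insert w (insert v S)))"
    using False by (auto simp: contr_def sg_insert_right[of v S "{w}"])
  have 2: "contr w (contr v a) S = sg {w} S * (sg {v} {w} * sg {v} S * a (insert v (insert w S)))"
    using False by (auto simp: contr_def sg_insert_right[of w S "{v}"])
  show ?thesis unfolding 1 2 e insert_commute[of w v S] by (simp add: mult_ac)
qed

lemma contr_contr_same: "contr v (contr v a) S = 0"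
  by (auto simp: contr_def)

text \<open>Contractions anticommute and square to zero. The enumeration splits the off-diagonal
  pairs into two halves that cancel.\<close>

lemma dK_dK: "dK (dK a) = (\<lambda>_. 0)"
proof
  fix S
  define g where "g v w = x v * x w * contr v (contr w a) S" for v w
  have gsw: "- g w v = g v w" for v w
    unfolding g_def by (subst contr_contr) (simp add: mult.commute)
  have c: "contr v (dK a) S = (\<Sum>w\<in>UNIV. x w * contr v (contr w a) S)" for v
    by (simp add: contr_def dK_def sum_distrib_left mult.left_commute)
  have "dK (dK a) S = (\<Sum>v\<in>UNIV. \<Sum>w\<in>UNIV. g v w)"
    unfolding dK_def[of "dK a"] c g_def by (simp add: sum_distrib_left mult.assoc)
  also have "\<dots> = (\<Sum>(v, w)\<in>UNIV \<times> UNIV. g v w)" by (rule sum.cartesian_product)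
  also have "\<dots> = (\<Sum>(v, w)\<in>{(v, w). r v < r w} \<union> {(v, w). r w < r v}. g v w)"
  proof (rule sum.mono_neutral_right)
    show "\<forall>z\<in>UNIV \<times> UNIV - ({(v, w). r v < r w} \<union> {(v, w). r w < r v}). (case z of (v, w) \<Rightarrow> g v w) = 0"
    proof
      fix z assume z: "z \<in> UNIV \<times> UNIV - ({(v, w). r v < r w} \<union> {(v, w). r w < r v})"
      obtain v w where vw: "z = (v, w)" by (cases z)
      have "r v = r w" using z vw by auto
      then have "v = w" using inj_r by (simp add: inj_eq)
      then show "(case z of (v, w) \<Rightarrow> g v w) = 0" by (simp add: vw g_def contr_contr_same)
    qed
  qed auto
  also have "\<dots> = (\<Sum>(v, w)\<in>{(v, w). r v < r w}. g v w) + (\<Sum>(v, w)\<in>{(v, w). r w < r v}. g v w)"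
    by (rule sum.union_disjoint) auto
  also have "(\<Sum>(v, w)\<in>{(v, w). r w < r v}. g v w) = (\<Sum>(v, w)\<in>{(v, w). r v < r w}. - g v w)"
    by (rule sum.reindex_bij_witness[of _ prod.swap prod.swap])
       (auto simp: gsw)
  finally show "dK (dK a) S = 0" by (simp add: sum_negf case_prod_unfold)
qed

lemma dK_add: "dK (\<lambda>S. a S + b S) = (\<lambda>S. dK a S + dK b S)"
  by (simp add: dK_def contr_def fun_eq_iff algebra_simps sum.distrib if_distrib cong: if_cong)
     (auto simp: sum.distrib[symmetric] intro!: sum.cong)

lemma contr_scale: "contr v (\<lambda>S. q * a S) S = q * contr v a S"
  by (simp add: contr_def)

lemma dK_scale: "dK (\<lambda>S. q * a S) = (\<lambda>S. q * dK a S)"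
  by (simp add: dK_def fun_eq_iff contr_scale sum_distrib_left mult.left_commute)

lemma pure_dK: "pure (Suc n) a \<Longrightarrow> pure n (dK a)"
  unfolding pure_def
proof (intro allI impI)
  fix S assume a: "\<forall>S. a S \<noteq> 0 \<longrightarrow> card S = Suc n" and "dK a S \<noteq> 0"
  then obtain v where "x v * contr v a S \<noteq> 0" unfolding dK_def by (meson sum.not_neutral_contains_not_neutral)
  then have "v \<notin> S" "a (insert v S) \<noteq> 0" by (auto simp: contr_def split: if_splits)
  then show "card S = n" using a by fastforce
qed

lemma dK_pure_0: "pure 0 a \<Longrightarrow> dK a = (\<lambda>_. 0)"
proof -
  assume "pure 0 a"
  then have "a (insert v S) = 0" for v S by (auto simp: pure_def)
  then have "contr v a S = 0" for v S by (simp add: contr_def)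
  then show ?thesis by (simp add: dK_def fun_eq_iff)
qed

lemma pure_wedge: "pure i a \<Longrightarrow> pure j b \<Longrightarrow> pure (i + j) (wedge a b)"
  unfolding pure_def
proof (intro allI impI)
  fix S assume a: "\<forall>S. a S \<noteq> 0 \<longrightarrow> card S = i" "\<forall>S. b S \<noteq> 0 \<longrightarrow> card S = j" and "wedge a b S \<noteq> 0"
  then obtain U where U: "U \<in> Pow S" "sg U (S - U) * a U * b (S - U) \<noteq> 0"
    unfolding wedge_def by (meson sum.not_neutral_contains_not_neutral)
  then have "a U \<noteq> 0" "b (S - U) \<noteq> 0" by auto
  then have "card U = i" "card (S - U) = j" using a by auto
  moreover have "card S = card U + card (S - U)"
    using U(1) by (metis PowD card_Diff_subset card_mono finite le_add_diff_inverse)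
  ultimately show "card S = i + j" by simp
qed

end

section \<open>Acyclicity of weighted Koszul complexes\<close>

definition expo :: "'v::finite set \<Rightarrow> 'v \<Rightarrow>\<^sub>0 nat" where
  "expo A = (\<Sum>v\<in>A. Poly_Mapping.single v 1)"

lemma lookup_expo: "Poly_Mapping.lookup (expo A) v = (if v \<in> A then 1 else 0)"
proof -
  have "(\<Sum>u\<in>A. Poly_Mapping.lookup (Poly_Mapping.single u (1::nat)) v) = (\<Sum>u\<in>A. if u = v then 1 else 0)"
    by (intro sum.cong) (auto simp: lookup_single when_def)
  then show ?thesis by (simp add: expo_def lookup_sum)
qed

lemma prod_var_expo: "(\<Prod>v\<in>A. var v :: ('v::finite, 'k::field) mpoly) = Poly_Mapping.single (expo A) 1"
proof -
  have "finite A" by simp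
  then show ?thesis
    by (induction A rule: finite_induct) (simp_all add: expo_def var_def mult_single)
qed

lemma prod_var_cancel: "(\<Prod>v\<in>A. var v) * p = (\<Prod>v\<in>A. var v) * q \<longleftrightarrow> p = (q :: ('v::finite, 'k::field) mpoly)"
  unfolding prod_var_expo using single_mult_cancel[of "expo A" p q] by blast

lemma expo_le_split:
  assumes "\<And>v. v \<in> A \<Longrightarrow> Poly_Mapping.lookup m v \<noteq> 0"
  shows "m = expo A + (m - expo A)"
proof (rule poly_mapping_eqI)
  fix v
  show "Poly_Mapping.lookup m v = Poly_Mapping.lookup (expo A + (m - expo A)) v"
    using assms[of v] by (auto simp: lookup_add lookup_minus lookup_expo)
qed

lemma monomial_divides:
  fixes f :: "('v::finite, 'k::field) mpoly"
  assumes "\<And>m. m \<in> Poly_Mapping.keys f \<Longrightarrow> \<exists>m'. m = e + m'"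
  shows "\<exists>g. f = Poly_Mapping.single e 1 * g"
proof -
  obtain h where h: "\<And>m. m \<in> Poly_Mapping.keys f \<Longrightarrow> m = e + h m" using assms by metis
  have "f = (\<Sum>m\<in>Poly_Mapping.keys f. Poly_Mapping.single m (Poly_Mapping.lookup f m))"
    by (rule poly_sum_monomials)
  also have "\<dots> = (\<Sum>m\<in>Poly_Mapping.keys f. Poly_Mapping.single e 1 * Poly_Mapping.single (h m) (Poly_Mapping.lookup f m))"
    by (rule sum.cong[OF refl]) (use h in \<open>simp add: mult_single\<close>)
  finally show ?thesis unfolding sum_distrib_left[symmetric] by blast
qed

locale koszul_var = koszul r x
  for r :: "'v::finite \<Rightarrow> nat" and x :: "'v \<Rightarrow> ('v, 'k::field) mpoly" +
  assumes x_var: "x = var"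
begin

lemma dK_var: "dK a S = (\<Sum>v\<in>UNIV. var v * contr v a S)"
  by (subst dK_def) (simp only: x_var)

definition gen :: "'v \<Rightarrow> 'v set \<Rightarrow> ('v, 'k) mpoly" where
  "gen v S = (if S = {v} then 1 else 0)"

lemma pure_gen: "pure 1 (gen v)"
  by (auto simp: pure_def gen_def)

lemma wedge_gen: "wedge (gen v) a S = (if v \<in> S then sg {v} (S - {v}) * a (S - {v}) else 0)"
proof -
  have "wedge (gen v) a S = (\<Sum>U\<in>Pow S. if U = {v} then sg {v} (S - {v}) * a (S - {v}) else 0)"
    unfolding wedge_def by (intro sum.cong) (auto simp: gen_def)
  then show ?thesis by simp
qed

lemma dK_gen: "dK (gen v) = (\<lambda>S. var v * oneK S)"
proof
  fix S
  have c: "contr u (gen v) S = (if u = v then oneK S else 0)" for u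
    by (auto simp: contr_def gen_def oneK_def)
  have "dK (gen v) S = (\<Sum>u\<in>UNIV. if u = v then var u * oneK S else 0)"
    unfolding dK_var c by (intro sum.cong) auto
  then show "dK (gen v) S = var v * oneK S" by simp
qed

definition supp :: "'v set \<Rightarrow> nat \<Rightarrow> ('v set \<Rightarrow> ('v, 'k) mpoly) \<Rightarrow> bool" where
  "supp Z n u \<longleftrightarrow> (\<forall>A. u A \<noteq> 0 \<longrightarrow> A \<subseteq> Z \<and> card A = n)"

lemma supp_pure: "supp Z n u \<Longrightarrow> pure n u"
  by (simp add: supp_def pure_def)

text \<open>The part of a cochain in the multidegrees satisfying \<open>P\<close>, where the basis element of
  \<open>A\<close> has multidegree \<open>expo A\<close>; the differential preserves multidegrees.\<close>

definition mpart :: "(('v \<Rightarrow>\<^sub>0 nat) \<Rightarrow> bool) \<Rightarrow> ('v set \<Rightarrow> ('v, 'k) mpoly) \<Rightarrow> 'v set \<Rightarrow> ('v, 'k) mpoly" where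
  "mpart P a A = pfilter (\<lambda>m. P (expo A + m)) (a A)"

lemma sg_cases: "sg U W = 1 \<or> sg U W = - 1"
  by (simp add: sg_def minus_one_power_iff)

lemma pfilter_uminus: "pfilter P (- p) = - pfilter P (p :: ('v, 'k) mpoly)"
  by (rule poly_mapping_eqI) (auto simp: lookup_pfilter)

lemma dK_mpart: "dK (mpart P a) = mpart P (dK a)"
proof
  fix S
  have "var v * contr v (mpart P a) S = pfilter (\<lambda>m. P (expo S + m)) (var v * contr v a S)" for v
  proof (cases "v \<in> S")
    case False
    have e: "expo (insert v S) = Poly_Mapping.single v 1 + expo S"
      using False by (simp add: expo_def)
    have "pfilter (\<lambda>m. P (expo S + m)) (a (insert v S) * var v)
        = pfilter (\<lambda>m. P (expo (insert v S) + m)) (a (insert v S)) * var v"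
      by (rule pfilter_mult) (auto simp: var_def e add_ac)
    then show ?thesis
      using False sg_cases[of "{v}" S]
      by (auto simp: contr_def mpart_def pfilter_uminus mult.commute)
  qed (simp add: contr_def)
  then show "dK (mpart P a) S = mpart P (dK a) S"
    by (simp add: dK_var mpart_def pfilter_sum)
qed

text \<open>With \<open>p a = {par a}\<close> the multiples of these weights form the Taylor complex
  of the edges {par a, a} inside a Koszul complex; with empty \<open>p a\<close> they form the
  Koszul complex itself. One acyclicity proof covers both.\<close>

definition wt :: "('v \<Rightarrow> 'v set) \<Rightarrow> 'v set \<Rightarrow> ('v, 'k) mpoly" where
  "wt p A = (\<Prod>y\<in>\<Union>(p ` A). var y)"

text \<open>In the multidegrees divisible by \<open>x\<^sub>a\<close> and by the weight of \<open>a\<close>, multiplication by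
  \<open>\<epsilon>\<^sub>a / x\<^sub>a\<close> is a contracting homotopy.\<close>

lemma weighted_koszul_part:
  fixes u :: "'v set \<Rightarrow> ('v, 'k) mpoly"
  assumes u: "supp Z n u" and cyc: "dK (\<lambda>A. wt p A * u A) = (\<lambda>_. 0)"
    and p: "\<And>b. b \<in> Z \<Longrightarrow> p b \<inter> Z = {}" and a: "a \<in> Z"
    and P: "\<And>m. P m \<Longrightarrow> Poly_Mapping.lookup m a \<noteq> 0 \<and> (\<forall>y\<in>p a. Poly_Mapping.lookup m y \<noteq> 0)"
  shows "\<exists>u'. supp Z (Suc n) u' \<and> dK (\<lambda>A. wt p A * u' A) = mpart P (\<lambda>A. wt p A * u A)"
proof -
  let ?al = "mpart P (\<lambda>A. wt p A * u A)"
  let ?w = "wedge (gen a) ?al"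
  \<comment> \<open>\<open>f\<close> is the quotient by x_a and the weight; the second clause keeps
    the support of the new chain under control.\<close>
  have "\<exists>f. ?w B = var a * (wt p B * f) \<and> (?w B = 0 \<longrightarrow> f = 0)" for B
  proof (cases "?w B = 0")
    case False
    then have aB: "a \<in> B" and nz: "?al (B - {a}) \<noteq> 0" by (auto simp: wedge_gen split: if_splits)
    then have "u (B - {a}) \<noteq> 0" by (auto simp: mpart_def)
    then have BZ: "B \<subseteq> Z" using u a by (auto simp: supp_def)
    let ?e = "expo (insert a (\<Union>(p ` B)))"
    have "\<exists>m'. m = ?e + m'" if m: "m \<in> Poly_Mapping.keys (?al (B - {a}))" for m
    proof -
      have Pm: "P (expo (B - {a}) + m)" and l: "Poly_Mapping.lookup (wt p (B - {a}) * u (B - {a})) m \<noteq> 0"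
        using m by (auto simp: mpart_def in_keys_iff lookup_pfilter split: if_splits)
      obtain m2 where m2: "m = expo (\<Union>(p ` (B - {a}))) + m2"
        using l lookup_single_mult_eq_0[of m "expo (\<Union>(p ` (B - {a})))" 1 "u (B - {a})"]
        unfolding wt_def prod_var_expo by blast
      have "Poly_Mapping.lookup m v \<noteq> 0" if v: "v \<in> insert a (\<Union>(p ` B))" for v
      proof -
        consider "v = a" | "v \<in> p a" | "v \<in> \<Union>(p ` (B - {a}))" using v by auto
        then show ?thesis
        proof cases
          case 1
          then show ?thesis using P[OF Pm] by (simp add: lookup_add lookup_expo)
        next
          case 2
          \<comment> \<open>Weights avoid \<open>Z\<close>, so the multidegree of the basis element
            of \<open>B - {a}\<close> cannot supply this variable; it must divide the
            coefficient.\<close>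
          then have "v \<notin> B" using p[OF a] BZ by auto
          then show ?thesis using P[OF Pm] 2 by (auto simp: lookup_add lookup_expo)
        next
          case 3
          then show ?thesis by (simp add: m2 lookup_add lookup_expo)
        qed
      qed
      then show ?thesis using expo_le_split by blast
    qed
    then obtain g where g: "?al (B - {a}) = Poly_Mapping.single ?e 1 * g" using monomial_divides by blast
    have "a \<notin> \<Union>(p ` B)" using p BZ a by blast
    then have e: "Poly_Mapping.single ?e 1 = var a * wt p B"
      by (simp add: wt_def prod_var_expo[symmetric])
    have "?w B = var a * (wt p B * (sg {a} (B - {a}) * g))"
      unfolding wedge_gen g e using aB by (simp add: mult_ac)
    then show ?thesis using False by blast
  qed (intro exI[of _ 0], simp)
  then have "\<forall>B. \<exists>f. ?w B = var a * (wt p B * f) \<and> (?w B = 0 \<longrightarrow> f = 0)" by (rule allI)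
  from choice[OF this] obtain u'
    where u0: "\<forall>B. ?w B = var a * (wt p B * u' B) \<and> (?w B = 0 \<longrightarrow> u' B = 0)" ..
  have u': "?w B = var a * (wt p B * u' B)" "?w B = 0 \<Longrightarrow> u' B = 0" for B
    by (rule u0[rule_format, THEN conjunct1], rule u0[rule_format, THEN conjunct2, rule_format])
  have "supp Z (Suc n) u'"
    unfolding supp_def
  proof (intro allI impI)
    fix B assume "u' B \<noteq> 0"
    then have "?w B \<noteq> 0" using u'(2) by blast
    then have aB: "a \<in> B" and "?al (B - {a}) \<noteq> 0" by (auto simp: wedge_gen split: if_splits)
    then have "u (B - {a}) \<noteq> 0" by (auto simp: mpart_def)
    then have "B - {a} \<subseteq> Z" "card (B - {a}) = n" using u by (auto simp: supp_def)
    moreover have "Suc (card (B - {a})) = card B" using aB by (intro card_Suc_Diff1) auto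
    ultimately show "B \<subseteq> Z \<and> card B = Suc n" using a by auto
  qed
  moreover have "dK (\<lambda>A. wt p A * u' A) = ?al"
  proof -
    have dal: "dK ?al = (\<lambda>_. 0)" unfolding dK_mpart cyc by (simp add: mpart_def fun_eq_iff)
    have "dK ?w = (\<lambda>S. wedge (\<lambda>S. var a * oneK S) ?al S + (-1) ^ 1 * wedge (gen a) (dK ?al) S)"
      unfolding dK_wedge[OF pure_gen] dK_gen ..
    also have "\<dots> = (\<lambda>S. var a * ?al S)"
      unfolding wedge_scale_left wedge_oneK_left dal by (simp add: wedge_def)
    finally have d: "dK ?w = (\<lambda>S. var a * ?al S)" .
    have w: "?w = (\<lambda>B. var a * (wt p B * u' B))" by (rule ext) (rule u'(1))
    have "dK (\<lambda>B. var a * (wt p B * u' B)) = (\<lambda>S. var a * ?al S)"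
      using d unfolding w .
    then have "var a * dK (\<lambda>B. wt p B * u' B) S = var a * ?al S" for S
      unfolding dK_scale by (rule fun_cong)
    then show ?thesis unfolding var_cancel by (rule ext)
  qed
  ultimately show ?thesis by blast
qed

lemma dK_sum: "dK (\<lambda>S. \<Sum>i\<in>I. f i S) = (\<lambda>S. \<Sum>i\<in>I. dK (f i) S)"
proof (induction I rule: infinite_finite_induct)
  case (insert x I)
  then show ?case using dK_add[of "f x" "\<lambda>S. \<Sum>i\<in>I. f i S"] by simp
qed (simp_all add: dK_pure_0 pure_def)

text \<open>A cycle of positive degree lives only in multidegrees that are good for some
  \<open>a\<close>. Selecting one such \<open>a\<close> for each multidegree splits the cycle into
  finitely many pieces, each with its own contracting homotopy.\<close>

lemma weighted_koszul_exact:
  fixes u :: "'v set \<Rightarrow> ('v, 'k) mpoly"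
  assumes u: "supp Z n u" "n > 0" and cyc: "dK (\<lambda>A. wt p A * u A) = (\<lambda>_. 0)"
    and p: "\<And>b. b \<in> Z \<Longrightarrow> p b \<inter> Z = {}"
  obtains u' where "supp Z (Suc n) u'" "dK (\<lambda>A. wt p A * u' A) = (\<lambda>A. wt p A * u A)"
proof -
  define good where "good a m \<longleftrightarrow> Poly_Mapping.lookup m a \<noteq> 0 \<and> (\<forall>y\<in>p a. Poly_Mapping.lookup m y \<noteq> 0)"
    for a and m :: "'v \<Rightarrow>\<^sub>0 nat"
  define ch where "ch m = (SOME a. a \<in> Z \<and> good a m)" for m
  let ?P = "\<lambda>a m. a = ch m \<and> good a m"
  let ?al = "\<lambda>A. wt p A * u A"
  have "\<exists>u'. supp Z (Suc n) u' \<and> dK (\<lambda>A. wt p A * u' A) = mpart (?P a) ?al" if "a \<in> Z" for a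
    by (rule weighted_koszul_part[OF u(1) cyc p that]) (auto simp: good_def)
  then have "\<forall>a\<in>Z. \<exists>u'. supp Z (Suc n) u' \<and> dK (\<lambda>A. wt p A * u' A) = mpart (?P a) ?al" by (rule ballI)
  from bchoice[OF this] obtain U
    where U0: "\<forall>a\<in>Z. supp Z (Suc n) (U a) \<and> dK (\<lambda>A. wt p A * U a A) = mpart (?P a) ?al" ..
  note U = U0[rule_format]
  have ch: "ch (expo A + m) \<in> Z \<and> good (ch (expo A + m)) (expo A + m)"
    if l: "Poly_Mapping.lookup (?al A) m \<noteq> 0" for A m
  proof -
    have "u A \<noteq> 0" using l by auto
    then have A: "A \<subseteq> Z" "card A = n" using u(1) by (auto simp: supp_def)
    then obtain a where a: "a \<in> A" using u(2) by fastforce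
    obtain m2 where m2: "m = expo (\<Union>(p ` A)) + m2"
      using l lookup_single_mult_eq_0[of m "expo (\<Union>(p ` A))" 1 "u A"]
      unfolding wt_def prod_var_expo by blast
    have "good a (expo A + m)"
      using a by (auto simp: good_def m2 lookup_add lookup_expo)
    then have "a \<in> Z \<and> good a (expo A + m)" using a A by blast
    then show ?thesis unfolding ch_def by (rule someI)
  qed
  have sum: "(\<Sum>a\<in>Z. mpart (?P a) ?al A) = ?al A" for A
  proof (rule poly_mapping_eqI)
    fix m
    have "(\<Sum>a\<in>Z. Poly_Mapping.lookup (mpart (?P a) ?al A) m)
       = (\<Sum>a\<in>Z. if a = ch (expo A + m) then Poly_Mapping.lookup (?al A) m else 0)"
      by (intro sum.cong refl) (use ch in \<open>auto simp: mpart_def lookup_pfilter\<close>)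
    also have "\<dots> = Poly_Mapping.lookup (?al A) m" using ch[of A m] by auto
    finally show "Poly_Mapping.lookup (\<Sum>a\<in>Z. mpart (?P a) ?al A) m = Poly_Mapping.lookup (?al A) m"
      by (simp add: lookup_sum)
  qed
  show ?thesis
  proof (rule that[of "\<lambda>A. \<Sum>a\<in>Z. U a A"])
    show "supp Z (Suc n) (\<lambda>A. \<Sum>a\<in>Z. U a A)"
      unfolding supp_def
    proof (intro allI impI)
      fix A assume "(\<Sum>a\<in>Z. U a A) \<noteq> 0"
      then obtain a where "a \<in> Z" "U a A \<noteq> 0" by (meson sum.not_neutral_contains_not_neutral)
      then show "A \<subseteq> Z \<and> card A = Suc n" using U by (auto simp: supp_def)
    qed
    have "dK (\<lambda>A. wt p A * (\<Sum>a\<in>Z. U a A)) = (\<lambda>S. \<Sum>a\<in>Z. dK (\<lambda>A. wt p A * U a A) S)"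
      unfolding sum_distrib_left by (rule dK_sum)
    also have "\<dots> = (\<lambda>S. \<Sum>a\<in>Z. mpart (?P a) ?al S)"
      using U by (intro ext sum.cong) auto
    also have "\<dots> = ?al" using sum by (rule ext)
    finally show "dK (\<lambda>A. wt p A * (\<Sum>a\<in>Z. U a A)) = ?al" .
  qed
qed

end

section \<open>The Taylor algebra of a disjoint union of stars\<close>

text \<open>A tree of diameter at most four: the centre \<open>c\<close>, its neighbours \<open>Y\<close>, and leaves \<open>X\<close>, each
  attached to \<open>par x \<in> Y\<close>. The enumeration is compatible with \<open>par\<close>, which makes signs disappear
  from \<open>Phi\<close>.\<close>

locale star_tree = koszul_var r x
  for r :: "'v::finite \<Rightarrow> nat" and x :: "'v \<Rightarrow> ('v, 'k::field) mpoly" +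
  fixes c :: 'v and Y X :: "'v set" and par :: "'v \<Rightarrow> 'v"
  assumes c: "c \<notin> Y" "c \<notin> X" and XY: "X \<inter> Y = {}" and par: "\<And>a. a \<in> X \<Longrightarrow> par a \<in> Y"
    and r_par: "\<And>a b. a \<in> X \<Longrightarrow> b \<in> X \<Longrightarrow> r (par a) < r (par b) \<Longrightarrow> r a < r b"
begin

definition w :: "'v set \<Rightarrow> ('v, 'k) mpoly" where "w A = (\<Prod>y\<in>par ` A. var y)"
definition xm :: "'v set \<Rightarrow> ('v, 'k) mpoly" where "xm A = (\<Prod>a\<in>A. var a)"
definition hat :: "('v set \<Rightarrow> ('v, 'k) mpoly) \<Rightarrow> 'v set \<Rightarrow> ('v, 'k) mpoly" where "hat u A = w A * u A"

text \<open>A set of leaves using a parent twice has to go to 0 in the Koszul algebra on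
  \<open>Y\<close>, where generators square to zero; hence only transversals index the sum in
  \<open>Phi\<close>.\<close>

definition transv :: "'v set \<Rightarrow> 'v set set" where
  "transv B = {A. A \<subseteq> X \<and> inj_on par A \<and> par ` A = B}"

text \<open>The Taylor resolution of the edges \<open>{par a, a}\<close> embeds into the Koszul complex on \<open>X\<close> by \<open>hat\<close>
  and maps to the Koszul complex on \<open>Y\<close> by \<open>Phi\<close>, which sends the generator of \<open>a\<close> to \<open>x\<^sub>a\<close> times that of
  \<open>par a\<close>; \<open>bd\<close> and \<open>tp\<close> are its differential and product.\<close>

definition Phi :: "('v set \<Rightarrow> ('v, 'k) mpoly) \<Rightarrow> 'v set \<Rightarrow> ('v, 'k) mpoly" where
  "Phi u B = (\<Sum>A\<in>transv B. xm A * u A)"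

definition bd :: "('v set \<Rightarrow> ('v, 'k) mpoly) \<Rightarrow> 'v set \<Rightarrow> ('v, 'k) mpoly" where
  "bd u A = (\<Sum>v\<in>X - A. sg {v} A * (var v * ((if par v \<in> par ` A then 1 else var (par v)) * u (insert v A))))"

definition tp :: "('v set \<Rightarrow> ('v, 'k) mpoly) \<Rightarrow> ('v set \<Rightarrow> ('v, 'k) mpoly) \<Rightarrow> 'v set \<Rightarrow> ('v, 'k) mpoly" where
  "tp u u' S = (\<Sum>U\<in>Pow S. sg U (S - U) * (\<Prod>y\<in>par ` U \<inter> par ` (S - U). var y) * u U * u' (S - U))"

lemma qlinear_hat: "qlinear hat"
  by (simp add: qlinear_def hat_def fun_eq_iff algebra_simps)

lemma qlinear_Phi: "qlinear Phi"
  by (simp add: qlinear_def Phi_def fun_eq_iff algebra_simps sum.distrib sum_distrib_left)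

lemma qlinear_bd: "qlinear bd"
  by (simp add: qlinear_def bd_def fun_eq_iff algebra_simps sum.distrib sum_distrib_left)

lemma qlinear_dK: "qlinear dK"
  by (simp add: qlinear_def dK_add dK_scale)

lemma hat_inj: "hat u = hat u' \<Longrightarrow> u = u'"
  unfolding hat_def w_def fun_eq_iff prod_var_cancel .

text \<open>Parents common to both factors are counted twice in \<open>w U * w (S - U)\<close>; the
  product over the intersection accounts for this. As \<open>hat\<close> is injective, identities
  for \<open>tp\<close> are inherited from \<open>wedge\<close>.\<close>

lemma hat_tp: "hat (tp u u') = wedge (hat u) (hat u')"
proof
  fix S
  have "w S * (sg U (S - U) * (\<Prod>y\<in>par ` U \<inter> par ` (S - U). var y) * u U * u' (S - U))
      = sg U (S - U) * hat u U * hat u' (S - U)" if "U \<in> Pow S" for U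
  proof -
    have "par ` S = par ` U \<union> par ` (S - U)" using that by auto
    then have "w S * (\<Prod>y\<in>par ` U \<inter> par ` (S - U). var y) = w U * w (S - U)"
      unfolding w_def using prod.union_inter[of "par ` U" "par ` (S - U)" var] by simp
    then have "sg U (S - U) * u U * u' (S - U) * (w S * (\<Prod>y\<in>par ` U \<inter> par ` (S - U). var y))
       = sg U (S - U) * u U * u' (S - U) * (w U * w (S - U))" by simp
    then show ?thesis by (simp add: hat_def mult_ac)
  qed
  then show "hat (tp u u') S = wedge (hat u) (hat u') S"
    unfolding hat_def[of "tp u u'"] tp_def wedge_def sum_distrib_left by (rule sum.cong[OF refl])
qed

lemma dK_hat:
  assumes u: "supp X n u"
  shows "dK (hat u) = hat (bd u)"
proof
  fix A
  have "dK (hat u) A = (\<Sum>v\<in>X - A. var v * contr v (hat u) A)"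
    unfolding dK_var
  proof (rule sum.mono_neutral_right)
    show "\<forall>v\<in>UNIV - (X - A). var v * contr v (hat u) A = 0"
    proof
      fix v assume v: "v \<in> UNIV - (X - A)"
      have "u (insert v A) = 0" if "v \<notin> A" using u v that by (auto simp: supp_def)
      then show "var v * contr v (hat u) A = 0" by (auto simp: contr_def hat_def)
    qed
  qed auto
  also have "\<dots> = hat (bd u) A"
    unfolding hat_def[of "bd u"] bd_def sum_distrib_left
  proof (rule sum.cong[OF refl])
    fix v assume v: "v \<in> X - A"
    have "w (insert v A) = w A * (if par v \<in> par ` A then 1 else var (par v))"
      by (simp add: w_def insert_absorb)
    then show "var v * contr v (hat u) A
       = w A * (sg {v} A * (var v * ((if par v \<in> par ` A then 1 else var (par v)) * u (insert v A))))"
      using v by (simp add: contr_def hat_def mult_ac)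
  qed
  finally show "dK (hat u) A = hat (bd u) A" .
qed

lemma supp_bd:
  assumes "supp X (Suc n) u"
  shows "supp X n (bd u)"
  unfolding supp_def
proof (intro allI impI)
  fix A assume "bd u A \<noteq> 0"
  then obtain v where v: "v \<in> X - A" and nz: "sg {v} A * (var v * ((if par v \<in> par ` A then 1 else var (par v)) * u (insert v A))) \<noteq> 0"
    unfolding bd_def by (meson sum.not_neutral_contains_not_neutral)
  from nz have "u (insert v A) \<noteq> 0" by auto
  then have "insert v A \<subseteq> X" "card (insert v A) = Suc n" using assms by (auto simp: supp_def)
  then show "A \<subseteq> X \<and> card A = n" using v by simp
qed

lemma supp_Phi:
  assumes "supp X n u"
  shows "supp Y n (Phi u)"
  unfolding supp_def
proof (intro allI impI)
  fix B assume "Phi u B \<noteq> 0"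
  then obtain A where A: "A \<in> transv B" and nz: "xm A * u A \<noteq> 0"
    unfolding Phi_def by (meson sum.not_neutral_contains_not_neutral)
  from nz have "u A \<noteq> 0" by auto
  then have "card A = n" using assms by (auto simp: supp_def)
  then show "B \<subseteq> Y \<and> card B = n" using A par by (auto simp: transv_def card_image)
qed

lemma supp_dK:
  assumes "supp Z (Suc n) u"
  shows "supp Z n (dK u)"
proof -
  have "pure n (dK u)" using assms by (intro pure_dK supp_pure)
  moreover have "A \<subseteq> Z" if nz: "dK u A \<noteq> 0" for A
  proof -
    obtain v where "var v * contr v u A \<noteq> 0"
      using nz unfolding dK_var by (meson sum.not_neutral_contains_not_neutral)
    then have "u (insert v A) \<noteq> 0" by (auto simp: contr_def split: if_splits)
    then show ?thesis using assms by (auto simp: supp_def)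
  qed
  ultimately show ?thesis by (auto simp: supp_def pure_def)
qed

lemma supp_wedge:
  assumes "supp Z n u" "supp Z m u'"
  shows "supp Z (n + m) (wedge u u')"
proof -
  have "pure (n + m) (wedge u u')" using assms by (intro pure_wedge supp_pure)
  moreover have "S \<subseteq> Z" if nz: "wedge u u' S \<noteq> 0" for S
  proof -
    obtain U where U: "U \<in> Pow S" "sg U (S - U) * u U * u' (S - U) \<noteq> 0"
      using nz unfolding wedge_def by (meson sum.not_neutral_contains_not_neutral)
    then have "u U \<noteq> 0" "u' (S - U) \<noteq> 0" by auto
    then have "U \<subseteq> Z" "S - U \<subseteq> Z" using assms by (auto simp: supp_def)
    then show ?thesis by blast
  qed
  ultimately show ?thesis by (auto simp: supp_def pure_def)
qed

lemma supp_hat: "supp Z n (hat u) \<longleftrightarrow> supp Z n u"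
proof -
  have "hat u A = 0 \<longleftrightarrow> u A = 0" for A
    using prod_var_cancel[of "par ` A" "u A" 0] by (simp add: hat_def w_def)
  then show ?thesis by (simp add: supp_def)
qed

lemma supp_tp: "supp X n u \<Longrightarrow> supp X m u' \<Longrightarrow> supp X (n + m) (tp u u')"
  using supp_wedge[of X n "hat u" m "hat u'"] by (simp add: hat_tp[symmetric] supp_hat)

lemma supp_add: "supp Z n u \<Longrightarrow> supp Z n u' \<Longrightarrow> supp Z n (\<lambda>A. u A + u' A)"
  unfolding supp_def by (metis add.right_neutral)

lemma supp_scale: "supp Z n u \<Longrightarrow> supp Z n (\<lambda>A. q * u A)"
  unfolding supp_def by (metis mult_zero_right)

lemma supp_uminus: "supp Z n u \<Longrightarrow> supp Z n (\<lambda>A. - u A)"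
  unfolding supp_def by simp

lemma supp_diff: "supp Z n u \<Longrightarrow> supp Z n u' \<Longrightarrow> supp Z n (\<lambda>A. u A - u' A)"
  using supp_add[OF _ supp_uminus, of Z n u u'] by simp

lemma bd_tp:
  assumes u: "supp X (Suc n) u" and u': "supp X m u'"
  shows "bd (tp u u') = (\<lambda>A. tp (bd u) u' A + (-1) ^ Suc n * tp u (bd u') A)"
proof (rule hat_inj)
  have "hat (bd (tp u u')) = dK (wedge (hat u) (hat u'))"
    using dK_hat[OF supp_tp[OF u u']] by (simp add: hat_tp)
  also have "\<dots> = (\<lambda>S. wedge (dK (hat u)) (hat u') S + (-1) ^ Suc n * wedge (hat u) (dK (hat u')) S)"
    by (rule dK_wedge) (use u in \<open>auto simp: supp_hat intro: supp_pure\<close>)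
  also have "\<dots> = hat (\<lambda>A. tp (bd u) u' A + (-1) ^ Suc n * tp u (bd u') A)"
    unfolding dK_hat[OF u] dK_hat[OF u'] hat_tp[symmetric]
    by (simp only: qlinear_add[OF qlinear_hat] qlinear_scale[OF qlinear_hat])
  finally show "hat (bd (tp u u')) = hat (\<lambda>A. tp (bd u) u' A + (-1) ^ Suc n * tp u (bd u') A)" .
qed

text \<open>On a set where \<open>par\<close> is injective it preserves and reflects the
  enumeration, by \<open>r_par\<close>, so inversions correspond.\<close>

lemma sg_par:
  assumes U: "U \<subseteq> X" "W \<subseteq> X" "inj_on par (U \<union> W)" "U \<inter> W = {}"
  shows "sg (par ` U) (par ` W) = sg U W"
proof -
  have iff: "r (par b) < r (par a) \<longleftrightarrow> r b < r a" if ab: "a \<in> U" "b \<in> W" for a b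
  proof
    assume "r (par b) < r (par a)"
    then show "r b < r a" using r_par U ab by blast
  next
    assume l: "r b < r a"
    have "a \<noteq> b" using ab U(4) by auto
    then have "par a \<noteq> par b" using U(3) ab by (auto simp: inj_on_def)
    then have "r (par a) \<noteq> r (par b)" using inj_r by (simp add: inj_eq)
    moreover have "\<not> r (par a) < r (par b)" using r_par[of a b] U ab l by auto
    ultimately show "r (par b) < r (par a)" by simp
  qed
  have "card {(u, b). u \<in> par ` U \<and> b \<in> par ` W \<and> r b < r u} = card (map_prod par par ` {(u, b). u \<in> U \<and> b \<in> W \<and> r b < r u})"
    by (rule arg_cong[of _ _ card]) (use iff in \<open>force simp: image_iff\<close>)
  also have "\<dots> = card {(u, b). u \<in> U \<and> b \<in> W \<and> r b < r u}"
    by (rule card_image) (use U(3) in \<open>auto simp: inj_on_def\<close>)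
  finally show ?thesis by (simp add: sg_def)
qed

text \<open>A transversal of \<open>B\<close> with a subset is the same as a subset \<open>V\<close>
  of \<open>B\<close> with one transversal of \<open>V\<close> and one of its complement. The
  parents of the two parts are disjoint, so the extra factor in \<open>tp\<close> is 1.\<close>

lemma Phi_tp: "Phi (tp u u') = wedge (Phi u) (Phi u')"
proof
  fix B
  have "Phi (tp u u') B = (\<Sum>(S, U)\<in>Sigma (transv B) Pow.
      xm S * (sg U (S - U) * (\<Prod>y\<in>par ` U \<inter> par ` (S - U). var y) * u U * u' (S - U)))"
    unfolding Phi_def tp_def sum_distrib_left by (rule sum.Sigma) auto
  also have "\<dots> = (\<Sum>(V, UW)\<in>Sigma (Pow B) (\<lambda>V. transv V \<times> transv (B - V)).
      sg V (B - V) * (xm (fst UW) * u (fst UW) * (xm (snd UW) * u' (snd UW))))"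
  proof (rule sum.reindex_bij_witness[of _ "\<lambda>(V, (U, W)). (U \<union> W, U)" "\<lambda>(S, U). (par ` U, (U, S - U))"])
    fix z assume z: "z \<in> Sigma (transv B) Pow"
    then obtain S U where SU: "z = (S, U)" "S \<in> transv B" "U \<subseteq> S" by auto
    have S: "S \<subseteq> X" "inj_on par S" "par ` S = B" using SU by (auto simp: transv_def)
    have d: "par ` (S - U) = B - par ` U" using inj_on_image_set_diff[OF S(2), of S U] SU(3) S(3) by auto
    show "(case case z of (S, U) \<Rightarrow> (par ` U, U, S - U) of (V, U, W) \<Rightarrow> (U \<union> W, U)) = z"
      using SU by auto
    show "(case z of (S, U) \<Rightarrow> (par ` U, U, S - U)) \<in> (SIGMA V:Pow B. transv V \<times> transv (B - V))"
      using SU S d by (auto simp: transv_def intro: inj_on_subset)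
    have "xm S = xm U * xm (S - U)"
      unfolding xm_def using SU(3) prod.subset_diff[of U S var] by (simp add: mult.commute)
    moreover have "sg (par ` U) (B - par ` U) = sg U (S - U)"
      unfolding d[symmetric] by (rule sg_par) (use S SU in \<open>auto intro: inj_on_subset\<close>)
    moreover have "par ` U \<inter> par ` (S - U) = {}" using d by auto
    ultimately show "(case case z of (S, U) \<Rightarrow> (par ` U, U, S - U) of (V, UW) \<Rightarrow>
        sg V (B - V) * (xm (fst UW) * u (fst UW) * (xm (snd UW) * u' (snd UW)))) =
      (case z of (S, U) \<Rightarrow> xm S * (sg U (S - U) * (\<Prod>y\<in>par ` U \<inter> par ` (S - U). var y) * u U * u' (S - U)))"
      by (simp add: SU(1) mult_ac)
  next
    fix z assume "z \<in> (SIGMA V:Pow B. transv V \<times> transv (B - V))"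
    then obtain V U W where z: "z = (V, (U, W))" "V \<subseteq> B" and U: "U \<subseteq> X" "inj_on par U" "par ` U = V"
      and W: "W \<subseteq> X" "inj_on par W" "par ` W = B - V" by (auto simp: transv_def)
    have d: "U \<inter> W = {}" using U W by auto
    then have UW: "(U \<union> W) - U = W" by auto
    show "(case case z of (V, U, W) \<Rightarrow> (U \<union> W, U) of (S, U) \<Rightarrow> (par ` U, U, S - U)) = z"
      using z(1) U(3) UW by simp
    have "inj_on par (U \<union> W)" unfolding inj_on_Un using U W by auto
    moreover have "par ` (U \<union> W) = B" using U(3) W(3) z(2) by (auto simp: image_Un)
    ultimately show "(case z of (V, U, W) \<Rightarrow> (U \<union> W, U)) \<in> Sigma (transv B) Pow"
      using z(1) U(1) W(1) by (simp add: transv_def)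
  qed
  also have "\<dots> = (\<Sum>V\<in>Pow B. \<Sum>UW\<in>transv V \<times> transv (B - V).
      sg V (B - V) * (xm (fst UW) * u (fst UW) * (xm (snd UW) * u' (snd UW))))"
    by (rule sum.Sigma[symmetric]) auto
  also have "\<dots> = wedge (Phi u) (Phi u') B"
    unfolding wedge_def
  proof (rule sum.cong[OF refl])
    fix V
    have "(\<Sum>UW\<in>transv V \<times> transv (B - V). xm (fst UW) * u (fst UW) * (xm (snd UW) * u' (snd UW)))
        = Phi u V * Phi u' (B - V)"
      unfolding Phi_def sum_product sum.cartesian_product by (rule sum.cong) auto
    then show "(\<Sum>UW\<in>transv V \<times> transv (B - V). sg V (B - V) * (xm (fst UW) * u (fst UW) * (xm (snd UW) * u' (snd UW))))
        = sg V (B - V) * Phi u V * Phi u' (B - V)"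
      unfolding sum_distrib_left[symmetric] by (simp add: mult.assoc)
  qed
  finally show "Phi (tp u u') B = wedge (Phi u) (Phi u') B" .
qed

lemma supp_unitv: "A \<subseteq> X \<Longrightarrow> supp X (card A) (unitv A)"
  by (auto simp: supp_def unitv_def)

lemma tp_unitv:
  assumes "U \<inter> W = {}"
  shows "tp (unitv U) (unitv W) = (\<lambda>S. sg U W * ((\<Prod>y\<in>par ` U \<inter> par ` W. var y) * unitv (U \<union> W) S))"
proof
  fix S
  have "tp (unitv U) (unitv W) S = (\<Sum>V\<in>Pow S. if V = U then
      sg U (S - U) * (\<Prod>y\<in>par ` U \<inter> par ` (S - U). var y) * unitv W (S - U) else 0)"
    unfolding tp_def by (intro sum.cong) (auto simp: unitv_def)
  also have "\<dots> = (if U \<subseteq> S then sg U (S - U) * (\<Prod>y\<in>par ` U \<inter> par ` (S - U). var y) * unitv W (S - U) else 0)"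
    by simp
  also have "\<dots> = sg U W * ((\<Prod>y\<in>par ` U \<inter> par ` W. var y) * unitv (U \<union> W) S)"
  proof (cases "S = U \<union> W")
    case True
    then have "S - U = W" using assms by auto
    then show ?thesis using True by (simp add: unitv_def)
  next
    case False
    then have "U \<subseteq> S \<Longrightarrow> S - U \<noteq> W" by auto
    then show ?thesis using False by (simp add: unitv_def)
  qed
  finally show "tp (unitv U) (unitv W) S = sg U W * ((\<Prod>y\<in>par ` U \<inter> par ` W. var y) * unitv (U \<union> W) S)" .
qed

lemma bd_supp0: "supp X 0 u \<Longrightarrow> bd u = (\<lambda>_. 0)"
proof
  fix A assume u: "supp X 0 u"
  have "u (insert v A) = 0" for v using u by (auto simp: supp_def)
  then show "bd u A = 0" by (simp add: bd_def)
qed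

text \<open>Both differentials satisfy the Leibniz rule, and a product of basis elements on disjoint
  sets is a basis element up to a sign and a monomial. Induction reduces the claim to single leaves;
  the sign and the monomial are cancelled at the end.\<close>

lemma dK_Phi_unitv:
  assumes "A \<subseteq> X"
  shows "dK (Phi (unitv A)) = Phi (bd (unitv A))"
proof -
  have "finite A" by simp
  then show ?thesis using assms
  proof (induction A rule: finite_induct)
    case empty
    have s: "supp X 0 (unitv {})" using supp_unitv[of "{}"] by simp
    show ?case
      unfolding bd_supp0[OF s] qlinear_zero[OF qlinear_Phi]
      by (rule dK_pure_0) (rule supp_pure[OF supp_Phi[OF s]])
  next
    case (insert a A)
    have aX: "a \<in> X" and AX: "A \<subseteq> X" using insert.prems by auto
    have sa: "supp X (Suc 0) (unitv {a})" using supp_unitv[of "{a}"] aX by simp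
    have sA: "supp X (card A) (unitv A)" by (rule supp_unitv[OF AX])
    have one: "Phi (unitv {}) = oneK"
    proof
      fix B
      have "Phi (unitv {}) B = (\<Sum>A\<in>transv B. if A = {} then 1 else 0)"
        unfolding Phi_def by (intro sum.cong) (auto simp: unitv_def xm_def)
      then show "Phi (unitv {}) B = oneK B" by (auto simp: oneK_def transv_def)
    qed
    have base: "dK (Phi (unitv {a})) = Phi (bd (unitv {a}))"
    proof -
      have "Phi (unitv {a}) = (\<lambda>B. var a * gen (par a) B)"
      proof
        fix B
        have "Phi (unitv {a}) B = (\<Sum>A\<in>transv B. if A = {a} then var a else 0)"
          unfolding Phi_def by (intro sum.cong) (auto simp: unitv_def xm_def)
        then show "Phi (unitv {a}) B = var a * gen (par a) B" using aX by (auto simp: gen_def transv_def)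
      qed
      moreover have "bd (unitv {a}) = (\<lambda>A. var a * var (par a) * unitv {} A)"
      proof
        fix A
        have "bd (unitv {a}) A = (\<Sum>v\<in>X - A. if v = a then (if A = {} then var a * var (par a) else 0) else 0)"
          unfolding bd_def by (intro sum.cong) (auto simp: unitv_def)
        then show "bd (unitv {a}) A = var a * var (par a) * unitv {} A"
          using aX by (auto simp: unitv_def)
      qed
      ultimately show ?thesis
        by (simp add: dK_scale dK_gen qlinear_scale[OF qlinear_Phi] one mult.assoc)
    qed
    let ?t = "tp (unitv {a}) (unitv A)"
    let ?\<pi> = "\<Prod>y\<in>par ` {a} \<inter> par ` A. var y :: ('v, 'k) mpoly"
    have t: "?t = (\<lambda>S. sg {a} A * (?\<pi> * unitv (insert a A) S))"
      using tp_unitv[of "{a}" A] insert.hyps by simp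
    have "dK (Phi ?t) = (\<lambda>S. wedge (dK (Phi (unitv {a}))) (Phi (unitv A)) S
        + (-1) ^ Suc 0 * wedge (Phi (unitv {a})) (dK (Phi (unitv A))) S)"
      unfolding Phi_tp by (rule dK_wedge) (rule supp_pure[OF supp_Phi[OF sa]])
    also have "\<dots> = Phi (\<lambda>S. tp (bd (unitv {a})) (unitv A) S + (-1) ^ Suc 0 * tp (unitv {a}) (bd (unitv A)) S)"
      unfolding base insert.IH[OF AX] Phi_tp[symmetric]
      by (simp only: qlinear_add[OF qlinear_Phi] qlinear_scale[OF qlinear_Phi])
    also have "\<dots> = Phi (bd ?t)"
      by (subst bd_tp[OF sa sA]) simp
    finally have "dK (Phi (\<lambda>S. sg {a} A * (?\<pi> * unitv (insert a A) S))) = Phi (bd (\<lambda>S. sg {a} A * (?\<pi> * unitv (insert a A) S)))"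
      unfolding t .
    then have eq: "(\<lambda>S. sg {a} A * (?\<pi> * dK (Phi (unitv (insert a A))) S)) = (\<lambda>S. sg {a} A * (?\<pi> * Phi (bd (unitv (insert a A))) S))"
      by (simp only: qlinear_scale[OF qlinear_Phi] qlinear_scale[OF qlinear_bd] dK_scale)
    have "sg {a} A * (sg {a} A * (?\<pi> * dK (Phi (unitv (insert a A))) S)) = sg {a} A * (sg {a} A * (?\<pi> * Phi (bd (unitv (insert a A))) S))" for S
      using arg_cong[OF fun_cong[OF eq, of S], of "(*) (sg {a} A)"] .
    then have "?\<pi> * dK (Phi (unitv (insert a A))) S = ?\<pi> * Phi (bd (unitv (insert a A))) S" for S
      unfolding mult.assoc[symmetric] sg_sq by simp
    then show ?case unfolding prod_var_cancel by (rule ext)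
  qed
qed

lemma dK_Phi:
  assumes u: "supp X n u"
  shows "dK (Phi u) = Phi (bd u)"
proof -
  have v: "vec (Pow X) u" using u by (auto simp: supp_def vec_def)
  have "dK (Phi u) = (\<lambda>S. \<Sum>A\<in>Pow X. u A * dK (Phi (unitv A)) S)"
    by (rule qlinear_expand[OF _ v qlinear_comp[OF qlinear_Phi qlinear_dK]]) simp
  also have "\<dots> = (\<lambda>S. \<Sum>A\<in>Pow X. u A * Phi (bd (unitv A)) S)"
    by (intro ext sum.cong) (auto simp: dK_Phi_unitv)
  also have "\<dots> = Phi (bd u)"
    by (rule qlinear_expand[OF _ v qlinear_comp[OF qlinear_bd qlinear_Phi], symmetric]) simp
  finally show ?thesis .
qed

lemma bd_exact:
  assumes u: "supp X n u" "n > 0" "bd u = (\<lambda>_. 0)"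
  obtains u' where "supp X (Suc n) u'" "bd u' = u"
proof -
  have h: "hat v = (\<lambda>A. wt (\<lambda>a. {par a}) A * v A)" for v
    by (simp add: fun_eq_iff hat_def w_def wt_def UNION_singleton_eq_range)
  have "dK (hat u) = (\<lambda>_. 0)" unfolding dK_hat[OF u(1)] u(3) by (simp add: hat_def fun_eq_iff)
  then have cyc: "dK (\<lambda>A. wt (\<lambda>a. {par a}) A * u A) = (\<lambda>_. 0)" by (simp only: h)
  obtain u' where u': "supp X (Suc n) u'" "dK (\<lambda>A. wt (\<lambda>a. {par a}) A * u' A) = (\<lambda>A. wt (\<lambda>a. {par a}) A * u A)"
    by (rule weighted_koszul_exact[OF u(1,2) cyc]) (use par XY in auto)
  have "hat (bd u') = hat u" using u'(2) unfolding h[symmetric] dK_hat[OF u'(1)] .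
  then have "bd u' = u" by (rule hat_inj)
  then show ?thesis using that u'(1) by blast
qed

lemma koszul_exact:
  assumes u: "supp Z n u" "n > 0" "dK u = (\<lambda>_. 0)"
  obtains u' where "supp Z (Suc n) u'" "dK u' = u"
proof -
  have cyc: "dK (\<lambda>A. wt (\<lambda>a. {}) A * u A) = (\<lambda>_. 0)" using u(3) by (simp add: wt_def)
  obtain u' where u': "supp Z (Suc n) u'" "dK (\<lambda>A. wt (\<lambda>a. {}) A * u' A) = (\<lambda>A. wt (\<lambda>a. {}) A * u A)"
    by (rule weighted_koszul_exact[OF u(1,2) cyc]) auto
  then show ?thesis using that by (simp add: wt_def)
qed

text \<open>The variable \<open>c\<close> is a non-zero-divisor modulo the ideal of the edges \<open>{par a, a}\<close>.\<close>

lemma divide_by_center: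
  assumes t: "supp X 1 t" and e: "\<And>A. bd t A + var c * d A = 0"
  obtains s where "supp X 1 s" "bd s = d" "bd (\<lambda>A. t A + var c * s A) = (\<lambda>_. 0)"
proof -
  have "\<forall>A. \<exists>q. t A = var c * q + kill {c} (t A) \<and> (t A = 0 \<longrightarrow> q = 0)"
  proof
    fix A
    show "\<exists>q. t A = var c * q + kill {c} (t A) \<and> (t A = 0 \<longrightarrow> q = 0)"
    proof (cases "t A = 0")
      case False
      obtain q where "t A = var c * q + kill {c} (t A)" by (rule var_split)
      then show ?thesis using False by blast
    qed (intro exI[of _ 0], simp)
  qed
  from choice[OF this] obtain q where q: "\<forall>A. t A = var c * q A + kill {c} (t A) \<and> (t A = 0 \<longrightarrow> q A = 0)" ..
  define k where "k A = kill {c} (t A)" for A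
  have tq: "t = (\<lambda>A. var c * q A + k A)" using q unfolding k_def by (intro ext) blast
  have sq: "supp X 1 q" using t q unfolding supp_def by blast
  \<comment> \<open>\<open>bd\<close> does not involve \<open>c\<close>, so it commutes with setting
    \<open>c\<close> to 0.\<close>
  have kk: "kill {c} (bd t A) = bd k A" for A
  proof -
    have s: "kill {c} (sg {v} A * p) = sg {v} A * kill {c} p" for v and p :: "('v, 'k) mpoly"
      using sg_cases[of "{v}" A] by (auto simp: kill_uminus)
    have "kill {c} (var v * ((if par v \<in> par ` A then 1 else var (par v)) * p))
      = var v * ((if par v \<in> par ` A then 1 else var (par v)) * kill {c} p)" if "v \<in> X" for v and p :: "('v, 'k) mpoly"
      using that c par[OF that] by (auto simp: kill_mult kill_var kill_one)
    then show ?thesis unfolding bd_def kill_sum s k_def by (intro sum.cong) auto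
  qed
  have bk: "bd k A = 0" for A
  proof -
    have "kill {c} (bd t A + var c * d A) = 0" unfolding e by simp
    then show ?thesis by (simp add: kill_add kill_mult kill_var kk)
  qed
  have "bd t A = var c * bd q A" for A
    unfolding tq by (simp only: qlinear_add[OF qlinear_bd] qlinear_scale[OF qlinear_bd] bk add_0_right)
  then have "var c * (bd q A + d A) = 0" for A using e[of A] by (simp add: distrib_left)
  then have "bd q A + d A = 0" for A unfolding var_mult_eq_0 .
  then have dq: "- bd q A = d A" for A by (simp add: neg_eq_iff_add_eq_0)
  show ?thesis
  proof (rule that[of "\<lambda>A. - q A"])
    show "supp X 1 (\<lambda>A. - q A)" by (rule supp_uminus[OF sq])
    show "bd (\<lambda>A. - q A) = d" unfolding qlinear_uminus[OF qlinear_bd] dq ..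
    have "(\<lambda>A. t A + var c * - q A) = k" unfolding tq by (simp add: fun_eq_iff)
    then show "bd (\<lambda>A. t A + var c * - q A) = (\<lambda>_. 0)" using bk by (simp add: fun_eq_iff)
  qed
qed

end

section \<open>Differential graded algebras from Koszul algebras\<close>

context koszul_var
begin

text \<open>A subalgebra of a product of two Koszul algebras inherits all axioms.\<close>

lemma admits_dga_of_embedding:
  fixes F :: "('v, 'k) mpoly cplx" and \<Theta>1 \<Theta>2 :: "nat \<Rightarrow> (nat \<Rightarrow> ('v, 'k) mpoly) \<Rightarrow> ('v set \<Rightarrow> ('v, 'k) mpoly)"
  assumes lin: "\<And>i. qlinear (\<Theta>1 i)" "\<And>i. qlinear (\<Theta>2 i)"
    and pu: "\<And>i a. inF F i a \<Longrightarrow> pure i (\<Theta>1 i a)" "\<And>i a. inF F i a \<Longrightarrow> pure i (\<Theta>2 i a)"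
    and inj0: "\<And>i a. inF F i a \<Longrightarrow> \<Theta>1 i a = (\<lambda>_. 0) \<Longrightarrow> \<Theta>2 i a = (\<lambda>_. 0) \<Longrightarrow> a = (\<lambda>_. 0)"
    and d: "\<And>i a. inF F (Suc i) a \<Longrightarrow> \<Theta>1 i (dd F (Suc i) a) = dK (\<Theta>1 (Suc i) a)"
      "\<And>i a. inF F (Suc i) a \<Longrightarrow> \<Theta>2 i (dd F (Suc i) a) = dK (\<Theta>2 (Suc i) a)"
    and one: "\<exists>e. inF F 0 e \<and> \<Theta>1 0 e = oneK \<and> \<Theta>2 0 e = oneK"
    and mult: "\<And>i j a b. inF F i a \<Longrightarrow> inF F j b \<Longrightarrow> \<exists>z. inF F (i + j) z \<and>
       \<Theta>1 (i + j) z = wedge (\<Theta>1 i a) (\<Theta>1 j b) \<and> \<Theta>2 (i + j) z = wedge (\<Theta>2 i a) (\<Theta>2 j b)"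
  shows "admits_dga_structure F"
proof -
  \<comment> \<open>Injectivity of the pair of maps makes this choice unique, and each axiom is
    checked after applying both maps.\<close>
  define mu where "mu i j a b = (SOME z. inF F (i + j) z \<and>
       \<Theta>1 (i + j) z = wedge (\<Theta>1 i a) (\<Theta>1 j b) \<and> \<Theta>2 (i + j) z = wedge (\<Theta>2 i a) (\<Theta>2 j b))" for i j a b
  have mu: "inF F (i + j) (mu i j a b) \<and> \<Theta>1 (i + j) (mu i j a b) = wedge (\<Theta>1 i a) (\<Theta>1 j b) \<and>
      \<Theta>2 (i + j) (mu i j a b) = wedge (\<Theta>2 i a) (\<Theta>2 j b)" if "inF F i a" "inF F j b" for i j a b
    using someI_ex[OF mult[OF that]] unfolding mu_def .
  note mu_in = mu[THEN conjunct1] and mu1 = mu[THEN conjunct2, THEN conjunct1]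
    and mu2 = mu[THEN conjunct2, THEN conjunct2]
  have inj: "a = b" if "inF F i a" "inF F i b" "\<Theta>1 i a = \<Theta>1 i b" "\<Theta>2 i a = \<Theta>2 i b" for i a b
  proof -
    have "(\<lambda>r. a r - b r) = (\<lambda>_. 0)"
      by (rule inj0[of i]) (use that in \<open>simp_all add: qlinear_diff[OF lin(1)] qlinear_diff[OF lin(2)] inF_def\<close>)
    then show ?thesis by (auto simp: fun_eq_iff)
  qed
  have inA: "inF F i a \<Longrightarrow> inF F i b \<Longrightarrow> inF F i (\<lambda>r. a r + b r)" for i a b by (simp add: inF_def)
  have inS: "inF F i a \<Longrightarrow> inF F i (\<lambda>r. q * a r)" for i a q by (simp add: inF_def)
  have in0: "inF F i (\<lambda>_. 0)" for i by (simp add: inF_def)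
  note L = qlinear_add[OF lin(1)] qlinear_add[OF lin(2)] qlinear_scale[OF lin(1)] qlinear_scale[OF lin(2)]
  note W = wedge_add_left wedge_add_right wedge_scale_left wedge_scale_right
  have z1: "\<Theta>1 i (\<lambda>_. 0) = (\<lambda>_. 0)" and z2: "\<Theta>2 i (\<lambda>_. 0) = (\<lambda>_. 0)" for i
    by (rule qlinear_zero[OF lin(1)], rule qlinear_zero[OF lin(2)])
  have w0: "wedge (\<lambda>_. 0) a = (\<lambda>_. 0)" "wedge a (\<lambda>_. 0) = (\<lambda>_. 0)" for a
    by (simp_all add: wedge_def fun_eq_iff)
  have mz: "mu i j a b = (\<lambda>_. 0)" if "inF F i a" "inF F j b" "a = (\<lambda>_. 0) \<or> b = (\<lambda>_. 0)" for i j a b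
    by (rule inj0[OF mu_in[OF that(1,2)]]) (use that(3) in \<open>auto simp: mu1[OF that(1,2)] mu2[OF that(1,2)] z1 z2 w0\<close>)
  have ddin: "inF F (i - 1) (dd F i a)" for i a by (rule inF_dd)
  \<comment> \<open>For \<open>i = 0\<close> the index \<open>i - 1\<close> is 0 again, so this case
    is separate: there both \<open>dd F 0\<close> and \<open>dK\<close> give zero.\<close>
  have dleft: "inF F (i + j - 1) (mu (i - 1) j (dd F i a) b) \<and>
      \<Theta>1 (i + j - 1) (mu (i - 1) j (dd F i a) b) = wedge (dK (\<Theta>1 i a)) (\<Theta>1 j b) \<and>
      \<Theta>2 (i + j - 1) (mu (i - 1) j (dd F i a) b) = wedge (dK (\<Theta>2 i a)) (\<Theta>2 j b)"
    if a: "inF F i a" and b: "inF F j b" for i j a b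
  proof (cases i)
    case 0
    have "dd F 0 a = (\<lambda>_. 0)" by (simp add: dd_def)
    then have "mu (i - 1) j (dd F i a) b = (\<lambda>_. 0)" using 0 mz[OF in0 b] by simp
    moreover have "dK (\<Theta>1 i a) = (\<lambda>_. 0)" "dK (\<Theta>2 i a) = (\<lambda>_. 0)" using pu[OF a] 0 dK_pure_0 by auto
    ultimately show ?thesis by (simp add: in0 z1 z2 w0)
  next
    case (Suc m)
    have "inF F m (dd F (Suc m) a)" using ddin[of "Suc m" a] by simp
    from mu[OF this b] show ?thesis using d[of m a] a Suc by simp
  qed
  have dright: "inF F (i + j - 1) (mu i (j - 1) a (dd F j b)) \<and>
      \<Theta>1 (i + j - 1) (mu i (j - 1) a (dd F j b)) = wedge (\<Theta>1 i a) (dK (\<Theta>1 j b)) \<and>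
      \<Theta>2 (i + j - 1) (mu i (j - 1) a (dd F j b)) = wedge (\<Theta>2 i a) (dK (\<Theta>2 j b))"
    if a: "inF F i a" and b: "inF F j b" for i j a b
  proof (cases j)
    case 0
    have "dd F 0 b = (\<lambda>_. 0)" by (simp add: dd_def)
    then have "mu i (j - 1) a (dd F j b) = (\<lambda>_. 0)" using 0 mz[OF a in0] by simp
    moreover have "dK (\<Theta>1 j b) = (\<lambda>_. 0)" "dK (\<Theta>2 j b) = (\<lambda>_. 0)" using pu[OF b] 0 dK_pure_0 by auto
    ultimately show ?thesis by (simp add: in0 z1 z2 w0)
  next
    case (Suc m)
    have "inF F m (dd F (Suc m) b)" using ddin[of "Suc m" b] by simp
    from mu[OF a this] show ?thesis using d[of m b] b Suc by simp
  qed
  have "is_dga_structure F mu"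
    unfolding is_dga_structure_def
  proof (intro conjI allI impI)
    fix i j a b assume a: "inF F i a" and b: "inF F j b"
    show "inF F (i + j) (mu i j a b)" by (rule mu_in[OF a b])
    show "mu i j (\<lambda>r. a r + a' r) b = (\<lambda>r. mu i j a b r + mu i j a' b r)" if a': "inF F i a'" for a'
      by (rule inj[of "i + j"]) (simp_all add: mu_in mu1 mu2 inA a b a' L W)
    show "mu i j a (\<lambda>r. b r + b' r) = (\<lambda>r. mu i j a b r + mu i j a b' r)" if b': "inF F j b'" for b'
      by (rule inj[of "i + j"]) (simp_all add: mu_in mu1 mu2 inA a b b' L W)
    show "mu i j (\<lambda>r. q * a r) b = (\<lambda>r. q * mu i j a b r)" for q
      by (rule inj[of "i + j"]) (simp_all add: mu_in mu1 mu2 inS a b L W)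
    show "mu i j a (\<lambda>r. q * b r) = (\<lambda>r. q * mu i j a b r)" for q
      by (rule inj[of "i + j"]) (simp_all add: mu_in mu1 mu2 inS a b L W)
    show "mu i j a b = (\<lambda>r. (-1) ^ (i * j) * mu j i b a r)"
    proof (rule inj[of "i + j"])
      have m: "inF F (i + j) (mu j i b a)" using mu_in[OF b a] by (simp add: add.commute)
      have t: "\<Theta>1 (i + j) (mu j i b a) = wedge (\<Theta>1 j b) (\<Theta>1 i a)" "\<Theta>2 (i + j) (mu j i b a) = wedge (\<Theta>2 j b) (\<Theta>2 i a)"
        using mu1[OF b a] mu2[OF b a] by (simp_all add: add.commute)
      show "inF F (i + j) (mu i j a b)" by (rule mu_in[OF a b])
      show "inF F (i + j) (\<lambda>r. (-1) ^ (i * j) * mu j i b a r)" by (rule inS[OF m])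
      show "\<Theta>1 (i + j) (mu i j a b) = \<Theta>1 (i + j) (\<lambda>r. (-1) ^ (i * j) * mu j i b a r)"
        unfolding L t mu1[OF a b] by (rule wedge_commute[OF pu(1)[OF a] pu(1)[OF b]])
      show "\<Theta>2 (i + j) (mu i j a b) = \<Theta>2 (i + j) (\<lambda>r. (-1) ^ (i * j) * mu j i b a r)"
        unfolding L t mu2[OF a b] by (rule wedge_commute[OF pu(2)[OF a] pu(2)[OF b]])
    qed
    show "dd F (i + j) (mu i j a b) =
          (\<lambda>r. mu (i - 1) j (dd F i a) b r + (-1) ^ i * mu i (j - 1) a (dd F j b) r)"
    proof (rule inj[of "i + j - 1"])
      let ?l = "mu (i - 1) j (dd F i a) b" and ?r = "mu i (j - 1) a (dd F j b)"
      note l = dleft[OF a b] and r = dright[OF a b]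
      show "inF F (i + j - 1) (dd F (i + j) (mu i j a b))" by (rule ddin)
      show "inF F (i + j - 1) (\<lambda>s. ?l s + (-1) ^ i * ?r s)" using l r by (intro inA inS) auto
      have "\<Theta>1 (i + j - 1) (dd F (i + j) (mu i j a b)) = dK (wedge (\<Theta>1 i a) (\<Theta>1 j b)) \<and>
        \<Theta>2 (i + j - 1) (dd F (i + j) (mu i j a b)) = dK (wedge (\<Theta>2 i a) (\<Theta>2 j b))"
      proof (cases "i + j")
        case 0
        then have "dd F (i + j) (mu i j a b) = (\<lambda>_. 0)" by (simp add: dd_def)
        moreover have "pure 0 (wedge (\<Theta>1 i a) (\<Theta>1 j b))" "pure 0 (wedge (\<Theta>2 i a) (\<Theta>2 j b))"
          using pure_wedge[OF pu(1)[OF a] pu(1)[OF b]] pure_wedge[OF pu(2)[OF a] pu(2)[OF b]] 0 by simp_all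
        ultimately show ?thesis by (simp add: dK_pure_0 z1 z2)
      next
        case (Suc m)
        have "inF F (Suc m) (mu i j a b)" using mu_in[OF a b] Suc by simp
        from d(1)[OF this] d(2)[OF this] show ?thesis
          using mu1[OF a b] mu2[OF a b] Suc by simp
      qed
      then have dm: "\<Theta>1 (i + j - 1) (dd F (i + j) (mu i j a b)) = dK (wedge (\<Theta>1 i a) (\<Theta>1 j b))"
        "\<Theta>2 (i + j - 1) (dd F (i + j) (mu i j a b)) = dK (wedge (\<Theta>2 i a) (\<Theta>2 j b))" by blast+
      show "\<Theta>1 (i + j - 1) (dd F (i + j) (mu i j a b)) = \<Theta>1 (i + j - 1) (\<lambda>s. ?l s + (-1) ^ i * ?r s)"
        unfolding dm dK_wedge[OF pu(1)[OF a]] L using l r by simp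
      show "\<Theta>2 (i + j - 1) (dd F (i + j) (mu i j a b)) = \<Theta>2 (i + j - 1) (\<lambda>s. ?l s + (-1) ^ i * ?r s)"
        unfolding dm dK_wedge[OF pu(2)[OF a]] L using l r by simp
    qed
  next
    obtain e where e: "inF F 0 e" "\<Theta>1 0 e = oneK" "\<Theta>2 0 e = oneK" using one by blast
    have "mu 0 i e a = a \<and> mu i 0 a e = a" if a: "inF F i a" for i a
    proof
      show "mu 0 i e a = a"
        using mu[OF e(1) a] a by (intro inj[of i]) (simp_all add: e wedge_oneK_left)
      show "mu i 0 a e = a"
        using mu[OF a e(1)] a by (intro inj[of i]) (simp_all add: e wedge_oneK_right)
    qed
    then show "\<exists>u. inF F 0 u \<and> (\<forall>i a. inF F i a \<longrightarrow> mu 0 i u a = a \<and> mu i 0 a u = a)"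
      using e(1) by blast
  next
    fix i j k a b q assume a: "inF F i a" and b: "inF F j b" and q: "inF F k q"
    show "mu (i + j) k (mu i j a b) q = mu i (j + k) a (mu j k b q)"
    proof (rule inj[of "i + j + k"])
      note ab = mu_in[OF a b] and bq = mu_in[OF b q]
      show "inF F (i + j + k) (mu (i + j) k (mu i j a b) q)" by (rule mu_in[OF ab q])
      show "inF F (i + j + k) (mu i (j + k) a (mu j k b q))" using mu_in[OF a bq] by (simp add: add.assoc)
      have t: "\<Theta>1 (i + j + k) (mu i (j + k) a (mu j k b q)) = wedge (\<Theta>1 i a) (wedge (\<Theta>1 j b) (\<Theta>1 k q))"
        "\<Theta>2 (i + j + k) (mu i (j + k) a (mu j k b q)) = wedge (\<Theta>2 i a) (wedge (\<Theta>2 j b) (\<Theta>2 k q))"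
        using mu1[OF a bq] mu2[OF a bq] mu1[OF b q] mu2[OF b q] by (simp_all add: add.assoc)
      show "\<Theta>1 (i + j + k) (mu (i + j) k (mu i j a b) q) = \<Theta>1 (i + j + k) (mu i (j + k) a (mu j k b q))"
        unfolding t mu1[OF ab q] mu1[OF a b] by (rule wedge_assoc)
      show "\<Theta>2 (i + j + k) (mu (i + j) k (mu i j a b) q) = \<Theta>2 (i + j + k) (mu i (j + k) a (mu j k b q))"
        unfolding t mu2[OF ab q] mu2[OF a b] by (rule wedge_assoc)
    qed
  next
    fix i a assume i: "odd i" and a: "inF F i a"
    show "mu i i a a = (\<lambda>_. 0)"
      by (rule inj0[OF mu_in[OF a a]])
         (simp_all add: mu1[OF a a] mu2[OF a a] wedge_odd_square[OF pu(1)[OF a] i] wedge_odd_square[OF pu(2)[OF a] i])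
  qed
  then show ?thesis unfolding admits_dga_structure_def by blast
qed

end

lemma qlinear_plus: "qlinear D \<Longrightarrow> qlinear D' \<Longrightarrow> qlinear (\<lambda>v r. D v r + D' v r)"
  by (simp add: qlinear_def fun_eq_iff algebra_simps)

lemma qlinear_minus: "qlinear D \<Longrightarrow> qlinear D' \<Longrightarrow> qlinear (\<lambda>v r. D v r - D' v r)"
  by (simp add: qlinear_def fun_eq_iff algebra_simps)

lemma qlinear_neg: "qlinear D \<Longrightarrow> qlinear (\<lambda>v r. - D v r)"
  by (simp add: qlinear_def fun_eq_iff)

lemma qlinear_mult: "qlinear D \<Longrightarrow> qlinear (\<lambda>v r. p * D v r)"
  by (simp add: qlinear_def fun_eq_iff algebra_simps)

section \<open>The minimal resolution for trees of diameter at most four\<close>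

text \<open>The free module with labels \<open>(0, A)\<close>, \<open>(1, B)\<close>, \<open>(2, A)\<close> glues the Taylor resolution of the edges
  \<open>{par a, a}\<close>, the Koszul complex on \<open>Y\<close> (shifted by the multidegree \<open>c\<close>) and the cone of
  multiplication by \<open>c\<close>, which identifies \<open>c\<close> times a Taylor generator with its image under \<open>Phi\<close>.\<close>

definition part :: "nat \<Rightarrow> (nat \<times> 'v set \<Rightarrow> 'q) \<Rightarrow> 'v set \<Rightarrow> 'q" where
  "part i v = (\<lambda>A. v (i, A))"

definition glue :: "('v set \<Rightarrow> 'q) \<Rightarrow> ('v set \<Rightarrow> 'q) \<Rightarrow> ('v set \<Rightarrow> 'q) \<Rightarrow> nat \<times> 'v set \<Rightarrow> 'q::zero" where
  "glue t k s = (\<lambda>(i, A). if i = 0 then t A else if i = 1 then k A else if i = 2 then s A else 0)"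

definition pr0 :: "('v set \<Rightarrow> 'q) \<Rightarrow> 'v set \<Rightarrow> 'q::zero" where
  "pr0 a = (\<lambda>S. if S = {} then a S else 0)"

definition ne :: "('v set \<Rightarrow> 'q) \<Rightarrow> 'v set \<Rightarrow> 'q::zero" where
  "ne a = (\<lambda>S. if S = {} then 0 else a S)"

lemma part_glue [simp]: "part 0 (glue t k s) = t" "part 1 (glue t k s) = k" "part (Suc 0) (glue t k s) = k"
    "part 2 (glue t k s) = s"
  by (simp_all add: part_def glue_def)

lemma glue_part: "(\<And>i A. i > 2 \<Longrightarrow> v (i, A) = 0) \<Longrightarrow> glue (part 0 v) (part 1 v) (part 2 v) = v"
  by (auto simp: glue_def part_def fun_eq_iff)

lemma qlinear_part: "qlinear (part i)"
  by (simp add: qlinear_def part_def)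

lemma qlinear_pr0: "qlinear pr0"
  by (simp add: qlinear_def pr0_def fun_eq_iff)

lemma qlinear_ne: "qlinear ne"
  by (simp add: qlinear_def ne_def fun_eq_iff)

lemma qlinear_glue:
  "qlinear D0 \<Longrightarrow> qlinear D1 \<Longrightarrow> qlinear D2 \<Longrightarrow> qlinear (\<lambda>v. glue (D0 v) (D1 v) (D2 v))"
  by (auto simp: qlinear_def glue_def fun_eq_iff)

context star_tree
begin

declare One_nat_def [simp del]

text \<open>The full cone would also contain \<open>(1, {})\<close> in degree 0 and
  \<open>(2, {})\<close> in degree 1, joined by a unit entry of the differential. Cancelling this
  pair makes the resolution minimal.\<close>

definition labels :: "nat \<Rightarrow> (nat \<times> 'v set) set" where
  "labels n = {(0, A) | A. A \<subseteq> X \<and> card A = n} \<union> {(1, B) | B. B \<subseteq> Y \<and> B \<noteq> {} \<and> card B = n}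
     \<union> {(2, A) | A. A \<subseteq> X \<and> A \<noteq> {} \<and> Suc (card A) = n}"

text \<open>The coordinate at the cancelled label \<open>(2, {})\<close> is restored as the value
  forced by the vanishing of the coordinate at \<open>(1, {})\<close>.\<close>

definition st :: "(nat \<times> 'v set \<Rightarrow> ('v, 'k) mpoly) \<Rightarrow> 'v set \<Rightarrow> ('v, 'k) mpoly" where
  "st v = (\<lambda>A. part 2 v A + pr0 (dK (part 1 v)) A)"

text \<open>Comparison with the Taylor algebra extended by an exterior variable for
  \<open>c\<close>, realised inside the Koszul algebra.\<close>

definition J1 :: "(nat \<times> 'v set \<Rightarrow> ('v, 'k) mpoly) \<Rightarrow> 'v set \<Rightarrow> ('v, 'k) mpoly" where
  "J1 v = (\<lambda>S. hat (part 0 v) S + wedge (gen c) (hat (st v)) S)"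

text \<open>Comparison with the Koszul algebra on \<open>Y\<close>. The factor \<open>var c\<close>
  appears because generators with label 1 lift the edges through \<open>c\<close>, whereas the
  Koszul generators lift the elements of \<open>Y\<close>.\<close>

definition J2 :: "(nat \<times> 'v set \<Rightarrow> ('v, 'k) mpoly) \<Rightarrow> 'v set \<Rightarrow> ('v, 'k) mpoly" where
  "J2 v = (\<lambda>S. Phi (part 0 v) S + var c * part 1 v S)"

definition dG :: "(nat \<times> 'v set \<Rightarrow> ('v, 'k) mpoly) \<Rightarrow> nat \<times> 'v set \<Rightarrow> ('v, 'k) mpoly" where
  "dG v = glue (\<lambda>A. bd (part 0 v) A + var c * st v A)
     (ne (\<lambda>B. dK (part 1 v) B - Phi (part 2 v) B)) (ne (\<lambda>A. - bd (part 2 v) A))"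

lemma qlinear_wedge_right: "qlinear (wedge a)"
  by (simp add: qlinear_def wedge_add_right wedge_scale_right)

lemma qlinear_st: "qlinear st"
  unfolding st_def
  by (intro qlinear_plus qlinear_part qlinear_comp[OF qlinear_comp[OF qlinear_part qlinear_dK] qlinear_pr0])

lemma qlinear_J1: "qlinear J1"
  unfolding J1_def
  by (intro qlinear_plus qlinear_comp[OF qlinear_part qlinear_hat]
      qlinear_comp[OF qlinear_comp[OF qlinear_st qlinear_hat] qlinear_wedge_right])

lemma qlinear_J2: "qlinear J2"
  unfolding J2_def by (intro qlinear_plus qlinear_mult qlinear_part qlinear_comp[OF qlinear_part qlinear_Phi])

lemma qlinear_dG: "qlinear dG"
  unfolding dG_def
  by (intro qlinear_glue qlinear_plus qlinear_mult qlinear_st qlinear_comp[OF qlinear_part qlinear_bd]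
     qlinear_comp[OF qlinear_minus[OF qlinear_comp[OF qlinear_part qlinear_dK] qlinear_comp[OF qlinear_part qlinear_Phi]] qlinear_ne]
     qlinear_comp[OF qlinear_neg[OF qlinear_comp[OF qlinear_part qlinear_bd]] qlinear_ne])

lemma finite_labels: "finite (labels n)"
proof (rule finite_subset)
  show "labels n \<subseteq> {0, 1, 2} \<times> UNIV" by (auto simp: labels_def)
qed simp

lemma labels_0: "labels 0 = {(0, {})}"
  by (auto simp: labels_def)

lemma vec_labels_0:
  fixes v :: "nat \<times> 'v set \<Rightarrow> ('v, 'k) mpoly"
  shows "vec (labels 0) v \<Longrightarrow> v = (\<lambda>b. v (0, {}) * unitv (0, {}) b)"
  by (auto simp: labels_0 vec_def unitv_def fun_eq_iff)

lemma vec_labels_Suc: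
  "vec (labels (Suc m)) v \<longleftrightarrow> supp X (Suc m) (part 0 v) \<and> supp Y (Suc m) (part 1 v) \<and>
     supp X m (part 2 v) \<and> part 2 v {} = 0 \<and> (\<forall>i A. i > 2 \<longrightarrow> v (i, A) = 0)" (is "?L \<longleftrightarrow> ?R")
proof
  assume L: ?L
  have z: "b \<in> labels (Suc m)" if "v b \<noteq> 0" for b using L that unfolding vec_def by blast
  show ?R
  proof (intro conjI allI impI)
    show "supp X (Suc m) (part 0 v)" using z[of "(0, _)"] by (auto simp: supp_def part_def labels_def)
    show "supp Y (Suc m) (part 1 v)" using z[of "(1, _)"] by (auto simp: supp_def part_def labels_def)
    show "supp X m (part 2 v)" using z[of "(2, _)"] by (auto simp: supp_def part_def labels_def)
    show "part 2 v {} = 0" using z[of "(2, {})"] by (auto simp: part_def labels_def)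
    show "v (i, A) = 0" if "i > 2" for i A using z[of "(i, A)"] that by (auto simp: labels_def)
  qed
next
  assume R: ?R
  have "b \<in> labels (Suc m)" if nz: "v b \<noteq> 0" for b
  proof -
    obtain i A where b: "b = (i, A)" by (cases b)
    have "\<not> i > 2" using R nz b by auto
    then consider "i = 0" | "i = 1" | "i = 2" by linarith
    then show ?thesis
    proof cases
      case 1
      then show ?thesis using R nz b by (auto simp: supp_def part_def labels_def)
    next
      case 2
      then have "A \<subseteq> Y \<and> card A = Suc m" using R nz b by (auto simp: supp_def part_def)
      then show ?thesis using 2 b by (auto simp: labels_def)
    next
      case 3
      then have "A \<subseteq> X \<and> card A = m" "A \<noteq> {}" using R nz b by (auto simp: supp_def part_def)
      then show ?thesis using 3 b by (auto simp: labels_def)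
    qed
  qed
  then show ?L unfolding vec_def by blast
qed

lemma vec_labels_glue:
  assumes "supp X (Suc m) t" "supp Y (Suc m) k" "supp X m s" "s {} = 0"
  shows "vec (labels (Suc m)) (glue t k s)"
  using assms by (simp add: vec_labels_Suc) (simp add: glue_def)

lemma supp_pr0: "supp Z n a \<Longrightarrow> n = 0 \<or> pr0 a = (\<lambda>_. 0)"
  by (auto simp: supp_def pr0_def fun_eq_iff)

lemma supp_st:
  assumes "vec (labels (Suc m)) v"
  shows "supp X m (st v)"
proof -
  have "supp X m (part 2 v)" using assms by (simp add: vec_labels_Suc)
  moreover have "supp Y m (dK (part 1 v))" using assms by (intro supp_dK) (simp add: vec_labels_Suc)
  then have "supp X m (pr0 (dK (part 1 v)))" by (auto simp: supp_def pr0_def)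
  ultimately show ?thesis unfolding st_def by (rule supp_add)
qed

lemma pr0_hom: "supp X 0 (pr0 a)"
  by (auto simp: supp_def pr0_def)

lemma bd_pr0: "bd (pr0 a) = (\<lambda>_. 0)"
  by (rule bd_supp0[OF pr0_hom])

lemma transv_empty: "transv {} = {{}}"
  by (auto simp: transv_def)

lemma Phi_empty: "Phi u {} = u {}"
  by (simp add: Phi_def transv_empty xm_def)

lemma Phi_pr0: "Phi (pr0 a) = pr0 a"
proof
  fix B
  have "Phi (pr0 a) B = (\<Sum>A\<in>transv B. if A = {} then a {} else 0)"
    unfolding Phi_def by (intro sum.cong) (auto simp: pr0_def xm_def)
  then show "Phi (pr0 a) B = pr0 a B" by (auto simp: pr0_def transv_def)
qed

lemma dK_empty: "dK a {} = (\<Sum>v\<in>UNIV. var v * a {v})"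
  by (simp add: dK_var contr_def)

lemma J1_dG:
  assumes v: "vec (labels (Suc m)) v"
  shows "J1 (dG v) = dK (J1 v)"
proof -
  let ?t = "part 0 v" and ?k = "part 1 v" and ?s = "part 2 v"
  have V: "supp X (Suc m) ?t" "supp Y (Suc m) ?k" "supp X m ?s" "?s {} = 0"
    using v by (simp_all add: vec_labels_Suc)
  have bst: "bd (st v) = bd ?s"
    unfolding st_def by (simp add: qlinear_add[OF qlinear_bd] bd_pr0)
  \<comment> \<open>At the cancelled label, \<open>dK_dK\<close> and \<open>dK_Phi\<close> show that
    the restored coordinate is the one \<open>- bd\<close> would have there.\<close>
  have P: "pr0 (dK (ne (\<lambda>B. dK ?k B - Phi ?s B))) = pr0 (\<lambda>A. - bd ?s A)"
  proof -
    have "dK (ne (\<lambda>B. dK ?k B - Phi ?s B)) {} = dK (\<lambda>B. dK ?k B - Phi ?s B) {}"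
      by (simp add: dK_empty ne_def)
    also have "\<dots> = dK (dK ?k) {} - dK (Phi ?s) {}"
      unfolding qlinear_diff[OF qlinear_dK] ..
    also have "\<dots> = - bd ?s {}" unfolding dK_dK dK_Phi[OF V(3)] Phi_empty by simp
    finally show ?thesis by (simp add: pr0_def fun_eq_iff)
  qed
  have "st (dG v) = (\<lambda>A. ne (\<lambda>A. - bd ?s A) A + pr0 (\<lambda>A. - bd ?s A) A)"
    unfolding P[symmetric] st_def[of "dG v"] by (simp add: dG_def)
  also have "\<dots> = (\<lambda>A. - bd (st v) A)"
    unfolding bst by (simp add: ne_def pr0_def fun_eq_iff)
  finally have "st (dG v) = (\<lambda>A. - bd (st v) A)" .
  then have "J1 (dG v) = (\<lambda>S. hat (bd ?t) S + var c * hat (st v) S - wedge (gen c) (hat (bd (st v))) S)"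
    unfolding J1_def by (simp add: dG_def qlinear_add[OF qlinear_hat] qlinear_scale[OF qlinear_hat]
      qlinear_uminus[OF qlinear_hat] qlinear_uminus[OF qlinear_wedge_right])
  moreover have "dK (wedge (gen c) (hat (st v))) = (\<lambda>S. var c * hat (st v) S - wedge (gen c) (hat (bd (st v))) S)"
    unfolding dK_wedge[OF pure_gen] dK_gen dK_hat[OF supp_st[OF v]] wedge_scale_left wedge_oneK_left by simp
  ultimately show ?thesis
    unfolding J1_def[of v] dK_add dK_hat[OF V(1)] by (simp add: fun_eq_iff)
qed

lemma J2_dG:
  assumes v: "vec (labels (Suc m)) v"
  shows "J2 (dG v) = dK (J2 v)"
proof -
  let ?t = "part 0 v" and ?k = "part 1 v" and ?s = "part 2 v"
  have V: "supp X (Suc m) ?t" "supp Y (Suc m) ?k" "supp X m ?s" "?s {} = 0"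
    using v by (simp_all add: vec_labels_Suc)
  have P: "Phi (st v) = (\<lambda>B. Phi ?s B + pr0 (dK ?k) B)"
    unfolding st_def by (simp add: qlinear_add[OF qlinear_Phi] Phi_pr0)
  \<comment> \<open>Away from the empty set the cone term cancels \<open>Phi ?s\<close>; at the
    empty set \<open>pr0\<close> supplies the coordinate that \<open>ne\<close> drops.\<close>
  have e: "Phi ?s B + pr0 (dK ?k) B + ne (\<lambda>B. dK ?k B - Phi ?s B) B = dK ?k B" for B
    by (simp add: pr0_def ne_def Phi_empty V(4))
  have "J2 (dG v) = (\<lambda>S. Phi (bd ?t) S + var c * (Phi ?s S + pr0 (dK ?k) S + ne (\<lambda>B. dK ?k B - Phi ?s B) S))"
    unfolding J2_def by (simp add: dG_def qlinear_add[OF qlinear_Phi] qlinear_scale[OF qlinear_Phi] P distrib_left add.assoc)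
  also have "\<dots> = (\<lambda>S. Phi (bd ?t) S + var c * dK ?k S)" unfolding e ..
  also have "\<dots> = dK (J2 v)" unfolding J2_def dK_add dK_scale dK_Phi[OF V(1)] ..
  finally show ?thesis .
qed

lemma vec_dG:
  assumes v: "vec (labels (Suc m)) v"
  shows "vec (labels m) (dG v)"
proof -
  let ?t = "part 0 v" and ?k = "part 1 v" and ?s = "part 2 v"
  have V: "supp X (Suc m) ?t" "supp Y (Suc m) ?k" "supp X m ?s" "?s {} = 0"
    using v by (simp_all add: vec_labels_Suc)
  have t: "supp X m (\<lambda>A. bd ?t A + var c * st v A)"
    by (intro supp_add supp_scale supp_bd V supp_st[OF v])
  have k: "supp Y m (\<lambda>B. dK ?k B - Phi ?s B)" by (intro supp_diff supp_dK supp_Phi V)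
  show ?thesis
  proof (cases m)
    case 0
    have "ne (\<lambda>B. dK ?k B - Phi ?s B) = (\<lambda>_. 0)" using k 0 by (auto simp: ne_def supp_def fun_eq_iff)
    moreover have "ne (\<lambda>A. - bd ?s A) = (\<lambda>_. 0)" using bd_supp0 V(3) 0 by (simp add: ne_def fun_eq_iff)
    ultimately show ?thesis
      using t 0 by (auto simp: dG_def labels_0 vec_def glue_def supp_def)
  next
    case (Suc n)
    have "supp X n (\<lambda>A. - bd ?s A)" using V(3) Suc by (intro supp_uminus supp_bd) simp
    then show ?thesis
      unfolding Suc dG_def using t k Suc
      by (intro vec_labels_glue) (auto simp: supp_def ne_def)
  qed
qed

lemma vec_labels_supp:
  assumes "vec (labels n) v"
  shows "part 0 v A \<noteq> 0 \<Longrightarrow> A \<subseteq> X" "part 2 v A \<noteq> 0 \<Longrightarrow> A \<subseteq> X"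
    "i > 2 \<Longrightarrow> v (i, A) = 0"
proof -
  have z: "b \<in> labels n" if "v b \<noteq> 0" for b using assms that unfolding vec_def by blast
  show "part 0 v A \<noteq> 0 \<Longrightarrow> A \<subseteq> X" using z[of "(0, A)"] by (auto simp: part_def labels_def)
  show "part 2 v A \<noteq> 0 \<Longrightarrow> A \<subseteq> X" using z[of "(2, A)"] by (auto simp: part_def labels_def)
  show "i > 2 \<Longrightarrow> v (i, A) = 0" using z[of "(i, A)"] by (auto simp: labels_def)
qed

lemma hat_eq_0: "hat u A = 0 \<longleftrightarrow> u A = 0"
  using prod_var_cancel[of "par ` A" "u A" 0] by (simp add: hat_def w_def)

text \<open>Coordinates are read off in the order 0, 1, 2: from the subsets of \<open>X\<close> in
  \<open>J1\<close>, then from \<open>J2\<close> by cancelling \<open>var c\<close>, then from the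
  sets containing \<open>c\<close> in \<open>J1\<close>.\<close>

lemma J_inj:
  assumes v: "vec (labels n) v" and J: "J1 v = (\<lambda>_. 0)" "J2 v = (\<lambda>_. 0)"
  shows "v = (\<lambda>_. 0)"
proof -
  have t0: "part 0 v A = 0" for A
  proof (cases "A \<subseteq> X")
    case True
    then have "c \<notin> A" using c by auto
    then have "J1 v A = hat (part 0 v) A" by (simp add: J1_def wedge_gen)
    then show ?thesis using J(1) by (simp add: hat_eq_0)
  qed (use vec_labels_supp(1)[OF v] in blast)
  then have t: "part 0 v = (\<lambda>_. 0)" by (rule ext)
  have k0: "part 1 v A = 0" for A
    using fun_cong[OF J(2), of A] by (simp add: J2_def t qlinear_zero[OF qlinear_Phi] var_mult_eq_0)
  then have k: "part 1 v = (\<lambda>_. 0)" by (rule ext)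
  have stv: "st v = part 2 v"
    by (simp add: st_def k qlinear_zero[OF qlinear_dK] pr0_def)
  have s0: "part 2 v A = 0" for A
  proof (cases "A \<subseteq> X")
    case True
    then have cA: "insert c A - {c} = A" using c by auto
    have "J1 v (insert c A) = sg {c} A * hat (part 2 v) A"
      unfolding J1_def t stv wedge_gen by (simp add: cA qlinear_zero[OF qlinear_hat])
    then have "sg {c} A * hat (part 2 v) A = 0" using J(1) by simp
    then have "sg {c} A * sg {c} A * hat (part 2 v) A = 0" by (simp only: mult.assoc) simp
    then show ?thesis by (simp add: hat_eq_0)
  qed (use vec_labels_supp(2)[OF v] in blast)
  show ?thesis
  proof
    fix b :: "nat \<times> 'v set"
    obtain i A where b: "b = (i, A)" by (cases b)
    consider "i = 0" | "i = 1" | "i = 2" | "i > 2" by linarith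
    then show "v b = 0"
      using t0 k0 s0 vec_labels_supp(3)[OF v] b by cases (auto simp: part_def)
  qed
qed

lemma J_unit: "J1 (unitv (0, {})) = oneK" "J2 (unitv (0, {})) = oneK"
proof -
  have p: "part 0 (unitv (0, {})) = (pr0 (\<lambda>_. 1) :: 'v set \<Rightarrow> ('v, 'k) mpoly)"
    "part 1 (unitv (0, {})) = (\<lambda>_. 0 :: ('v, 'k) mpoly)" "part 2 (unitv (0, {})) = (\<lambda>_. 0 :: ('v, 'k) mpoly)"
    by (auto simp: part_def unitv_def pr0_def fun_eq_iff)
  have st0: "st (unitv (0, {})) = (\<lambda>_. 0)"
    by (simp add: st_def p qlinear_zero[OF qlinear_dK] pr0_def)
  show "J1 (unitv (0, {})) = oneK"
    by (auto simp: J1_def st0 p qlinear_zero[OF qlinear_hat] qlinear_zero[OF qlinear_wedge_right]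
        hat_def w_def pr0_def oneK_def fun_eq_iff)
  show "J2 (unitv (0, {})) = oneK"
    unfolding J2_def p Phi_pr0 by (auto simp: pr0_def oneK_def fun_eq_iff)
qed

lemma pure_J:
  assumes v: "vec (labels n) v"
  shows "pure n (J1 v)" "pure n (J2 v)"
proof -
  have "pure n (J1 v) \<and> pure n (J2 v)"
  proof (cases n)
    case 0
    have "J1 v = (\<lambda>S. v (0, {}) * oneK S)" "J2 v = (\<lambda>S. v (0, {}) * oneK S)"
      using vec_labels_0[of v] v 0 J_unit qlinear_scale[OF qlinear_J1, of "v (0, {})" "unitv (0, {})"]
        qlinear_scale[OF qlinear_J2, of "v (0, {})" "unitv (0, {})"] by simp_all
    then show ?thesis using 0 by (auto simp: pure_def oneK_def)
  next
    case (Suc m)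
    have v': "vec (labels (Suc m)) v" using v Suc by simp
    have V: "supp X (Suc m) (part 0 v)" "supp Y (Suc m) (part 1 v)"
      using v' by (simp_all add: vec_labels_Suc)
    have "supp X m (hat (st v))" by (simp add: supp_hat supp_st[OF v'])
    then have "pure (1 + m) (wedge (gen c) (hat (st v)))"
      by (rule pure_wedge[OF pure_gen supp_pure])
    moreover have "supp X (Suc m) (hat (part 0 v))" by (simp add: supp_hat V)
    then have "pure (Suc m) (hat (part 0 v))" by (rule supp_pure)
    moreover have "pure (Suc m) (Phi (part 0 v))" by (rule supp_pure[OF supp_Phi[OF V(1)]])
    ultimately show ?thesis
      using supp_pure[OF V(2)] Suc unfolding J1_def J2_def pure_def
      by (metis add.commute add.right_neutral mult_zero_right plus_1_eq_Suc)
  qed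
  then show "pure n (J1 v)" "pure n (J2 v)" by auto
qed

lemma J_mult:
  assumes v: "vec (labels n) v" and v': "vec (labels m) v'"
  shows "\<exists>z. vec (labels (n + m)) z \<and> J1 z = wedge (J1 v) (J1 v') \<and> J2 z = wedge (J2 v) (J2 v')"
proof -
  consider "n = 0" | "m = 0" | n' m' where "n = Suc n'" "m = Suc m'" by (metis not0_implies_Suc)
  then show ?thesis
  proof cases
    case 1
    have "J1 v = (\<lambda>S. v (0, {}) * oneK S)" "J2 v = (\<lambda>S. v (0, {}) * oneK S)"
      using vec_labels_0[of v] v 1 J_unit qlinear_scale[OF qlinear_J1, of "v (0, {})" "unitv (0, {})"]
        qlinear_scale[OF qlinear_J2, of "v (0, {})" "unitv (0, {})"] by simp_all
    then show ?thesis
      using v' 1 by (intro exI[of _ "\<lambda>b. v (0, {}) * v' b"])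
        (simp add: vec_scale qlinear_scale[OF qlinear_J1] qlinear_scale[OF qlinear_J2] wedge_scale_left wedge_oneK_left)
  next
    case 2
    have "J1 v' = (\<lambda>S. v' (0, {}) * oneK S)" "J2 v' = (\<lambda>S. v' (0, {}) * oneK S)"
      using vec_labels_0[of v'] v' 2 J_unit qlinear_scale[OF qlinear_J1, of "v' (0, {})" "unitv (0, {})"]
        qlinear_scale[OF qlinear_J2, of "v' (0, {})" "unitv (0, {})"] by simp_all
    then show ?thesis
      using v 2 by (intro exI[of _ "\<lambda>b. v' (0, {}) * v b"])
        (simp add: vec_scale qlinear_scale[OF qlinear_J1] qlinear_scale[OF qlinear_J2] wedge_scale_right wedge_oneK_right)
  next
    case 3
    have w: "vec (labels (Suc n')) v" "vec (labels (Suc m')) v'" using v v' 3 by simp_all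
    let ?t = "part 0 v" and ?k = "part 1 v" and ?t' = "part 0 v'" and ?k' = "part 1 v'"
    have V: "supp X (Suc n') ?t" "supp Y (Suc n') ?k" "supp X (Suc m') ?t'" "supp Y (Suc m') ?k'"
      using w by (simp_all add: vec_labels_Suc)
    \<comment> \<open>\<open>S\<close> collects the terms with the exterior variable of
      \<open>c\<close> in the product of the \<open>J1\<close> images. \<open>Kz\<close> is the
      quotient by \<open>var c\<close> of what the product of the \<open>J2\<close> images has
      besides the product of the \<open>Phi\<close> images.\<close>
    define S where "S = (\<lambda>A. tp (st v) ?t' A + (-1) ^ Suc n' * tp ?t (st v') A)"
    define Kz where "Kz = (\<lambda>B. wedge ?k (Phi ?t') B + wedge (Phi ?t) ?k' B + var c * wedge ?k ?k' B)"
    have sS: "supp X (Suc (n' + m')) S"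
      unfolding S_def using supp_tp[OF supp_st[OF w(1)] V(3)] supp_tp[OF V(1) supp_st[OF w(2)]]
      by (intro supp_add supp_scale) simp_all
    have sK: "supp Y (Suc n' + Suc m') Kz"
      unfolding Kz_def by (intro supp_add supp_scale supp_wedge supp_Phi V)
    define z where "z = glue (tp ?t ?t') Kz S"
    have vz: "vec (labels (Suc (Suc (n' + m')))) z"
      unfolding z_def
      by (rule vec_labels_glue) (use supp_tp[OF V(1,3)] sK sS in \<open>auto simp: supp_def\<close>)
    \<comment> \<open>\<open>Kz\<close> has degree at least two, so its differential has no
      coordinate at the empty set and \<open>st z\<close> needs no restored coordinate.\<close>
    have "supp Y (Suc (n' + m')) (dK Kz)" using sK by (intro supp_dK) simp
    then have stz: "st z = S"
      using supp_pr0[of Y "Suc (n' + m')" "dK Kz"] by (simp add: st_def z_def)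
    have gg: "wedge (gen c) (gen c) = (\<lambda>_. 0)" by (rule wedge_odd_square[OF pure_gen]) simp
    have comm: "wedge (hat ?t) (gen c) = (\<lambda>S. (-1) ^ Suc n' * wedge (gen c) (hat ?t) S)"
      using wedge_commute[OF _ pure_gen, of "Suc n'" "hat ?t" c] V(1) by (simp add: supp_hat supp_pure)
    have comm': "wedge (hat (st v)) (gen c) = (\<lambda>S. (-1) ^ n' * wedge (gen c) (hat (st v)) S)"
      using wedge_commute[OF _ pure_gen, of n' "hat (st v)" c] supp_st[OF w(1)] by (simp add: supp_hat supp_pure)
    have z0: "wedge (\<lambda>_. 0) a = (\<lambda>_. 0)" "wedge a (\<lambda>_. 0) = (\<lambda>_. 0)" for a
      by (simp_all add: wedge_def fun_eq_iff)
    have A1: "wedge (hat ?t) (wedge (gen c) (hat (st v'))) = (\<lambda>S. (-1) ^ Suc n' * wedge (gen c) (wedge (hat ?t) (hat (st v'))) S)"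
      by (simp only: wedge_assoc[symmetric] comm wedge_scale_left)
    have A2: "wedge (wedge (gen c) (hat (st v))) (wedge (gen c) (hat (st v'))) = (\<lambda>_. 0)"
    proof -
      have "wedge (wedge (gen c) (hat (st v))) (wedge (gen c) (hat (st v')))
         = wedge (gen c) (wedge (wedge (hat (st v)) (gen c)) (hat (st v')))" by (simp only: wedge_assoc)
      also have "\<dots> = (\<lambda>S. (-1) ^ n' * wedge (wedge (gen c) (gen c)) (wedge (hat (st v)) (hat (st v'))) S)"
        by (simp only: comm' wedge_scale_left wedge_scale_right wedge_assoc)
      finally show ?thesis by (simp add: gg z0)
    qed
    have A3: "wedge (wedge (gen c) (hat (st v))) (hat ?t') = wedge (gen c) (wedge (hat (st v)) (hat ?t'))"
      by (rule wedge_assoc)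
    have hS: "hat S = (\<lambda>A. wedge (hat (st v)) (hat ?t') A + (-1) ^ Suc n' * wedge (hat ?t) (hat (st v')) A)"
      unfolding S_def qlinear_add[OF qlinear_hat] qlinear_scale[OF qlinear_hat] hat_tp ..
    have "wedge (J1 v) (J1 v') = (\<lambda>A. wedge (hat ?t) (hat ?t') A + wedge (hat ?t) (wedge (gen c) (hat (st v'))) A
        + (wedge (wedge (gen c) (hat (st v))) (hat ?t') A + wedge (wedge (gen c) (hat (st v))) (wedge (gen c) (hat (st v'))) A))"
      unfolding J1_def by (simp only: wedge_add_left wedge_add_right)
    also have "\<dots> = (\<lambda>A. hat (tp ?t ?t') A + wedge (gen c) (hat S) A)"
      unfolding A1 A2 A3 hS
      by (simp add: hat_tp qlinear_add[OF qlinear_wedge_right] qlinear_scale[OF qlinear_wedge_right]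
        qlinear_diff[OF qlinear_wedge_right] algebra_simps)
    also have "\<dots> = J1 z" unfolding J1_def stz by (simp add: z_def)
    finally have j1: "J1 z = wedge (J1 v) (J1 v')" ..
    have "wedge (J2 v) (J2 v') = (\<lambda>A. wedge (Phi ?t) (Phi ?t') A + var c * Kz A)"
      unfolding J2_def Kz_def
      by (simp only: wedge_add_left wedge_add_right wedge_scale_left wedge_scale_right) (simp add: algebra_simps)
    also have "\<dots> = J2 z" by (simp add: J2_def z_def Phi_tp)
    finally have "J2 z = wedge (J2 v) (J2 v')" ..
    then show ?thesis using j1 vz 3 by auto
  qed
qed

lemma parts_dG:
  "part 0 (dG v) = (\<lambda>A. bd (part 0 v) A + var c * st v A)"
  "part 1 (dG v) = ne (\<lambda>B. dK (part 1 v) B - Phi (part 2 v) B)"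
  "part 2 (dG v) = ne (\<lambda>A. - bd (part 2 v) A)"
  by (simp_all add: dG_def)

lemma dG_dG:
  assumes v: "vec (labels (Suc (Suc m))) v"
  shows "dG (dG v) = (\<lambda>_. 0)"
  using vec_dG[OF v] vec_dG[OF vec_dG[OF v]]
  by (intro J_inj) (simp_all add: J1_dG[OF v] J2_dG[OF v] J1_dG[OF vec_dG[OF v]] J2_dG[OF vec_dG[OF v]] dK_dK)

text \<open>The preimage is solved for in triangular order: \<open>s1\<close> with boundary
  \<open>st v\<close>, then \<open>t1\<close> for the Taylor coordinate corrected by
  \<open>var c * s1 A\<close>, then \<open>k1\<close> for the Koszul coordinate corrected by
  \<open>Phi s1\<close>.\<close>

lemma dG_exact:
  assumes v: "vec (labels (Suc m)) v" and z: "dG v = (\<lambda>_. 0)"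
  shows "\<exists>v'. vec (labels (Suc (Suc m))) v' \<and> dG v' = v"
proof -
  let ?t = "part 0 v" and ?k = "part 1 v" and ?s = "part 2 v"
  have V: "supp X (Suc m) ?t" "supp Y (Suc m) ?k" "supp X m ?s" "?s {} = 0"
      "\<And>i A. i > 2 \<Longrightarrow> v (i, A) = 0"
    using v by (simp_all add: vec_labels_Suc)
  have pz: "part i (dG v) A = 0" for i A by (simp add: z part_def)
  have a: "bd ?t A + var c * st v A = 0" for A using pz[of 0 A] by (simp add: parts_dG)
  have b: "dK ?k B = Phi ?s B" if "B \<noteq> {}" for B using pz[of 1 B] that by (simp add: parts_dG ne_def)
  have "bd ?s {} = dK (Phi ?s) {}" by (simp add: dK_Phi[OF V(3)] Phi_empty)
  also have "\<dots> = dK (dK ?k) {}" by (simp add: dK_empty b)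
  finally have "bd ?s {} = 0" by (simp add: dK_dK)
  moreover have "bd ?s A = 0" if "A \<noteq> {}" for A using pz[of 2 A] that by (simp add: parts_dG ne_def)
  ultimately have "bd ?s A = 0" for A by (cases "A = {}") auto
  then have bs: "bd ?s = (\<lambda>_. 0)" by (rule ext)
  \<comment> \<open>For \<open>m = 0\<close> the Taylor complex is not exact in the degree of
    \<open>st v\<close>; there the regularity of \<open>c\<close> modulo the ideal of the edges {par
    a, a} takes over.\<close>
  have "\<exists>s1. supp X (Suc m) s1 \<and> bd s1 = st v \<and> bd (\<lambda>A. ?t A + var c * s1 A) = (\<lambda>_. 0)"
  proof (cases m)
    case 0
    have t: "supp X 1 ?t" using V(1) 0 by (simp add: One_nat_def)
    obtain s where s: "supp X 1 s" "bd s = st v" "bd (\<lambda>A. ?t A + var c * s A) = (\<lambda>_. 0)"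
      by (rule divide_by_center[OF t a])
    show ?thesis using s 0 by (intro exI[of _ s]) (simp add: One_nat_def)
  next
    case (Suc n)
    have "supp Y (Suc n) (dK ?k)" using V(2) Suc by (intro supp_dK) simp
    then have st: "st v = ?s" using supp_pr0[of Y "Suc n" "dK ?k"] by (simp add: st_def)
    have m: "m > 0" using Suc by simp
    obtain s1 where s1: "supp X (Suc m) s1" "bd s1 = ?s" by (rule bd_exact[OF V(3) m bs])
    have "bd (\<lambda>A. ?t A + var c * s1 A) = (\<lambda>_. 0)"
      using a by (simp add: qlinear_add[OF qlinear_bd] qlinear_scale[OF qlinear_bd] s1(2) st)
    then show ?thesis using s1 st by auto
  qed
  then obtain s1 where s1: "supp X (Suc m) s1" "bd s1 = st v" "bd (\<lambda>A. ?t A + var c * s1 A) = (\<lambda>_. 0)" by blast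
  have nst: "ne (st v) = ?s" using V(4) by (simp add: st_def ne_def pr0_def fun_eq_iff)
  have "Phi (st v) = (\<lambda>B. Phi ?s B + pr0 (dK ?k) B)"
    unfolding st_def by (simp add: qlinear_add[OF qlinear_Phi] Phi_pr0)
  then have Pst: "Phi (st v) = dK ?k" using b V(4) by (auto simp: fun_eq_iff pr0_def Phi_empty)
  have "supp X (Suc m) (\<lambda>A. ?t A + var c * s1 A)" by (intro supp_add supp_scale V(1) s1(1))
  then obtain t1 where t1: "supp X (Suc (Suc m)) t1" "bd t1 = (\<lambda>A. ?t A + var c * s1 A)"
    by (rule bd_exact[OF _ zero_less_Suc s1(3)])
  have sk: "supp Y (Suc m) (\<lambda>B. ?k B - Phi s1 B)" by (intro supp_diff supp_Phi V(2) s1(1))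
  have "dK (\<lambda>B. ?k B - Phi s1 B) = (\<lambda>_. 0)"
    by (simp add: qlinear_diff[OF qlinear_dK] dK_Phi[OF s1(1)] s1(2) Pst)
  then obtain k1 where k1: "supp Y (Suc (Suc m)) k1" "dK k1 = (\<lambda>B. ?k B - Phi s1 B)"
    by (rule koszul_exact[OF sk zero_less_Suc])
  define v' where "v' = glue t1 k1 (\<lambda>A. - s1 A)"
  have "s1 {} = 0" using s1(1) by (auto simp: supp_def)
  then have v': "vec (labels (Suc (Suc m))) v'"
    unfolding v'_def by (intro vec_labels_glue t1(1) k1(1) supp_uminus s1(1)) simp
  have stv': "st v' = (\<lambda>A. - s1 A)"
    using supp_pr0[OF sk] by (simp add: st_def v'_def k1(2))
  have nk: "ne ?k = ?k" using V(2) by (auto simp: ne_def supp_def fun_eq_iff)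
  have "dG v' = glue ?t ?k ?s"
    unfolding dG_def stv'
    by (simp add: v'_def t1(2) k1(2) qlinear_uminus[OF qlinear_Phi] qlinear_uminus[OF qlinear_bd] s1(2) nst nk)
  also have "\<dots> = v" by (rule glue_part) (rule V(5))
  finally show ?thesis using v' by blast
qed

section \<open>Internal degrees, minimality and the image of the first differential\<close>

lemma homogeneous_sg: "homogeneous p t \<Longrightarrow> homogeneous (sg U W * p) t" "homogeneous p t \<Longrightarrow> homogeneous (p * sg U W) t"
  using sg_cases[of U W] homogeneous_uminus by auto

lemma homogeneous_var_mult: "homogeneous p (t - 1) \<Longrightarrow> homogeneous (var a * p) t"
  using homogeneous_mult[OF homogeneous_var, of p "t - 1" a] by simp

lemma homogeneous_dK:
  assumes "\<And>A. homogeneous (u A) (t - int (card A))"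
  shows "homogeneous (dK u A) (t - int (card A))"
  unfolding dK_var
proof (rule homogeneous_sum)
  fix v
  have "homogeneous (contr v u A) (t - int (card A) - 1)"
    using assms[of "insert v A"] by (auto simp: contr_def algebra_simps intro!: homogeneous_sg)
  then show "homogeneous (var v * contr v u A) (t - int (card A))" by (rule homogeneous_var_mult)
qed

lemma homogeneous_bd:
  assumes u: "\<And>A. homogeneous (u A) (t - int (card A) - int (card (par ` A)))"
  shows "homogeneous (bd u A) (t - int (card A) - int (card (par ` A)))"
  unfolding bd_def
proof (intro homogeneous_sum homogeneous_sg homogeneous_var_mult)
  fix a assume "a \<in> X - A"
  then show "homogeneous ((if par a \<in> par ` A then 1 else var (par a)) * u (insert a A))
      (t - int (card A) - int (card (par ` A)) - 1)"
    using u[of "insert a A"] by (auto simp: insert_absorb algebra_simps intro!: homogeneous_var_mult)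
qed

lemma homogeneous_Phi:
  assumes u: "\<And>A. homogeneous (u A) (t - int (card A) - int (card (par ` A)))"
  shows "homogeneous (Phi u B) (t - int (card B))"
  unfolding Phi_def
proof (rule homogeneous_sum)
  fix A assume "A \<in> transv B"
  then have "card (par ` A) = card B" by (auto simp: transv_def)
  then show "homogeneous (xm A * u A) (t - int (card B))"
    using homogeneous_mult[OF homogeneous_prod_var u[of A], of A] by (simp add: xm_def)
qed

text \<open>The degree of the least common multiple of the edges in a label, with 1 for
  \<open>c\<close> in the copies labelled 1 and 2.\<close>

definition label_degree :: "nat \<times> 'v set \<Rightarrow> int" where
  "label_degree = (\<lambda>(i, A). int (if i = 0 then card A + card (par ` A) else if i = 1 then card A + 1
     else if i = 2 then card A + card (par ` A) + 1 else 0))"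

lemma hvec_dG:
  assumes v: "hvec label_degree \<tau> v"
  shows "hvec label_degree \<tau> (dG v)"
proof -
  have h: "homogeneous (v (i, A)) (\<tau> - label_degree (i, A))" for i A
    using v unfolding hvec_def by blast
  have t: "homogeneous (part 0 v A) (\<tau> - int (card A) - int (card (par ` A)))" for A
    using h[of 0 A] by (simp add: part_def label_degree_def algebra_simps)
  have k: "homogeneous (part 1 v A) (\<tau> - 1 - int (card A))" for A
    using h[of 1 A] by (simp add: part_def label_degree_def algebra_simps)
  have s: "homogeneous (part 2 v A) (\<tau> - 1 - int (card A) - int (card (par ` A)))" for A
    using h[of 2 A] by (simp add: part_def label_degree_def algebra_simps)
  have "homogeneous (st v A) (\<tau> - 1 - int (card A) - int (card (par ` A)))" for A
    unfolding st_def pr0_def using homogeneous_dK[OF k, of "{}"] s[of A] by (auto intro!: homogeneous_add)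
  then have st: "homogeneous (st v A) (\<tau> - int (card A) - int (card (par ` A)) - 1)" for A
    by (simp add: algebra_simps)
  have 0: "homogeneous (part 0 (dG v) A) (\<tau> - int (card A) - int (card (par ` A)))" for A
    unfolding parts_dG by (intro homogeneous_add homogeneous_bd t homogeneous_var_mult st)
  have 1: "homogeneous (part 1 (dG v) A) (\<tau> - 1 - int (card A))" for A
    unfolding parts_dG ne_def
    using homogeneous_add[OF homogeneous_dK[OF k, of A] homogeneous_uminus[OF homogeneous_Phi[OF s, of A]]] by simp
  have 2: "homogeneous (part 2 (dG v) A) (\<tau> - 1 - int (card A) - int (card (par ` A)))" for A
    unfolding parts_dG ne_def using homogeneous_uminus[OF homogeneous_bd[OF s], of A] by simp
  show ?thesis
    unfolding hvec_def
  proof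
    fix b :: "nat \<times> 'v set"
    obtain i A where b: "b = (i, A)" by (cases b)
    consider "i = 0" | "i = 1" | "i = 2" | "i > 2" by linarith
    then show "homogeneous (dG v b) (\<tau> - label_degree b)"
    proof cases
      case 1
      then show ?thesis using 0[of A] b by (simp add: part_def label_degree_def algebra_simps)
    next
      case 2
      then show ?thesis using \<open>\<And>A. homogeneous (part 1 (dG v) A) _\<close>[of A] b
        by (simp add: part_def label_degree_def algebra_simps)
    next
      case 3
      then show ?thesis using \<open>\<And>A. homogeneous (part 2 (dG v) A) _\<close>[of A] b
        by (simp add: part_def label_degree_def algebra_simps)
    qed (simp add: b dG_def glue_def)
  qed
qed

lemma lookup_var_mult_0: "Poly_Mapping.lookup (var a * p) 0 = 0"
  by (simp add: lookup_var_mult)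

lemma lookup_sg_mult_0: "Poly_Mapping.lookup p 0 = 0 \<Longrightarrow> Poly_Mapping.lookup (sg U W * p :: ('v, 'k) mpoly) 0 = 0"
  by (simp add: lookup_mult_zero)

lemma dG_minimal:
  assumes v: "vec (labels (Suc m)) v"
  shows "Poly_Mapping.lookup (dG v b) 0 = 0"
proof -
  have s0: "part 2 v {} = 0" using v by (simp add: vec_labels_Suc)
  have dK0: "Poly_Mapping.lookup (dK u A) 0 = 0" for u A
    by (simp add: dK_var lookup_sum lookup_var_mult_0)
  have bd0: "Poly_Mapping.lookup (bd u A) 0 = 0" for u A
    by (simp add: bd_def lookup_sum lookup_var_mult_0 lookup_sg_mult_0)
  \<comment> \<open>Only the empty transversal could give a unit entry of \<open>Phi\<close>, and
    \<open>part 2 v\<close> vanishes there.\<close>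
  have Phi0: "Poly_Mapping.lookup (Phi (part 2 v) B) 0 = 0" for B
    unfolding Phi_def lookup_sum
  proof (rule sum.neutral, rule ballI)
    fix A assume "A \<in> transv B"
    show "Poly_Mapping.lookup (xm A * part 2 v A) 0 = 0"
    proof (cases "A = {}")
      case False
      then obtain a where "a \<in> A" by blast
      then have "xm A = (var a * (\<Prod>a\<in>A - {a}. var a) :: ('v, 'k) mpoly)" unfolding xm_def by (intro prod.remove) auto
      then show ?thesis by (simp add: mult.assoc lookup_var_mult_0)
    qed (simp add: s0)
  qed
  obtain i A where b: "b = (i, A)" by (cases b)
  show ?thesis
    by (simp add: b dG_def glue_def ne_def lookup_add lookup_minus lookup_var_mult_0 dK0 bd0 Phi0)
qed

lemma edge_ideal_sum: "(\<And>i. i \<in> I \<Longrightarrow> f i \<in> edge_ideal E) \<Longrightarrow> (\<Sum>i\<in>I. f i) \<in> edge_ideal E"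
  by (induction I rule: infinite_finite_induct) (auto intro: edge_ideal_add edge_ideal_zero)

lemma edge_monomial_in: "e \<in> E \<Longrightarrow> edge_monomial e \<in> (edge_ideal E :: ('v, 'k) mpoly set)"
proof -
  assume e: "e \<in> E"
  have "(\<Sum>e'\<in>E. (if e' = e then 1 else 0) * edge_monomial e') = (\<Sum>e'\<in>E. if e' = e then edge_monomial e' else (0 :: ('v, 'k) mpoly))"
    by (rule sum.cong) auto
  also have "\<dots> = edge_monomial e" using e by simp
  finally show ?thesis
    unfolding edge_ideal_def by (intro CollectI exI[of _ "\<lambda>e'. if e' = e then 1 else 0"] conjI TrueI) (rule sym)
qed

lemma dG_image:
  assumes E: "E = (\<lambda>y. {c, y}) ` Y \<union> (\<lambda>a. {par a, a}) ` X"
  shows "{dG v | v. vec (labels 1) v} = {u. vec {(0, {})} u \<and> u (0, {}) \<in> edge_ideal E}"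
proof -
  have m1: "edge_monomial {c, y} = (var c * var y :: ('v, 'k) mpoly)" if "y \<in> Y" for y
  proof -
    have "c \<noteq> y" using that c by auto
    then show ?thesis by (simp add: edge_monomial_def)
  qed
  have m2: "edge_monomial {par a, a} = (var (par a) * var a :: ('v, 'k) mpoly)" if "a \<in> X" for a
    using that par[OF that] XY by (subst edge_monomial_def, subst prod.insert) auto
  have ev: "dG v (0, {}) = (\<Sum>a\<in>X. var a * (var (par a) * part 0 v {a})) + var c * (part 2 v {} + (\<Sum>y\<in>UNIV. var y * part 1 v {y}))" for v
    by (simp add: dG_def glue_def bd_def st_def pr0_def dK_empty)
  have v1: "vec {(0, {})} (dG v)" if "vec (labels 1) v" for v
    using vec_dG[of 0 v] that by (simp add: labels_0 One_nat_def)
  have "dG v (0, {}) \<in> edge_ideal E" if v: "vec (labels 1) v" for v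
  proof -
    have V: "supp Y 1 (part 1 v)" "part 2 v {} = 0" using v vec_labels_Suc[of 0 v] by (simp_all add: One_nat_def)
    have "var a * (var (par a) * part 0 v {a}) \<in> edge_ideal E" if a: "a \<in> X" for a
    proof -
      have "part 0 v {a} * edge_monomial {par a, a} \<in> edge_ideal E"
        by (intro edge_ideal_mult edge_monomial_in) (use a E in auto)
      then show ?thesis by (simp add: m2[OF a] mult_ac)
    qed
    moreover have "var c * (var y * part 1 v {y}) \<in> edge_ideal E" for y
    proof (cases "y \<in> Y")
      case True
      have "part 1 v {y} * edge_monomial {c, y} \<in> edge_ideal E"
        by (intro edge_ideal_mult edge_monomial_in) (use True E in auto)
      then show ?thesis by (simp add: m1[OF True] mult_ac)
    next
      case False
      then have "part 1 v {y} = 0" using V(1) by (auto simp: supp_def)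
      then show ?thesis by (simp add: edge_ideal_zero)
    qed
    ultimately show ?thesis
      unfolding ev V(2) add_0 sum_distrib_left by (intro edge_ideal_add edge_ideal_sum)
  qed
  moreover have "\<exists>v. vec (labels 1) v \<and> dG v = u" if u: "vec {(0, {})} u" "u (0, {}) \<in> edge_ideal E" for u
  proof -
    obtain f where f: "u (0, {}) = (\<Sum>e\<in>E. f e * edge_monomial e)" using u(2) by (auto simp: edge_ideal_def)
    have "\<exists>v. vec (labels 1) v \<and> dG v (0, {}) = edge_monomial e" if eE: "e \<in> E" for e
    proof -
      have "e \<in> (\<lambda>y. {c, y}) ` Y \<union> (\<lambda>a. {par a, a}) ` X" using eE E by simp
      then consider y where "y \<in> Y" "e = {c, y}" | a where "a \<in> X" "e = {par a, a}" by auto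
      then show ?thesis
      proof cases
        case 1
        have p: "part 0 (unitv (1, {y})) = (\<lambda>_. 0 :: ('v, 'k) mpoly)" "part 2 (unitv (1, {y})) = (\<lambda>_. 0 :: ('v, 'k) mpoly)"
          "part 1 (unitv (1, {y})) = (\<lambda>A. if A = {y} then 1 else 0 :: ('v, 'k) mpoly)"
          by (auto simp: part_def unitv_def fun_eq_iff)
        have s: "(\<Sum>v\<in>UNIV. var v * (if v = y then 1 else 0)) = (var y :: ('v, 'k) mpoly)"
        proof -
          have "(\<Sum>v\<in>UNIV. var v * (if v = y then 1 else 0)) = (\<Sum>v\<in>UNIV. if v = y then var v else (0 :: ('v, 'k) mpoly))"
            by (intro sum.cong) auto
          then show ?thesis by simp
        qed
        have L: "(1, {y}) \<in> labels 1" using 1 by (simp add: labels_def)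
        have D: "dG (unitv (1, {y})) (0, {}) = edge_monomial e"
          unfolding ev p using 1 s by (simp add: m1)
        show ?thesis by (rule exI[of _ "unitv (1, {y})"]) (rule conjI[OF vec_unitv[OF L] D])
      next
        case 2
        have p: "part 1 (unitv (0, {a})) = (\<lambda>_. 0 :: ('v, 'k) mpoly)" "part 2 (unitv (0, {a})) = (\<lambda>_. 0 :: ('v, 'k) mpoly)"
          "part 0 (unitv (0, {a})) = (\<lambda>A. if A = {a} then 1 else 0 :: ('v, 'k) mpoly)"
          by (auto simp: part_def unitv_def fun_eq_iff)
        have s: "(\<Sum>v\<in>X. var v * (var (par v) * (if v = a then 1 else 0))) = (var a * var (par a) :: ('v, 'k) mpoly)"
        proof -
          have "(\<Sum>v\<in>X. var v * (var (par v) * (if v = a then 1 else 0))) = (\<Sum>v\<in>X. if v = a then var v * var (par v) else (0 :: ('v, 'k) mpoly))"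
            by (intro sum.cong) auto
          then show ?thesis using 2 by simp
        qed
        have L: "(0, {a}) \<in> labels 1" using 2 by (simp add: labels_def)
        have D: "dG (unitv (0, {a})) (0, {}) = edge_monomial e"
          unfolding ev p using 2 s by (simp add: m2 mult.commute)
        show ?thesis by (rule exI[of _ "unitv (0, {a})"]) (rule conjI[OF vec_unitv[OF L] D])
      qed
    qed
    then have "\<forall>e\<in>E. \<exists>v. vec (labels 1) v \<and> dG v (0, {}) = edge_monomial e" by (rule ballI)
    from bchoice[OF this] obtain W where W: "\<forall>e\<in>E. vec (labels 1) (W e) \<and> dG (W e) (0, {}) = edge_monomial e" by (rule exE)
    let ?v = "\<lambda>b. \<Sum>e\<in>E. f e * W e b"
    have vv: "vec (labels 1) ?v" using W by (intro vec_sum vec_scale) auto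
    have "dG ?v = (\<lambda>b. \<Sum>e\<in>E. f e * dG (W e) b)"
      by (simp add: qlinear_sum[OF qlinear_dG] qlinear_scale[OF qlinear_dG])
    then have e0: "dG ?v (0, {}) = u (0, {})" using W f by simp
    have "dG ?v b = u b" for b
      using e0 v1[OF vv] u(1) by (cases "b = (0, {})") (simp, simp only: vec_def singleton_iff not_False_eq_True)
    then have "dG ?v = u" by (rule ext)
    with vv show ?thesis by blast
  qed
  ultimately show ?thesis using v1 by (intro equalityI subsetI; elim CollectE exE conjE) (simp, fastforce)
qed

theorem admits_dga:
  fixes F :: "('v, 'k) mpoly cplx"
  assumes E: "E = (\<lambda>y. {c, y}) ` Y \<union> (\<lambda>a. {par a, a}) ` X" and F: "is_min_free_res E F"
  shows "admits_dga_structure F"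
proof -
  have ex: "{v. vec (labels (Suc i)) v \<and> dG v = (\<lambda>_. 0)} = {dG u | u. vec (labels (Suc (Suc i))) u}" for i
  proof (intro equalityI subsetI)
    fix v assume "v \<in> {v. vec (labels (Suc i)) v \<and> dG v = (\<lambda>_. 0)}"
    then show "v \<in> {dG u | u. vec (labels (Suc (Suc i))) u}" using dG_exact[of i v] by auto
  next
    fix v assume "v \<in> {dG u | u. vec (labels (Suc (Suc i))) u}"
    then obtain u where "v = dG u" "vec (labels (Suc (Suc i))) u" by blast
    then show "v \<in> {v. vec (labels (Suc i)) v \<and> dG v = (\<lambda>_. 0)}" using vec_dG dG_dG by simp
  qed
  have gr: "graded_map (labels (Suc i)) label_degree label_degree dG" for i
    unfolding graded_map_def by (intro ballI hvec_dG hvec_unitv)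
  have deg0: "label_degree (0, {}) = 0" by (simp add: label_degree_def)
  obtain \<alpha> where \<alpha>: "\<And>i. qlinear (\<alpha> i)" "\<And>i. bij_betw (\<alpha> i) {v. inF F i v} {w. vec (labels i) w}"
    "\<And>i v. inF F (Suc i) v \<Longrightarrow> dG (\<alpha> (Suc i) v) = \<alpha> i (dd F (Suc i) v)"
    by (rule minimal_res_unique[where B = labels and \<delta> = "\<lambda>_. label_degree" and d = "\<lambda>_. dG",
          OF F finite_labels labels_0 deg0 qlinear_dG gr dG_image[OF E] ex dG_minimal]) (assumption, rule that)
  have in\<alpha>: "vec (labels i) (\<alpha> i a)" if "inF F i a" for i a
    using bij_betw_apply[OF \<alpha>(2), of a i] that by simp
  have sur: "\<exists>z. inF F i z \<and> \<alpha> i z = v" if v: "vec (labels i) v" for i v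
  proof -
    have "v \<in> \<alpha> i ` {v. inF F i v}" using bij_betw_imp_surj_on[OF \<alpha>(2)[of i]] v by simp
    then show ?thesis by blast
  qed
  show ?thesis
  proof (rule admits_dga_of_embedding[where ?\<Theta>1.0 = "\<lambda>i v. J1 (\<alpha> i v)" and ?\<Theta>2.0 = "\<lambda>i v. J2 (\<alpha> i v)"])
    show "qlinear (\<lambda>v. J1 (\<alpha> i v))" "qlinear (\<lambda>v. J2 (\<alpha> i v))" for i
      by (rule qlinear_comp[OF \<alpha>(1) qlinear_J1], rule qlinear_comp[OF \<alpha>(1) qlinear_J2])
    show "pure i (J1 (\<alpha> i a))" "pure i (J2 (\<alpha> i a))" if "inF F i a" for i a
      by (rule pure_J(1)[OF in\<alpha>[OF that]], rule pure_J(2)[OF in\<alpha>[OF that]])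
    show "a = (\<lambda>_. 0)" if a: "inF F i a" "J1 (\<alpha> i a) = (\<lambda>_. 0)" "J2 (\<alpha> i a) = (\<lambda>_. 0)" for i a
    proof -
      have "\<alpha> i a = \<alpha> i (\<lambda>_. 0)" using J_inj[OF in\<alpha>[OF a(1)] a(2,3)] by (simp add: qlinear_zero[OF \<alpha>(1)])
      then show ?thesis using bij_betw_imp_inj_on[OF \<alpha>(2)[of i]] a(1) by (auto simp: inj_on_def inF_def)
    qed
    show "J1 (\<alpha> i (dd F (Suc i) a)) = dK (J1 (\<alpha> (Suc i) a))" "J2 (\<alpha> i (dd F (Suc i) a)) = dK (J2 (\<alpha> (Suc i) a))"
      if a: "inF F (Suc i) a" for i a
      using J1_dG[OF in\<alpha>[OF a]] J2_dG[OF in\<alpha>[OF a]] by (simp_all add: \<alpha>(3)[OF a])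
    have "vec (labels 0) (unitv (0, {}) :: nat \<times> 'v set \<Rightarrow> ('v, 'k) mpoly)" unfolding labels_0 by (rule vec_unitv) simp
    from sur[OF this] obtain e where "inF F 0 e" "\<alpha> 0 e = unitv (0, {})" by (elim exE conjE)
    then show "\<exists>e. inF F 0 e \<and> J1 (\<alpha> 0 e) = oneK \<and> J2 (\<alpha> 0 e) = oneK"
      by (intro exI[of _ e]) (simp add: J_unit)
    show "\<exists>z. inF F (i + j) z \<and> J1 (\<alpha> (i + j) z) = wedge (J1 (\<alpha> i a)) (J1 (\<alpha> j b)) \<and>
        J2 (\<alpha> (i + j) z) = wedge (J2 (\<alpha> i a)) (J2 (\<alpha> j b))" if ab: "inF F i a" "inF F j b" for i j a b
    proof -
      obtain v where v: "vec (labels (i + j)) v" "J1 v = wedge (J1 (\<alpha> i a)) (J1 (\<alpha> j b))"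
          "J2 v = wedge (J2 (\<alpha> i a)) (J2 (\<alpha> j b))"
        using J_mult[OF in\<alpha>[OF ab(1)] in\<alpha>[OF ab(2)]] by (elim exE conjE)
      obtain z where "inF F (i + j) z" "\<alpha> (i + j) z = v" using sur[OF v(1)] by (elim exE conjE)
      then show ?thesis using v(2,3) by (intro exI[of _ z]) simp
    qed
  qed
qed

end

section \<open>Choice of the enumeration and the two directions of the equivalence\<close>

lemma ex_compatible_order:
  fixes par :: "'v::finite \<Rightarrow> 'v"
  assumes "X \<inter> Y = {}" and "\<forall>a\<in>X. par a \<in> Y"
  obtains r :: "'v \<Rightarrow> nat" where "inj r"
    "\<And>a b. a \<in> X \<Longrightarrow> b \<in> X \<Longrightarrow> r (par a) < r (par b) \<Longrightarrow> r a < r b"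
proof -
  obtain n :: "'v \<Rightarrow> nat" where n: "inj n" using finite_imp_inj_to_nat_seg[of "UNIV :: 'v set"] by auto
  define N where "N = Suc (Max (range n))"
  have nN: "n v < N" for v unfolding N_def by (simp add: le_imp_less_Suc)
  \<comment> \<open>Leaves come after all other vertices and are sorted by parent first: division by
    \<open>N\<close> returns the number of the parent plus one for a leaf and 0 otherwise, and the
    remainder keeps \<open>r\<close> injective.\<close>
  define r where "r v = (if v \<in> X then Suc (n (par v)) * N + n v else n v)" for v
  have rdiv: "r v div N = (if v \<in> X then Suc (n (par v)) else 0)" for v
    using nN[of v] by (auto simp: r_def div_add1_eq)
  have rmod: "r v mod N = n v" for v using nN[of v] by (simp add: r_def del: mult_Suc)
  have "inj r"
  proof (rule injI)
    fix a b assume "r a = r b"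
    then have "n a = n b" using rmod by metis
    then show "a = b" using n by (simp add: inj_eq)
  qed
  moreover have "r a < r b" if "a \<in> X" "b \<in> X" "r (par a) < r (par b)" for a b
  proof -
    have "par a \<notin> X" "par b \<notin> X" using assms that(1,2) by auto
    then have "n (par a) < n (par b)" using that(3) by (simp add: r_def)
    then have "r a div N < r b div N" using that(1,2) by (simp add: rdiv)
    then show ?thesis by (metis div_le_mono not_less)
  qed
  ultimately show ?thesis by (rule that)
qed

lemma tree_diameter_le_4_admits_dga:
  fixes F :: "('v::finite, 'k::field) mpoly cplx"
  assumes E: "is_tree E" "diameter E \<le> 4" and F: "is_min_free_res E F"
  shows "admits_dga_structure F"
proof -
  obtain c Y X par where T: "c \<notin> Y" "c \<notin> X" "X \<inter> Y = {}" "\<forall>x\<in>X. par x \<in> Y"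
    and E': "E = (\<lambda>y. {c, y}) ` Y \<union> (\<lambda>x. {par x, x}) ` X"
    by (rule tree_diameter4_structure[OF E])
  obtain r :: "'v \<Rightarrow> nat" where r: "inj r"
    "\<And>a b. a \<in> X \<Longrightarrow> b \<in> X \<Longrightarrow> r (par a) < r (par b) \<Longrightarrow> r a < r b"
    by (rule ex_compatible_order[OF T(3,4)]) (rule that)
  interpret star_tree r "var :: 'v \<Rightarrow> ('v, 'k) mpoly" c Y X par
    by unfold_locales (use T r in auto)
  show ?thesis by (rule admits_dga[OF E' F])
qed

lemma tree_diameter_ge_5_no_dga:
  fixes F :: "('v::finite, 'k::field) mpoly cplx"
  assumes E: "is_tree E" "diameter E \<ge> 5" and F: "is_min_free_res E F"
  shows "\<not> admits_dga_structure F"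
proof -
  obtain p where p: "is_path E p" "length p = 6"
    and ind: "\<And>i j. i < 6 \<Longrightarrow> j < 6 \<Longrightarrow> {p ! i, p ! j} \<in> E \<Longrightarrow> j = Suc i \<or> i = Suc j"
    by (rule induced_path6[OF E]) (rule that)
  have sg: "simple_graph E" using E(1) by (simp add: is_tree_def)
  have adj: "{p ! i, p ! Suc i} \<in> E" if "i < 5" for i using p that by (simp add: is_path_def adj_def)
  have pe: "p = [p ! 0, p ! 1, p ! 2, p ! 3, p ! 4, p ! 5]"
    by (rule nth_equalityI) (auto simp: p(2) less_Suc_eq numeral_eq_Suc)
  have dist: "distinct [p ! 0, p ! 1, p ! 2, p ! 3, p ! 4, p ! 5]"
    using p(1) pe by (simp add: is_path_def)
  let ?V = "{p ! 0, p ! 1, p ! 2, p ! 3, p ! 4, p ! 5}"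
  let ?P = "{{p ! 0, p ! 1}, {p ! 1, p ! 2}, {p ! 2, p ! 3}, {p ! 3, p ! 4}, {p ! 4, p ! 5}}"
  have V: "?V = (!) p ` {..<6}" by (auto simp: numeral_eq_Suc lessThan_Suc)
  have P: "?P = (\<lambda>i. {p ! i, p ! Suc i}) ` {..<5}" by (simp add: numeral_eq_Suc lessThan_Suc insert_commute)
  have "{e \<in> E. e \<subseteq> ?V} = ?P"
  proof (intro equalityI subsetI)
    fix e assume "e \<in> {e \<in> E. e \<subseteq> ?V}"
    then have e: "e \<in> E" "e \<subseteq> (!) p ` {..<6}" unfolding V by auto
    have "card e = 2" using sg e(1) by (simp add: simple_graph_def)
    then obtain u v where uv: "e = {u, v}" by (auto simp: card_2_iff)
    then obtain i j where ij: "i < 6" "j < 6" "u = p ! i" "v = p ! j" using e(2) by auto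
    have "j = Suc i \<or> i = Suc j" using ind[OF ij(1,2)] e(1) uv ij by simp
    then show "e \<in> ?P"
    proof
      assume "j = Suc i"
      then show ?thesis unfolding P using ij uv by (intro image_eqI[of _ _ i]) auto
    next
      assume "i = Suc j"
      then show ?thesis unfolding P using ij uv by (intro image_eqI[of _ _ j]) auto
    qed
  next
    fix e assume "e \<in> ?P"
    then obtain i where i: "i < 5" "e = {p ! i, p ! Suc i}" unfolding P by auto
    then show "e \<in> {e \<in> E. e \<subseteq> ?V}" unfolding V using adj by auto
  qed
  then interpret res_path6 E F "p ! 0" "p ! 1" "p ! 2" "p ! 3" "p ! 4" "p ! 5"
    by unfold_locales (use F sg dist in simp_all)
  show ?thesis using no_dga_structure by (auto simp: admits_dga_structure_def)
qed

text \<open>The existence clause keeps the equivalence over all minimal resolutions from being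
  vacuous.\<close>

theorem mainTheorem19:
  fixes E :: "('v::finite) set set"
  assumes "is_tree E"
  shows "(\<exists>F :: ('v, 'k::field) mpoly cplx. is_min_free_res E F) \<and>
         (\<forall>F :: ('v, 'k) mpoly cplx. is_min_free_res E F \<longrightarrow>
            (admits_dga_structure F \<longleftrightarrow> diameter E \<le> 4))"
proof (intro conjI allI impI iffI)
  show "\<exists>F :: ('v, 'k) mpoly cplx. is_min_free_res E F"
    by (rule ex_min_free_res) (use assms in \<open>simp add: is_tree_def\<close>)
next
  fix F :: "('v, 'k) mpoly cplx" assume "is_min_free_res E F" "diameter E \<le> 4"
  then show "admits_dga_structure F" using tree_diameter_le_4_admits_dga[OF assms] by blast
next
  fix F :: "('v, 'k) mpoly cplx" assume "is_min_free_res E F" "admits_dga_structure F"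
  then show "diameter E \<le> 4" using tree_diameter_ge_5_no_dga[OF assms, of F] by linarith
qed

end
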